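(* Let $\mathbb{K}$ be an algebraically closed field of characteristic zero, $T\cong(\mathbb{K}^\times)^r$ a torus with Lie algebra $\mathfrak t$, and $V=\bigoplus_{i=1}^n V_i$ an $n$-dimensional $T$-module with $V_i\cong\mathbb K$ of weight $s_i=(s_i^1,\dots,s_i^r)\in X^*(T)\cong\mathbb Z^r$. Let $S=(s_i^j)$ be the $n\times r$ weight matrix, and for $I\subseteq\{1,\dots,n\}$ let $S_I$ be the submatrix of rows indexed by $I$ and $S_{\hat\imath}:=S_{\{1,\dots,n\}\setminus\{i\}}$. Let $\mu:V\oplus V^*\to\mathfrak t^*$, $\mu(x,\varphi)(\xi)=\varphi(\xi\cdot x)$. Then: (i) $\mu^{-1}(0)$ is a reduced complete intersection of dimension $2\dim V-\operatorname{rk}S$; (ii) the irreducible components of $\mu^{-1}(0)$ are exactly the sets $\overline{\mu^{-1}(0)_{J_I}}$ with $\operatorname{rk}S-\operatorname{rk}S_I=n-\#I$; (iii) $\mu^{-1}(0)$ is irreducible if and only if $\operatorname{rk}S_{\hat\imath}=\operatorname{rk}S$ for every $i\in\{1,\dots,n\}$; (iv) $\mu^{-1}(0)$ is normal if and only if it is irreducible.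
   Context: For $I\subseteq\{1,\dots,n\}$, $J_I:=\{(v_i)_i\in V\mid v_i\neq0\Leftrightarrow i\in I\}$, and $\mu^{-1}(0)_{J_I}:=\{(x,\varphi)\in J_I\times V^*\mid \varphi\in(\mathfrak t\cdot x)^\perp\}$. *)

theory Defs
  imports "HOL-Library.Poly_Mapping" "HOL-Computational_Algebra.Polynomial"
begin

type_synonym ('v, 'a) mpoly = "('v \<Rightarrow>\<^sub>0 nat) \<Rightarrow>\<^sub>0 'a"

definition Var :: "'v \<Rightarrow> ('v, 'a::comm_ring_1) mpoly" where
  "Var v = Poly_Mapping.single (Poly_Mapping.single v 1) 1"

definition mon_eval :: "('v \<Rightarrow> 'a::comm_ring_1) \<Rightarrow> ('v \<Rightarrow>\<^sub>0 nat) \<Rightarrow> 'a" where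
  "mon_eval a m = (\<Prod>v\<in>Poly_Mapping.keys m. a v ^ Poly_Mapping.lookup m v)"

definition peval :: "('v \<Rightarrow> 'a::comm_ring_1) \<Rightarrow> ('v, 'a) mpoly \<Rightarrow> 'a" where
  "peval a p = (\<Sum>m\<in>Poly_Mapping.keys p. Poly_Mapping.lookup p m * mon_eval a m)"

definition alg_closed :: "'a::field itself \<Rightarrow> bool" where
  "alg_closed _ \<longleftrightarrow> (\<forall>p::'a poly. degree p > 0 \<longrightarrow> (\<exists>x. poly p x = 0))"

definition is_ideal :: "'r::comm_ring_1 set \<Rightarrow> bool" where
  "is_ideal J \<longleftrightarrow> 0 \<in> J \<and> (\<forall>x\<in>J. \<forall>y\<in>J. x + y \<in> J) \<and> (\<forall>x\<in>J. \<forall>c. c * x \<in> J)"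

definition ideal_gen :: "'r::comm_ring_1 set \<Rightarrow> 'r set" where
  "ideal_gen G = \<Inter>{J. is_ideal J \<and> G \<subseteq> J}"

definition prime_ideal :: "'r::comm_ring_1 set \<Rightarrow> bool" where
  "prime_ideal P \<longleftrightarrow> is_ideal P \<and> 1 \<notin> P \<and> (\<forall>a b. a * b \<in> P \<longrightarrow> a \<in> P \<or> b \<in> P)"

definition radical :: "'r::comm_ring_1 set \<Rightarrow> 'r set" where
  "radical J = {f. \<exists>k. f ^ k \<in> J}"

definition reduced_quot :: "'r::comm_ring_1 set \<Rightarrow> bool" where
  "reduced_quot J \<longleftrightarrow> radical J = J"

definition has_prime_chain :: "'r::comm_ring_1 set \<Rightarrow> nat \<Rightarrow> bool" where
  "has_prime_chain J d \<longleftrightarrow>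
     (\<exists>Q::nat \<Rightarrow> 'r set. (\<forall>k\<le>d. prime_ideal (Q k) \<and> J \<subseteq> Q k) \<and> (\<forall>k<d. Q k \<subset> Q (Suc k)))"

definition krull_dim_quot :: "'r::comm_ring_1 set \<Rightarrow> nat \<Rightarrow> bool" where
  "krull_dim_quot J d \<longleftrightarrow> has_prime_chain J d \<and> \<not> has_prime_chain J (Suc d)"

text \<open>Closed subscheme V(J) of affine N-space (R a polynomial ring in N variables) is a
  complete intersection: J is generated by codim = N - dim many elements.\<close>
definition complete_intersection :: "nat \<Rightarrow> 'r::comm_ring_1 set \<Rightarrow> bool" where
  "complete_intersection N J \<longleftrightarrow>
     (\<exists>d. krull_dim_quot J d \<and> d \<le> N \<and> (\<exists>gs. length gs = N - d \<and> ideal_gen (set gs) = J))"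

text \<open>Normality of Spec(R/J): for every prime Q of R containing J the local ring
  (R/J)_Q is an integrally closed domain. Written out on representatives:
  a/1 = 0 in (R/J)_Q iff t*a in J for some t not in Q.\<close>
definition loc_zero :: "'r::comm_ring_1 set \<Rightarrow> 'r set \<Rightarrow> 'r \<Rightarrow> bool" where
  "loc_zero J Q a \<longleftrightarrow> (\<exists>t. t \<notin> Q \<and> t * a \<in> J)"

definition normal_local :: "'r::comm_ring_1 set \<Rightarrow> 'r set \<Rightarrow> bool" where
  "normal_local J Q \<longleftrightarrow>
     \<not> loc_zero J Q 1 \<and>
     (\<forall>a b. loc_zero J Q (a * b) \<longrightarrow> loc_zero J Q a \<or> loc_zero J Q b) \<and>
     (\<forall>a b. \<not> loc_zero J Q b \<longrightarrow>
        (\<exists>m>0. \<exists>c u. u \<notin> Q \<and>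
            loc_zero J Q (u * a ^ m + (\<Sum>k<m. c k * a ^ k * b ^ (m - k))))
        \<longrightarrow> (\<exists>c v. v \<notin> Q \<and> loc_zero J Q (a * v - b * c)))"

definition normal_quot :: "'r::comm_ring_1 set \<Rightarrow> bool" where
  "normal_quot J \<longleftrightarrow> (\<forall>Q. prime_ideal Q \<and> J \<subseteq> Q \<longrightarrow> normal_local J Q)"

definition zero_set :: "('v, 'a::comm_ring_1) mpoly set \<Rightarrow> ('v \<Rightarrow> 'a) set" where
  "zero_set F = {a. \<forall>f\<in>F. peval a f = 0}"

definition zclosed :: "('v \<Rightarrow> 'a::comm_ring_1) set \<Rightarrow> bool" where
  "zclosed X \<longleftrightarrow> (\<exists>F::('v, 'a) mpoly set. X = zero_set F)"

definition zclosure :: "('v \<Rightarrow> 'a::comm_ring_1) set \<Rightarrow> ('v \<Rightarrow> 'a) set" where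
  "zclosure A = \<Inter>{X. zclosed X \<and> A \<subseteq> X}"

definition zirreducible :: "('v \<Rightarrow> 'a::comm_ring_1) set \<Rightarrow> bool" where
  "zirreducible X \<longleftrightarrow> zclosed X \<and> X \<noteq> {} \<and>
     (\<forall>Y1 Y2. zclosed Y1 \<and> zclosed Y2 \<and> X \<subseteq> Y1 \<union> Y2 \<longrightarrow> X \<subseteq> Y1 \<or> X \<subseteq> Y2)"

definition irreducible_component :: "('v \<Rightarrow> 'a::comm_ring_1) set \<Rightarrow> ('v \<Rightarrow> 'a) set \<Rightarrow> bool" where
  "irreducible_component C X \<longleftrightarrow> zirreducible C \<and> C \<subseteq> X \<and>
     (\<forall>D. zirreducible D \<and> C \<subseteq> D \<and> D \<subseteq> X \<longrightarrow> D = C)"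

definition rows_indep :: "nat \<Rightarrow> ('n \<Rightarrow> nat \<Rightarrow> int) \<Rightarrow> 'n set \<Rightarrow> bool" where
  "rows_indep r S I \<longleftrightarrow>
     (\<forall>c::'n \<Rightarrow> rat. (\<forall>j<r. (\<Sum>i\<in>I. c i * of_int (S i j)) = 0) \<longrightarrow> (\<forall>i\<in>I. c i = 0))"

definition rank_rows :: "nat \<Rightarrow> ('n::finite \<Rightarrow> nat \<Rightarrow> int) \<Rightarrow> 'n set \<Rightarrow> nat" where
  "rank_rows r S I = Max (card ` {J. J \<subseteq> I \<and> rows_indep r S J})"

text \<open>Coordinates: Inl i = x_i (on V), Inr i = phi_i (on V^*). The j-th component of
  mu(x,phi) is sum_i s_i^j x_i phi_i.\<close>
definition mu_comp :: "nat \<Rightarrow> ('n::finite \<Rightarrow> nat \<Rightarrow> int) \<Rightarrow> nat \<Rightarrow> ('n + 'n, 'a::comm_ring_1) mpoly" where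
  "mu_comp r S j = (\<Sum>i\<in>UNIV. of_int (S i j) * Var (Inl i) * Var (Inr i))"

definition mu_ideal :: "nat \<Rightarrow> ('n::finite \<Rightarrow> nat \<Rightarrow> int) \<Rightarrow> ('n + 'n, 'a::comm_ring_1) mpoly set" where
  "mu_ideal r S = ideal_gen {mu_comp r S j | j. j < r}"

definition mu_zero :: "nat \<Rightarrow> ('n::finite \<Rightarrow> nat \<Rightarrow> int) \<Rightarrow> ('n + 'n \<Rightarrow> 'a::comm_ring_1) set" where
  "mu_zero r S = zero_set (mu_ideal r S)"

definition mu_zero_J :: "nat \<Rightarrow> ('n::finite \<Rightarrow> nat \<Rightarrow> int) \<Rightarrow> 'n set \<Rightarrow> ('n + 'n \<Rightarrow> 'a::comm_ring_1) set" where
  "mu_zero_J r S I = {p \<in> mu_zero r S. \<forall>i. p (Inl i) \<noteq> 0 \<longleftrightarrow> i \<in> I}"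

end

theory Submission
  imports Defs "HOL-Library.Countable" "HOL-Library.FuncSet"
begin

text \<open>Write \<open>u i = x i * \<phi> i\<close>. The ideal says that \<open>u\<close> satisfies the linear relations between the rows of
  the weight matrix, so modulo the ideal \<open>u i = l i\<close> is a linear form in the \<open>u j\<close> indexed by the
  complement of a row basis \<open>P\<close>, and the monomials without a factor \<open>x i * \<phi> i\<close>, \<open>i \<in> P\<close>, span the quotient.
  Let \<open>Z\<close> be the set of \<open>i\<close> with \<open>l i = 0\<close>. Sending \<open>x i\<close> to a Laurent variable and \<open>\<phi> i\<close> to \<open>l i / x i\<close>
  (killing one of the two if \<open>i \<in> Z\<close>) gives the spanning monomials distinct leading exponents. Hence the ideal is
  radical, and for empty \<open>Z\<close> the quotient is a subring of a Laurent polynomial ring. Its leading exponents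
  form a saturated semigroup, so it is completely integrally closed and thus normal. Counting the
  spanning monomials bounds the Krull dimension from above, and explicit irreducible subsets of the zero fibre
  bound it from below. The components correspond to the subsets of \<open>Z\<close>, and if \<open>Z\<close> is nonempty
  several of them pass through the origin, where normality fails.\<close>

text \<open>The linear forms \<open>l i\<close> usually have several terms, so the image in the
  Laurent ring is not a toric ring; only its algebra of leading terms is. Normality is lifted from
  the semigroup of leading exponents by subduction. This is why almost integral fractions are used
  in place of integral ones: that \<open>b ^ k\<close> divides \<open>c * a ^ k\<close> for every
  \<open>k\<close> is a divisibility statement and can be read off on leading exponents. The set
  \<open>Z\<close> depends on the weight matrix alone. It consists of the coloops of the rows, the
  indices at which every linear relation between the rows has coefficient zero. Both rank conditions
  come down to this: deleting rows lowers the rank by their number exactly when all of them are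
  coloops.\<close>

section \<open>Arithmetic of ideals and primes\<close>

lemma is_ideal_ideal_gen: "is_ideal (ideal_gen G)"
  unfolding ideal_gen_def is_ideal_def by auto

lemma ideal_gen_superset: "G \<subseteq> ideal_gen G"
  unfolding ideal_gen_def by auto

lemma ideal_gen_least: "is_ideal J \<Longrightarrow> G \<subseteq> J \<Longrightarrow> ideal_gen G \<subseteq> J"
  unfolding ideal_gen_def by auto

lemma ideal_zero: "is_ideal J \<Longrightarrow> 0 \<in> J"
  unfolding is_ideal_def by auto

lemma ideal_add: "is_ideal J \<Longrightarrow> x \<in> J \<Longrightarrow> y \<in> J \<Longrightarrow> x + y \<in> J"
  unfolding is_ideal_def by auto

lemma ideal_mult_left: "is_ideal J \<Longrightarrow> x \<in> J \<Longrightarrow> c * x \<in> J"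
  unfolding is_ideal_def by auto

lemma ideal_mult_right: "is_ideal J \<Longrightarrow> x \<in> J \<Longrightarrow> x * c \<in> J"
  using ideal_mult_left[of J x c] by (simp add: mult.commute)

lemma ideal_uminus: "is_ideal J \<Longrightarrow> x \<in> J \<Longrightarrow> - x \<in> J"
  using ideal_mult_left[of J x "-1"] by simp

lemma ideal_diff: "is_ideal J \<Longrightarrow> x \<in> J \<Longrightarrow> y \<in> J \<Longrightarrow> x - y \<in> J"
  using ideal_add[of J x "- y"] ideal_uminus[of J y] by simp

lemma ideal_sum: "is_ideal J \<Longrightarrow> (\<And>a. a \<in> A \<Longrightarrow> f a \<in> J) \<Longrightarrow> sum f A \<in> J"
  by (induction A rule: infinite_finite_induct) (auto intro: ideal_zero ideal_add)

lemma ideal_diff_trans: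
  assumes "is_ideal J" "a - b \<in> J" "b - c \<in> J"
  shows "a - c \<in> J"
  using ideal_add[OF assms] by simp

lemma prime_ideal_power:
  assumes "prime_ideal Q" "y ^ k * x \<in> Q" "y \<notin> Q"
  shows "x \<in> Q"
  using assms(2) by (induction k) (use assms in \<open>auto simp: prime_ideal_def mult.assoc\<close>)

lemma prime_ideal_D: "prime_ideal Q \<Longrightarrow> is_ideal Q"
  unfolding prime_ideal_def by auto

lemma prime_ideal_mult: "prime_ideal Q \<Longrightarrow> a * b \<in> Q \<Longrightarrow> a \<in> Q \<or> b \<in> Q"
  unfolding prime_ideal_def by auto

subsection \<open>Evaluation homomorphisms\<close>

lemma poly_mapping_sum_single: "p = (\<Sum>k\<in>Poly_Mapping.keys p. Poly_Mapping.single k (Poly_Mapping.lookup p k))"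
proof (rule poly_mapping_eqI)
  fix k
  show "Poly_Mapping.lookup p k = Poly_Mapping.lookup (\<Sum>k\<in>Poly_Mapping.keys p. Poly_Mapping.single k (Poly_Mapping.lookup p k)) k"
    by (auto simp: lookup_sum lookup_single when_def in_keys_iff)
qed

lemma mon_eval_superset:
  assumes "finite K" "Poly_Mapping.keys m \<subseteq> K"
  shows "mon_eval a m = (\<Prod>v\<in>K. a v ^ Poly_Mapping.lookup m v)"
  unfolding mon_eval_def
  by (rule prod.mono_neutral_left) (use assms in \<open>auto simp: in_keys_iff\<close>)

lemma mon_eval_finite: "mon_eval a (m :: 'v::finite \<Rightarrow>\<^sub>0 nat) = (\<Prod>v\<in>UNIV. a v ^ Poly_Mapping.lookup m v)"
  by (rule mon_eval_superset) auto

lemma mon_eval_0 [simp]: "mon_eval a 0 = 1"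
  by (simp add: mon_eval_def)

lemma mon_eval_add: "mon_eval a (m + m') = mon_eval a m * mon_eval a m'"
proof -
  let ?K = "Poly_Mapping.keys m \<union> Poly_Mapping.keys m'"
  have "mon_eval a (m + m') = (\<Prod>v\<in>?K. a v ^ Poly_Mapping.lookup (m + m') v)"
    by (rule mon_eval_superset) (auto dest: subsetD[OF keys_add])
  moreover have "mon_eval a m = (\<Prod>v\<in>?K. a v ^ Poly_Mapping.lookup m v)"
    by (rule mon_eval_superset) auto
  moreover have "mon_eval a m' = (\<Prod>v\<in>?K. a v ^ Poly_Mapping.lookup m' v)"
    by (rule mon_eval_superset) auto
  ultimately show ?thesis
    by (simp add: lookup_add power_add prod.distrib)
qed

lemma mon_eval_single: "mon_eval a (Poly_Mapping.single v k) = a v ^ k"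
  by (simp add: mon_eval_def)

text \<open>The coefficient map \<open>h\<close> is kept general so that one homomorphism proof
  serves both evaluation at points over the field and substitution into Laurent rings, where
  \<open>h\<close> embeds constants.\<close>

definition heval :: "('a::comm_ring_1 \<Rightarrow> 'b::comm_ring_1) \<Rightarrow> ('v \<Rightarrow> 'b) \<Rightarrow> ('v, 'a) mpoly \<Rightarrow> 'b" where
  "heval h a p = (\<Sum>m\<in>Poly_Mapping.keys p. h (Poly_Mapping.lookup p m) * mon_eval a m)"

lemma peval_eq_heval: "peval a p = heval (\<lambda>x. x) a p"
  by (simp add: peval_def heval_def)

locale coeff_hom =
  fixes h :: "'a::comm_ring_1 \<Rightarrow> 'b::comm_ring_1"
  assumes h_add: "h (x + y) = h x + h y"
    and h_mult: "h (x * y) = h x * h y"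
    and h_1: "h 1 = 1"
begin

lemma h_0: "h 0 = 0"
  using h_add[of 0 0] by simp

lemma heval_superset:
  assumes "finite K" "Poly_Mapping.keys p \<subseteq> K"
  shows "heval h a p = (\<Sum>m\<in>K. h (Poly_Mapping.lookup p m) * mon_eval a m)"
  unfolding heval_def
  by (rule sum.mono_neutral_left) (use assms in \<open>auto simp: in_keys_iff h_0\<close>)

lemma heval_0: "heval h a 0 = 0"
  by (simp add: heval_def)

lemma heval_add: "heval h a (p + q) = heval h a p + heval h a q"
proof -
  let ?K = "Poly_Mapping.keys p \<union> Poly_Mapping.keys q"
  have "heval h a (p + q) = (\<Sum>m\<in>?K. h (Poly_Mapping.lookup (p + q) m) * mon_eval a m)"
    by (rule heval_superset) (auto dest: subsetD[OF keys_add])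
  moreover have "heval h a p = (\<Sum>m\<in>?K. h (Poly_Mapping.lookup p m) * mon_eval a m)"
    by (rule heval_superset) auto
  moreover have "heval h a q = (\<Sum>m\<in>?K. h (Poly_Mapping.lookup q m) * mon_eval a m)"
    by (rule heval_superset) auto
  ultimately show ?thesis
    by (simp add: lookup_add h_add sum.distrib algebra_simps)
qed

lemma heval_sum: "heval h a (sum f A) = (\<Sum>x\<in>A. heval h a (f x))"
  by (induction A rule: infinite_finite_induct) (auto simp: heval_0 heval_add)

lemma heval_single: "heval h a (Poly_Mapping.single m c) = h c * mon_eval a m"
  by (cases "c = 0") (auto simp: heval_def h_0)

lemma heval_1: "heval h a 1 = 1"
  using heval_single[of a 0 1] by (simp add: h_1)

lemma heval_mult: "heval h a (p * q) = heval h a p * heval h a q"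
proof -
  let ?sp = "\<lambda>m. Poly_Mapping.single m (Poly_Mapping.lookup p m)"
  let ?sq = "\<lambda>m. Poly_Mapping.single m (Poly_Mapping.lookup q m)"
  have "p * q = (\<Sum>m\<in>Poly_Mapping.keys p. ?sp m) * (\<Sum>m\<in>Poly_Mapping.keys q. ?sq m)"
    by (simp flip: poly_mapping_sum_single)
  also have "heval h a \<dots> = (\<Sum>m\<in>Poly_Mapping.keys p. \<Sum>l\<in>Poly_Mapping.keys q. heval h a (?sp m) * heval h a (?sq l))"
    by (simp add: sum_product heval_sum mult_single heval_single h_mult mon_eval_add algebra_simps)
  also have "\<dots> = (\<Sum>m\<in>Poly_Mapping.keys p. heval h a (?sp m)) * (\<Sum>m\<in>Poly_Mapping.keys q. heval h a (?sq m))"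
    by (simp add: sum_product)
  also have "\<dots> = heval h a p * heval h a q"
    by (simp add: heval_sum[symmetric] flip: poly_mapping_sum_single)
  finally show ?thesis .
qed

lemma heval_uminus: "heval h a (- p) = - heval h a p"
  using heval_add[of a p "- p"] by (simp add: heval_0 add_eq_0_iff)

lemma heval_diff: "heval h a (p - q) = heval h a p - heval h a q"
  using heval_add[of a p "- q"] by (simp add: heval_uminus)

lemma heval_power: "heval h a (p ^ k) = heval h a p ^ k"
  by (induction k) (auto simp: heval_1 heval_mult)

lemma heval_Var: "heval h a (Var v) = a v"
  by (simp add: Var_def heval_single h_1 mon_eval_single)

end

interpretation peval_hom: coeff_hom "\<lambda>x. x"
  rewrites "heval (\<lambda>x. x) = peval"
  by unfold_locales (auto simp: fun_eq_iff peval_eq_heval)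

interpretation const_hom: coeff_hom "Poly_Mapping.single 0 :: 'b::comm_ring_1 \<Rightarrow> 'k::comm_monoid_add \<Rightarrow>\<^sub>0 'b"
  by unfold_locales (auto simp: single_add mult_single)

lemmas peval_simps = peval_hom.heval_add peval_hom.heval_mult peval_hom.heval_diff
  peval_hom.heval_sum peval_hom.heval_Var peval_hom.heval_1 peval_hom.heval_0 peval_hom.heval_single

subsection \<open>Leading exponents\<close>

definition lead :: "('k::linorder \<Rightarrow>\<^sub>0 'b::zero) \<Rightarrow> 'k \<Rightarrow> bool" where
  "lead p k \<longleftrightarrow> k \<in> Poly_Mapping.keys p \<and> (\<forall>l\<in>Poly_Mapping.keys p. l \<le> k)"

lemma lead_unique: "lead p k \<Longrightarrow> lead p l \<Longrightarrow> k = l"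
  unfolding lead_def by force

lemma lead_nonzero: "lead p k \<Longrightarrow> p \<noteq> 0"
  unfolding lead_def by auto

lemma lead_single: "c \<noteq> 0 \<Longrightarrow> lead (Poly_Mapping.single k c) k"
  unfolding lead_def by simp

text \<open>The order is translation invariant, so no other pair of exponents sums to
  \<open>k + l\<close> and its coefficient is a single product.\<close>

lemma lookup_lead_mult:
  fixes p q :: "'k::linordered_ab_group_add \<Rightarrow>\<^sub>0 'b::idom"
  assumes "lead p k" "lead q l"
  shows "Poly_Mapping.lookup (p * q) (k + l) = Poly_Mapping.lookup p k * Poly_Mapping.lookup q l"
proof -
  let ?sp = "\<lambda>m. Poly_Mapping.single m (Poly_Mapping.lookup p m)"
  let ?sq = "\<lambda>m. Poly_Mapping.single m (Poly_Mapping.lookup q m)"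
  have eq: "a + b = k + l \<longleftrightarrow> a = k \<and> b = l" if "a \<in> Poly_Mapping.keys p" "b \<in> Poly_Mapping.keys q" for a b
  proof -
    have "a \<le> k" "b \<le> l" using that assms by (auto simp: lead_def)
    then show ?thesis
      by (metis add_le_cancel_left add_le_cancel_right add_left_cancel antisym_conv)
  qed
  have "p * q = (\<Sum>m\<in>Poly_Mapping.keys p. ?sp m) * (\<Sum>m\<in>Poly_Mapping.keys q. ?sq m)"
    by (simp flip: poly_mapping_sum_single)
  also have "Poly_Mapping.lookup \<dots> (k + l) =
    (\<Sum>a\<in>Poly_Mapping.keys p. \<Sum>b\<in>Poly_Mapping.keys q. Poly_Mapping.lookup p a * Poly_Mapping.lookup q b when a + b = k + l)"
    by (simp add: sum_product lookup_sum mult_single lookup_single)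
  also have "\<dots> = (\<Sum>a\<in>Poly_Mapping.keys p. \<Sum>b\<in>Poly_Mapping.keys q.
      if b = l then if a = k then Poly_Mapping.lookup p a * Poly_Mapping.lookup q b else 0 else 0)"
    by (intro sum.cong refl) (simp add: when_def eq)
  also have "\<dots> = (\<Sum>a\<in>Poly_Mapping.keys p. if a = k then Poly_Mapping.lookup p a * Poly_Mapping.lookup q l else 0)"
    using assms by (intro sum.cong refl) (simp add: lead_def)
  also have "\<dots> = Poly_Mapping.lookup p k * Poly_Mapping.lookup q l"
    using assms by (simp add: lead_def)
  finally show ?thesis .
qed

lemma lead_mult:
  fixes p q :: "'k::linordered_ab_group_add \<Rightarrow>\<^sub>0 'b::idom"
  assumes "lead p k" "lead q l"
  shows "lead (p * q) (k + l)"
  unfolding lead_def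
proof (intro conjI ballI)
  show "k + l \<in> Poly_Mapping.keys (p * q)"
    using assms lookup_lead_mult[OF assms] by (simp add: lead_def in_keys_iff)
next
  fix x assume "x \<in> Poly_Mapping.keys (p * q)"
  then obtain a b where "a \<in> Poly_Mapping.keys p" "b \<in> Poly_Mapping.keys q" "x = a + b"
    using keys_mult[of p q] by auto
  then show "x \<le> k + l" using assms by (auto simp: lead_def intro: add_mono)
qed

lemma lead_power:
  fixes p :: "('i::linorder \<Rightarrow>\<^sub>0 int) \<Rightarrow>\<^sub>0 'b::idom"
  assumes "lead p k"
  shows "lead (p ^ n) (frag_cmul (int n) k)"
proof (induction n)
  case 0
  then show ?case using lead_single[of "1::'b" "0 :: 'i \<Rightarrow>\<^sub>0 int"] by simp
next
  case (Suc n)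
  have "k + frag_cmul (int n) k = frag_cmul (int (Suc n)) k"
    by (simp add: poly_mapping_eq_iff fun_eq_iff lookup_add algebra_simps)
  then show ?case using lead_mult[OF assms Suc] by simp
qed

lemma lead_prod:
  fixes p :: "'v \<Rightarrow> 'k::linordered_ab_group_add \<Rightarrow>\<^sub>0 'b::idom"
  assumes "finite V" "\<And>v. v \<in> V \<Longrightarrow> lead (p v) (k v)"
  shows "lead (\<Prod>v\<in>V. p v) (\<Sum>v\<in>V. k v)"
  using assms
proof (induction V rule: finite_induct)
  case empty
  then show ?case using lead_single[of "1::'b" "0 :: 'k"] by simp
next
  case (insert v V)
  then show ?case using lead_mult[of "p v" "k v"] by simp
qed

text \<open>The largest of the distinct leading exponents occurs in only one summand, so nothing
  cancels it. This detects the linear independence of normal forms.\<close>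

lemma lead_sum:
  assumes "finite A" "A \<noteq> {}" "\<And>a. a \<in> A \<Longrightarrow> lead (f a) (k a)" "inj_on k A"
  shows "\<exists>a\<in>A. lead (\<Sum>a\<in>A. f a :: 'k::linorder \<Rightarrow>\<^sub>0 'b::comm_monoid_add) (k a)"
proof -
  have "Max (k ` A) \<in> k ` A" using assms by auto
  then obtain a where a: "a \<in> A" "Max (k ` A) = k a" by auto
  then have le: "k b \<le> k a" if "b \<in> A" for b using that assms(1) by (metis Max_ge finite_imageI imageI)
  have other: "Poly_Mapping.lookup (f b) (k a) = 0" if "b \<in> A" "b \<noteq> a" for b
  proof -
    have "k b < k a" using le[OF that(1)] that a assms(4) by (metis inj_onD order_neq_le_trans)
    then show ?thesis using assms(3)[OF that(1)] by (force simp: lead_def in_keys_iff)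
  qed
  have "Poly_Mapping.lookup (\<Sum>a\<in>A. f a) (k a) = (\<Sum>b\<in>A. if b = a then Poly_Mapping.lookup (f a) (k a) else 0)"
    unfolding lookup_sum by (intro sum.cong) (auto simp: other)
  also have "\<dots> = Poly_Mapping.lookup (f a) (k a)" using a assms(1) by simp
  finally have "k a \<in> Poly_Mapping.keys (\<Sum>a\<in>A. f a)" using assms(3)[OF a(1)] by (simp add: lead_def in_keys_iff)
  moreover have "l \<le> k a" if l: "l \<in> Poly_Mapping.keys (\<Sum>a\<in>A. f a)" for l
  proof -
    have "\<exists>b\<in>A. l \<in> Poly_Mapping.keys (f b)"
    proof (rule ccontr)
      assume "\<not> (\<exists>b\<in>A. l \<in> Poly_Mapping.keys (f b))"
      then have "Poly_Mapping.lookup (\<Sum>a\<in>A. f a) l = 0"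
        by (auto simp: lookup_sum in_keys_iff intro: sum.neutral)
      then show False using l by (simp add: in_keys_iff)
    qed
    then obtain b where "b \<in> A" "l \<in> Poly_Mapping.keys (f b)" by auto
    then have "l \<le> k b" using assms(3) by (auto simp: lead_def)
    then show ?thesis using le \<open>b \<in> A\<close> by force
  qed
  ultimately show ?thesis using a(1) unfolding lead_def by blast
qed

subsection \<open>Linear algebra over the weight matrix\<close>

text \<open>Gaussian elimination: equation \<open>a\<close> is solved for an unknown
  \<open>b0\<close> with nonzero coefficient, and the result is substituted into the other
  equations.\<close>

lemma homogeneous_system_nontrivial:
  fixes M :: "'b \<Rightarrow> 'c \<Rightarrow> 'a::field"
  assumes "finite A" "finite B" "card A < card B"
  shows "\<exists>c. (\<exists>b\<in>B. c b \<noteq> 0) \<and> (\<forall>a\<in>A. (\<Sum>b\<in>B. c b * M b a) = 0)"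
  using assms
proof (induction A arbitrary: B M rule: finite_induct)
  case empty
  then have "B \<noteq> {}" by auto
  then show ?case by (intro exI[of _ "\<lambda>_. 1"]) auto
next
  case (insert a A)
  show ?case
  proof (cases "\<forall>b\<in>B. M b a = 0")
    case True
    from insert.hyps insert.prems have "card A < card B" by simp
    from insert.IH[OF insert.prems(1) this, of M] True show ?thesis by auto
  next
    case False
    then obtain b0 where b0: "b0 \<in> B" "M b0 a \<noteq> 0" by auto
    let ?B = "B - {b0}"
    let ?M = "\<lambda>b x. M b x - M b a / M b0 a * M b0 x"
    have "card A < card ?B" using insert.hyps insert.prems b0 by simp
    with insert.IH[of ?B ?M] insert.prems(1) obtain c where
      c: "\<exists>b\<in>?B. c b \<noteq> 0" "\<forall>x\<in>A. (\<Sum>b\<in>?B. c b * ?M b x) = 0" by auto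
    define c' where "c' = c(b0 := - (\<Sum>b\<in>?B. c b * (M b a / M b0 a)))"
    have split: "(\<Sum>b\<in>B. c' b * M b x) = (\<Sum>b\<in>?B. c b * ?M b x)" for x
    proof -
      have "(\<Sum>b\<in>B. c' b * M b x) = c' b0 * M b0 x + (\<Sum>b\<in>?B. c' b * M b x)"
        using insert.prems(1) b0 by (simp add: sum.remove)
      also have "(\<Sum>b\<in>?B. c' b * M b x) = (\<Sum>b\<in>?B. c b * M b x)"
        by (intro sum.cong) (auto simp: c'_def)
      also have "c' b0 * M b0 x + (\<Sum>b\<in>?B. c b * M b x) = (\<Sum>b\<in>?B. c b * ?M b x)"
        by (simp add: c'_def algebra_simps sum_subtractf sum_distrib_left sum_distrib_right)
      finally show ?thesis .
    qed
    have "(\<Sum>b\<in>?B. c b * ?M b a) = 0" using b0 by simp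
    then have "\<forall>x\<in>insert a A. (\<Sum>b\<in>B. c' b * M b x) = 0" using split c(2) by auto
    moreover have "\<exists>b\<in>B. c' b \<noteq> 0" using c(1) by (auto simp: c'_def)
    ultimately show ?thesis by blast
  qed
qed

lemma rows_indepD:
  fixes c :: "'n \<Rightarrow> rat"
  assumes "rows_indep r S I" "\<And>j. j < r \<Longrightarrow> (\<Sum>i\<in>I. c i * of_int (S i j)) = 0" "i \<in> I"
  shows "c i = 0"
proof -
  from assms(1) have "(\<forall>j<r. (\<Sum>i\<in>I. c i * of_int (S i j)) = 0) \<longrightarrow> (\<forall>i\<in>I. c i = 0)"
    unfolding rows_indep_def by (rule spec)
  with assms(2,3) show ?thesis by blast
qed

lemma rows_indep_subset:
  assumes "rows_indep r S I" "J \<subseteq> I" "finite I"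
  shows "rows_indep r S J"
  unfolding rows_indep_def
proof (intro allI impI ballI)
  fix c :: "'a \<Rightarrow> rat" and i
  assume c: "\<forall>j<r. (\<Sum>i\<in>J. c i * of_int (S i j)) = 0" and i: "i \<in> J"
  let ?c = "\<lambda>i. if i \<in> J then c i else 0"
  have "(\<Sum>i\<in>I. ?c i * of_int (S i j)) = (\<Sum>i\<in>J. c i * of_int (S i j))" for j
    using assms(2,3) by (intro sum.mono_neutral_cong_right) auto
  with c have eq: "(\<Sum>i\<in>I. ?c i * of_int (S i j)) = 0" if "j < r" for j using that by simp
  have "?c i = 0" by (rule rows_indepD[OF assms(1), of ?c i]) (use i assms(2) eq in auto)
  with i show "c i = 0" by simp
qed

text \<open>Dual functionals take the place of inverting a maximal minor; they later recover the
  pivot generators from the components of the moment map.\<close>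

lemma rows_indep_dual:
  assumes "finite I" "rows_indep r S I"
  shows "\<exists>t. \<forall>i\<in>I. \<forall>k\<in>I. (\<Sum>j<r. t i j * of_int (S k j)) = (if i = k then 1 else (0::rat))"
  using assms
proof (induction I rule: finite_induct)
  case empty
  then show ?case by simp
next
  case (insert k I)
  then have "rows_indep r S I" by (auto intro: rows_indep_subset)
  then obtain t where t: "\<And>i a. i \<in> I \<Longrightarrow> a \<in> I \<Longrightarrow> (\<Sum>j<r. t i j * of_int (S a j)) = (if i = a then 1 else (0::rat))"
    using insert.IH by blast
  define b where "b i = (\<Sum>j<r. t i j * of_int (S k j))" for i
  define s where "s j = of_int (S k j) - (\<Sum>i\<in>I. b i * of_int (S i j))" for j
  have "\<exists>j<r. s j \<noteq> 0"
  proof (rule ccontr)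
    assume "\<not> ?thesis"
    then have s0: "s j = 0" if "j < r" for j using that by auto
    let ?c = "\<lambda>i. if i = k then 1 else - b i"
    have eq: "(\<Sum>i\<in>insert k I. ?c i * of_int (S i j)) = s j" for j
    proof -
      have "(\<Sum>i\<in>I. ?c i * of_int (S i j)) = (\<Sum>i\<in>I. - (b i * of_int (S i j)))"
        using insert.hyps by (intro sum.cong) auto
      then show ?thesis using insert.hyps by (simp add: s_def sum_negf)
    qed
    have "?c k = 0" by (rule rows_indepD[OF insert.prems, of ?c k]) (use s0 eq in auto)
    then show False by simp
  qed
  then obtain j where j: "j < r" "s j \<noteq> 0" by auto
  \<comment> \<open>The functional \<open>t0\<close> sends a vector to the \<open>j\<close>-th entry
    of what remains after subtracting its part along the rows in \<open>I\<close>, as measured by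
    \<open>t\<close>. Hence it kills these rows and takes the value \<open>s j\<close> on row
    \<open>k\<close>.\<close>
  define t0 where "t0 l = (if l = j then 1 else 0) - (\<Sum>i\<in>I. of_int (S i j) * t i l)" for l
  have t0: "(\<Sum>l<r. t0 l * x l) = x j - (\<Sum>i\<in>I. of_int (S i j) * (\<Sum>l<r. t i l * x l))" for x
  proof -
    have "(\<Sum>l<r. t0 l * x l) = (\<Sum>l<r. (if l = j then x l else 0)) - (\<Sum>l<r. \<Sum>i\<in>I. of_int (S i j) * t i l * x l)"
      unfolding t0_def sum_subtractf[symmetric] by (intro sum.cong) (auto simp: algebra_simps sum_distrib_left)
    also have "(\<Sum>l<r. \<Sum>i\<in>I. of_int (S i j) * t i l * x l) = (\<Sum>i\<in>I. of_int (S i j) * (\<Sum>l<r. t i l * x l))"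
      by (subst sum.swap) (simp add: sum_distrib_left mult.assoc)
    finally show ?thesis using j by simp
  qed
  have t0I: "(\<Sum>l<r. t0 l * of_int (S a l)) = 0" if "a \<in> I" for a
  proof -
    have "(\<Sum>i\<in>I. of_int (S i j) * (\<Sum>l<r. t i l * of_int (S a l))) = (\<Sum>i\<in>I. if i = a then of_int (S i j) else (0::rat))"
      by (intro sum.cong) (auto simp: t that)
    then show ?thesis using that insert.hyps by (simp add: t0)
  qed
  have t0k: "(\<Sum>l<r. t0 l * of_int (S k l)) = s j"
    by (simp add: t0 s_def b_def mult.commute)
  \<comment> \<open>Scaling \<open>t0\<close> gives the functional dual to row \<open>k\<close>;
    each old one is corrected by its value \<open>b i\<close> on that row.\<close>
  define t' where "t' i l = (if i = k then t0 l / s j else t i l - b i * (t0 l / s j))" for i l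
  have scale: "(\<Sum>l<r. t0 l * x l / s j) = (\<Sum>l<r. t0 l * x l) / s j" for x
    by (simp add: sum_divide_distrib)
  have k: "(\<Sum>l<r. t' k l * of_int (S a l)) = (if k = a then 1 else 0)" if "a \<in> insert k I" for a
    using that insert.hyps j by (auto simp: t'_def scale t0I t0k)
  have "(\<Sum>l<r. t' i l * of_int (S a l)) = (if i = a then 1 else 0)" if "a \<in> insert k I" "i \<in> I" for a i
  proof -
    have "i \<noteq> k" using that insert.hyps by auto
    then have "(\<Sum>l<r. t' i l * of_int (S a l)) = (\<Sum>l<r. t i l * of_int (S a l)) - b i * (\<Sum>l<r. t' k l * of_int (S a l))"
      by (simp add: t'_def sum_subtractf sum_distrib_left algebra_simps)
    then show ?thesis using that insert.hyps k[OF that(1)] t[OF that(2)] by (auto simp: b_def)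
  qed
  with k show ?case by blast
qed

lemma rows_dependent_extend:
  assumes "finite K" "rows_indep r S K" "\<not> rows_indep r S (insert j K)"
  shows "\<exists>\<alpha>::_ \<Rightarrow> rat. \<forall>k<r. of_int (S j k) = (\<Sum>i\<in>K. \<alpha> i * of_int (S i k))"
proof -
  have j: "j \<notin> K" using assms by (auto simp: insert_absorb)
  have "\<exists>c::_ \<Rightarrow> rat. (\<forall>k<r. (\<Sum>i\<in>insert j K. c i * of_int (S i k)) = 0) \<and> (\<exists>i\<in>insert j K. c i \<noteq> 0)"
    using assms(3) unfolding rows_indep_def by (simp only: not_all not_imp ball_simps(10))
  then obtain c :: "_ \<Rightarrow> rat" and i where c: "\<And>k. k < r \<Longrightarrow> (\<Sum>i\<in>insert j K. c i * of_int (S i k)) = 0" and i: "i \<in> insert j K" "c i \<noteq> 0"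
    by (elim exE conjE bexE) (rule that, rule mp, erule spec)
  have eq: "c j * of_int (S j k) + (\<Sum>i\<in>K. c i * of_int (S i k)) = 0" if "k < r" for k
    using c[OF that] assms(1) j by simp
  have cj: "c j \<noteq> 0"
  proof
    assume "c j = 0"
    have "c i = 0" if "i \<in> K" for i
      by (rule rows_indepD[OF assms(2) _ that]) (use eq \<open>c j = 0\<close> in simp)
    with i \<open>c j = 0\<close> show False by auto
  qed
  have "of_int (S j k) = (\<Sum>i\<in>K. - c i / c j * of_int (S i k))" if "k < r" for k
  proof -
    have "of_int (S j k) = - (\<Sum>i\<in>K. c i * of_int (S i k)) / c j"
      using eq[OF that] cj by (simp add: field_simps add_eq_0_iff)
    also have "\<dots> = (\<Sum>i\<in>K. - c i / c j * of_int (S i k))"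
      by (simp add: sum_divide_distrib sum_negf)
    finally show ?thesis .
  qed
  then show ?thesis by (intro exI[of _ "\<lambda>i. - c i / c j"]) blast
qed

lemma rank_rows_ge:
  fixes S :: "'n::finite \<Rightarrow> nat \<Rightarrow> int"
  assumes "J \<subseteq> I" "rows_indep r S J"
  shows "card J \<le> rank_rows r S I"
  unfolding rank_rows_def by (rule Max_ge) (use assms in auto)

lemma rank_rows_attained:
  fixes S :: "'n::finite \<Rightarrow> nat \<Rightarrow> int"
  obtains J where "J \<subseteq> I" "rows_indep r S J" "card J = rank_rows r S I"
proof -
  have "rows_indep r S {}" by (simp add: rows_indep_def)
  then have "Max (card ` {J. J \<subseteq> I \<and> rows_indep r S J}) \<in> card ` {J. J \<subseteq> I \<and> rows_indep r S J}"
    by (intro Max_in) auto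
  then show ?thesis using that unfolding rank_rows_def by auto
qed

lemma rank_rows_spanning:
  fixes S :: "'n::finite \<Rightarrow> nat \<Rightarrow> int"
  assumes "J \<subseteq> I" "rows_indep r S J" "card J = rank_rows r S I" "i \<in> I"
  shows "\<exists>\<alpha>::'n \<Rightarrow> rat. \<forall>k<r. of_int (S i k) = (\<Sum>a\<in>J. \<alpha> a * of_int (S a k))"
proof (cases "i \<in> J")
  case True
  then show ?thesis
    by (intro exI[of _ "\<lambda>a. if a = i then 1 else 0"]) (simp add: if_distrib if_distribR cong: if_cong)
next
  case False
  have "\<not> rows_indep r S (insert i J)"
  proof
    assume "rows_indep r S (insert i J)"
    then have "card (insert i J) \<le> rank_rows r S I" by (intro rank_rows_ge) (use assms in auto)
    then show False using False assms by simp
  qed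
  then show ?thesis by (intro rows_dependent_extend) (use assms in auto)
qed

lemma rank_rows_diff_le:
  fixes S :: "'n::finite \<Rightarrow> nat \<Rightarrow> int"
  shows "rank_rows r S UNIV \<le> rank_rows r S I + card (- I)"
proof -
  obtain K where K: "rows_indep r S K" "card K = rank_rows r S UNIV"
    using rank_rows_attained[of UNIV r S] by auto
  have "card K = card (K \<inter> I) + card (K \<inter> - I)"
    by (subst card_Un_disjoint[symmetric]) (auto intro: arg_cong[of _ _ card])
  moreover have "card (K \<inter> I) \<le> rank_rows r S I"
    using K by (intro rank_rows_ge rows_indep_subset[OF K(1)]) auto
  moreover have "card (K \<inter> - I) \<le> card (- I)" by (intro card_mono) auto
  ultimately show ?thesis using K by simp
qed

text \<open>The set on the right consists of the coloops. Such rows can be added to a basis of the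
  rows in \<open>I\<close> without creating a relation; conversely, equality forces a basis of all
  rows to contain \<open>- I\<close>.\<close>

lemma rank_rows_diff_eq_iff:
  fixes S :: "'n::finite \<Rightarrow> nat \<Rightarrow> int"
  shows "rank_rows r S UNIV = rank_rows r S I + card (- I) \<longleftrightarrow>
    - I \<subseteq> {i. \<forall>c::'n \<Rightarrow> rat. (\<forall>k<r. (\<Sum>i\<in>UNIV. c i * of_int (S i k)) = 0) \<longrightarrow> c i = 0}" (is "?l \<longleftrightarrow> - I \<subseteq> ?Z")
proof
  assume Z: "- I \<subseteq> ?Z"
  obtain J where J: "J \<subseteq> I" "rows_indep r S J" "card J = rank_rows r S I"
    by (rule rank_rows_attained[of I r S])
  have "rows_indep r S (J \<union> - I)"
    unfolding rows_indep_def
  proof (intro allI impI)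
    fix c :: "'n \<Rightarrow> rat"
    assume c: "\<forall>k<r. (\<Sum>i\<in>J \<union> - I. c i * of_int (S i k)) = 0"
    let ?c = "\<lambda>i. if i \<in> J \<union> - I then c i else 0"
    have "(\<Sum>i\<in>UNIV. ?c i * of_int (S i k)) = (\<Sum>i\<in>J \<union> - I. c i * of_int (S i k))" for k
      by (intro sum.mono_neutral_cong_right) auto
    with c have "\<forall>k<r. (\<Sum>i\<in>UNIV. ?c i * of_int (S i k)) = 0" by simp
    then have cI: "c i = 0" if "i \<in> - I" for i
      using Z that by (auto dest!: subsetD[OF Z] spec[of _ ?c])
    have "(\<Sum>i\<in>J \<union> - I. c i * of_int (S i k)) = (\<Sum>i\<in>J. c i * of_int (S i k))" for k
      using J(1) by (intro sum.mono_neutral_right) (auto simp: cI)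
    with c have "\<forall>i\<in>J. c i = 0" using rows_indepD[OF J(2)] by simp
    with cI show "\<forall>i\<in>J \<union> - I. c i = 0" by auto
  qed
  then have "card (J \<union> - I) \<le> rank_rows r S UNIV" by (intro rank_rows_ge) auto
  moreover have "card (J \<union> - I) = card J + card (- I)" using J(1) by (intro card_Un_disjoint) auto
  ultimately show ?l using rank_rows_diff_le[of r S I] J(3) by linarith
next
  assume l: ?l
  obtain K where K: "rows_indep r S K" "card K = rank_rows r S UNIV"
    using rank_rows_attained[of UNIV r S] by auto
  have cardK: "card K = card (K \<inter> I) + card (K \<inter> - I)"
    by (subst card_Un_disjoint[symmetric]) (auto intro: arg_cong[of _ _ card])
  have KI: "rows_indep r S (K \<inter> I)" by (intro rows_indep_subset[OF K(1)]) auto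
  have 1: "card (K \<inter> I) \<le> rank_rows r S I" using KI by (intro rank_rows_ge) auto
  have 2: "card (K \<inter> - I) \<le> card (- I)" by (intro card_mono) auto
  have "card (K \<inter> - I) = card (- I)" using 1 2 cardK K l by linarith
  then have "K \<inter> - I = - I" by (intro card_subset_eq) auto
  then have sub: "- I \<subseteq> K" by auto
  have cKI: "card (K \<inter> I) = rank_rows r S I" using 1 2 cardK K l by linarith
  have "\<forall>i\<in>I. \<exists>\<alpha>::'n \<Rightarrow> rat. \<forall>k<r. of_int (S i k) = (\<Sum>a\<in>K \<inter> I. \<alpha> a * of_int (S a k))"
    using rank_rows_spanning[OF _ KI cKI] by auto
  then obtain \<alpha> :: "'n \<Rightarrow> 'n \<Rightarrow> rat" where
    \<alpha>: "\<And>i k. i \<in> I \<Longrightarrow> k < r \<Longrightarrow> of_int (S i k) = (\<Sum>a\<in>K \<inter> I. \<alpha> i a * of_int (S a k))"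
    by metis
  show "- I \<subseteq> ?Z"
  proof (intro subsetI CollectI allI impI)
    fix i and c :: "'n \<Rightarrow> rat"
    assume i: "i \<in> - I" and c: "\<forall>k<r. (\<Sum>i\<in>UNIV. c i * of_int (S i k)) = 0"
    \<comment> \<open>Rows in \<open>I\<close> are rewritten through the basis rows in
      \<open>K \<inter> I\<close>. A relation among all rows becomes one among the independent rows
      \<open>K\<close>, with unchanged coefficients on \<open>- I\<close>.\<close>
    define c' where "c' a = (if a \<in> I then (\<Sum>i\<in>I. c i * \<alpha> i a) else c a)" for a
    have *: "(\<Sum>a\<in>K. c' a * of_int (S a k)) = 0" if k: "k < r" for k
    proof -
      have "(\<Sum>a\<in>K. c' a * of_int (S a k)) = (\<Sum>a\<in>K \<inter> I. c' a * of_int (S a k)) + (\<Sum>a\<in>- I. c' a * of_int (S a k))"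
      proof -
        have "K = (K \<inter> I) \<union> - I" using sub by auto
        then show ?thesis by (metis (no_types, lifting) Int_assoc Compl_disjoint Int_empty_right finite sum.union_disjoint)
      qed
      also have "(\<Sum>a\<in>K \<inter> I. c' a * of_int (S a k)) = (\<Sum>a\<in>K \<inter> I. \<Sum>i\<in>I. c i * (\<alpha> i a * of_int (S a k)))"
        by (intro sum.cong) (auto simp: c'_def sum_distrib_right mult.assoc)
      also have "\<dots> = (\<Sum>i\<in>I. c i * of_int (S i k))"
        by (subst sum.swap) (simp add: \<alpha>[OF _ k] sum_distrib_left)
      also have "(\<Sum>a\<in>- I. c' a * of_int (S a k)) = (\<Sum>a\<in>- I. c a * of_int (S a k))"
        by (intro sum.cong) (auto simp: c'_def)
      also have "(\<Sum>i\<in>I. c i * of_int (S i k)) + (\<Sum>a\<in>- I. c a * of_int (S a k)) = (\<Sum>i\<in>UNIV. c i * of_int (S i k))"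
        by (subst sum.union_disjoint[symmetric]) (simp_all add: Int_Un_distrib2 Compl_partition Un_absorb2 Int_Un_distrib)
      finally show ?thesis using c k by simp
    qed
    from i sub have "i \<in> K" by auto
    have "c' i = 0" by (rule rows_indepD[OF K(1) _ \<open>i \<in> K\<close>]) (rule *)
    with i show "c i = 0" by (simp add: c'_def)
  qed
qed

subsection \<open>Zariski closures and irreducibility\<close>

definition vanishing :: "('v \<Rightarrow> 'a::comm_ring_1) set \<Rightarrow> ('v, 'a) mpoly set" where
  "vanishing X = {f. \<forall>a\<in>X. peval a f = 0}"

lemma is_ideal_vanishing: "is_ideal (vanishing X)"
  by (auto simp: vanishing_def is_ideal_def peval_simps)

lemma zclosure_eq: "zclosure A = zero_set (vanishing A)"
proof
  have "zclosed (zero_set (vanishing A))" by (auto simp: zclosed_def)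
  moreover have "A \<subseteq> zero_set (vanishing A)" by (auto simp: zero_set_def vanishing_def)
  ultimately show "zclosure A \<subseteq> zero_set (vanishing A)" unfolding zclosure_def by blast
  show "zero_set (vanishing A) \<subseteq> zclosure A"
    unfolding zclosure_def zclosed_def by (fastforce simp: zero_set_def vanishing_def)
qed

lemma zclosed_zclosure: "zclosed (zclosure A)"
  by (auto simp: zclosed_def zclosure_eq)

lemma zclosure_superset: "A \<subseteq> zclosure A"
  by (auto simp: zclosure_def)

lemma zclosure_minimal: "A \<subseteq> X \<Longrightarrow> zclosed X \<Longrightarrow> zclosure A \<subseteq> X"
  by (auto simp: zclosure_def)

lemma zclosed_Un:
  fixes X Y :: "('v \<Rightarrow> 'a::idom) set"
  assumes "zclosed X" "zclosed Y"
  shows "zclosed (X \<union> Y)"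
proof -
  obtain F G :: "('v, 'a) mpoly set" where FG: "X = zero_set F" "Y = zero_set G"
    using assms unfolding zclosed_def by auto
  have "X \<union> Y = zero_set {f * g | f g. f \<in> F \<and> g \<in> G}"
    unfolding FG by (fastforce simp: zero_set_def peval_simps)
  then show ?thesis unfolding zclosed_def by blast
qed

lemma zclosed_empty: "zclosed ({} :: ('v \<Rightarrow> 'a::comm_ring_1) set)"
proof -
  have "{} = zero_set {1 :: ('v, 'a) mpoly}" by (auto simp: zero_set_def peval_simps)
  then show ?thesis unfolding zclosed_def by blast
qed

lemma zclosed_Union:
  fixes \<X> :: "('v \<Rightarrow> 'a::idom) set set"
  assumes "finite \<X>" "\<And>X. X \<in> \<X> \<Longrightarrow> zclosed X"
  shows "zclosed (\<Union>\<X>)"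
  using assms by (induction \<X> rule: finite_induct) (auto intro: zclosed_Un zclosed_empty)

lemma zirreducible_subset_Union:
  fixes \<X> :: "('v \<Rightarrow> 'a::idom) set set"
  assumes "finite \<X>" "\<And>X. X \<in> \<X> \<Longrightarrow> zclosed X" "zirreducible D" "D \<subseteq> \<Union>\<X>"
  shows "\<exists>X\<in>\<X>. D \<subseteq> X"
  using assms
proof (induction \<X> rule: finite_induct)
  case empty
  then show ?case by (auto simp: zirreducible_def)
next
  case (insert X \<X>)
  have "zclosed X" "zclosed (\<Union>\<X>)" using insert by (auto intro: zclosed_Union)
  then have "D \<subseteq> X \<or> D \<subseteq> \<Union>\<X>" using insert.prems(2,3) unfolding zirreducible_def by auto
  then show ?case using insert by auto
qed

lemma zirreducible_zclosure:
  fixes A :: "('v \<Rightarrow> 'a::idom) set"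
  assumes "prime_ideal (vanishing A)"
  shows "zirreducible (zclosure A)"
  unfolding zirreducible_def
proof (intro conjI allI impI)
  show "zclosed (zclosure A)" by (rule zclosed_zclosure)
  have "1 \<notin> vanishing A" using assms by (auto simp: prime_ideal_def)
  then have "A \<noteq> {}" by (auto simp: vanishing_def)
  then show "zclosure A \<noteq> {}" using zclosure_superset[of A] by auto
  fix Y1 Y2 :: "('v \<Rightarrow> 'a) set"
  assume Y: "zclosed Y1 \<and> zclosed Y2 \<and> zclosure A \<subseteq> Y1 \<union> Y2"
  then obtain F1 F2 :: "('v, 'a) mpoly set" where F: "Y1 = zero_set F1" "Y2 = zero_set F2"
    unfolding zclosed_def by auto
  have AY: "A \<subseteq> Y1 \<union> Y2" using Y zclosure_superset[of A] by auto
  have "A \<subseteq> Y1 \<or> A \<subseteq> Y2"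
  proof (rule ccontr)
    assume "\<not> ?thesis"
    then obtain a1 a2 f1 f2 where *: "a1 \<in> A" "f1 \<in> F1" "peval a1 f1 \<noteq> 0" "a2 \<in> A" "f2 \<in> F2" "peval a2 f2 \<noteq> 0"
      by (auto simp: F zero_set_def)
    have "f1 * f2 \<in> vanishing A"
      using AY * by (fastforce simp: F zero_set_def vanishing_def peval_simps)
    with prime_ideal_mult[OF assms] * show False by (auto simp: vanishing_def)
  qed
  then show "zclosure A \<subseteq> Y1 \<or> zclosure A \<subseteq> Y2" using Y zclosure_minimal by blast
qed

text \<open>An irreducible set inside a finite union of closed sets lies in one of them, so every
  maximal one is a member of the family; incomparability makes each member maximal.\<close>

lemma irreducible_components_Union:
  fixes \<X> :: "('v \<Rightarrow> 'a::idom) set set"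
  assumes "finite \<X>" "\<And>X. X \<in> \<X> \<Longrightarrow> zirreducible X"
    and incomparable: "\<And>X Y. X \<in> \<X> \<Longrightarrow> Y \<in> \<X> \<Longrightarrow> X \<subseteq> Y \<Longrightarrow> X = Y"
  shows "{C. irreducible_component C (\<Union>\<X>)} = \<X>"
proof -
  have sub: "\<exists>X\<in>\<X>. D \<subseteq> X" if "zirreducible D" "D \<subseteq> \<Union>\<X>" for D
    using that assms by (intro zirreducible_subset_Union) (auto simp: zirreducible_def)
  show ?thesis
  proof (intro equalityI subsetI)
    fix C assume "C \<in> {C. irreducible_component C (\<Union>\<X>)}"
    then have C: "irreducible_component C (\<Union>\<X>)" by simp
    then obtain X where X: "X \<in> \<X>" "C \<subseteq> X" using sub[of C] by (auto simp: irreducible_component_def)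
    have "X = C" using C X assms(2)[OF X(1)] unfolding irreducible_component_def by blast
    with X show "C \<in> \<X>" by simp
  next
    fix C assume C: "C \<in> \<X>"
    have "D = C" if D: "zirreducible D" "C \<subseteq> D" "D \<subseteq> \<Union>\<X>" for D
    proof -
      obtain X where X: "X \<in> \<X>" "D \<subseteq> X" using sub[OF D(1,3)] by auto
      with incomparable[OF C X(1)] D(2) show ?thesis by auto
    qed
    with C assms(2) show "C \<in> {C. irreducible_component C (\<Union>\<X>)}"
      by (auto simp: irreducible_component_def)
  qed
qed

subsection \<open>Rational curves\<close>

text \<open>Regular functions on the part of the line where \<open>D\<close> does not vanish. The
  fixed denominator gives closure under sums and products, and values at roots of \<open>D\<close>
  are unconstrained.\<close>

definition rat_fun :: "'a::field poly \<Rightarrow> ('a \<Rightarrow> 'a) \<Rightarrow> bool" where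
  "rat_fun D h \<longleftrightarrow> (\<exists>F N. \<forall>t. poly D t \<noteq> 0 \<longrightarrow> h t * poly D t ^ N = poly F t)"

lemma rat_funI: "(\<And>t. poly D t \<noteq> 0 \<Longrightarrow> h t * poly D t ^ N = poly F t) \<Longrightarrow> rat_fun D h"
  unfolding rat_fun_def by blast

lemma rat_fun_poly: "rat_fun D (poly F)"
  by (rule rat_funI[of _ _ 0 F]) simp

lemma rat_fun_const: "rat_fun D (\<lambda>_. c)"
  by (rule rat_funI[of _ _ 0 "[:c:]"]) simp

lemma rat_fun_add:
  assumes "rat_fun D g" "rat_fun D h"
  shows "rat_fun D (\<lambda>t. g t + h t)"
proof -
  obtain F N G M where FG: "\<And>t. poly D t \<noteq> 0 \<Longrightarrow> g t * poly D t ^ N = poly F t"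
    "\<And>t. poly D t \<noteq> 0 \<Longrightarrow> h t * poly D t ^ M = poly G t"
    using assms unfolding rat_fun_def by blast
  have "(g t + h t) * poly D t ^ (N + M) = poly (F * D ^ M + G * D ^ N) t" if "poly D t \<noteq> 0" for t
  proof -
    have "(g t + h t) * poly D t ^ (N + M) = (g t * poly D t ^ N) * poly D t ^ M + (h t * poly D t ^ M) * poly D t ^ N"
      by (simp add: power_add algebra_simps)
    then show ?thesis using FG that by simp
  qed
  then show ?thesis by (rule rat_funI)
qed

lemma rat_fun_mult:
  assumes "rat_fun D g" "rat_fun D h"
  shows "rat_fun D (\<lambda>t. g t * h t)"
proof -
  obtain F N G M where FG: "\<And>t. poly D t \<noteq> 0 \<Longrightarrow> g t * poly D t ^ N = poly F t"
    "\<And>t. poly D t \<noteq> 0 \<Longrightarrow> h t * poly D t ^ M = poly G t"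
    using assms unfolding rat_fun_def by blast
  have "(g t * h t) * poly D t ^ (N + M) = poly (F * G) t" if "poly D t \<noteq> 0" for t
  proof -
    have "(g t * h t) * poly D t ^ (N + M) = (g t * poly D t ^ N) * (h t * poly D t ^ M)"
      by (simp add: power_add algebra_simps)
    then show ?thesis using FG that by simp
  qed
  then show ?thesis by (rule rat_funI)
qed

lemma rat_fun_power: "rat_fun D h \<Longrightarrow> rat_fun D (\<lambda>t. h t ^ n)"
  by (induction n) (auto intro: rat_fun_const rat_fun_mult)

lemma rat_fun_sum: "(\<And>x. x \<in> A \<Longrightarrow> rat_fun D (h x)) \<Longrightarrow> rat_fun D (\<lambda>t. \<Sum>x\<in>A. h x t)"
  by (induction A rule: infinite_finite_induct) (auto intro: rat_fun_const rat_fun_add)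

lemma rat_fun_prod: "(\<And>x. x \<in> A \<Longrightarrow> rat_fun D (h x)) \<Longrightarrow> rat_fun D (\<lambda>t. \<Prod>x\<in>A. h x t)"
  by (induction A rule: infinite_finite_induct) (auto intro: rat_fun_const rat_fun_mult)

lemma rat_fun_peval:
  assumes "\<And>v. rat_fun D (\<lambda>t. \<gamma> t v)"
  shows "rat_fun D (\<lambda>t. peval (\<gamma> t) f)"
  unfolding peval_def mon_eval_def
  by (intro rat_fun_sum rat_fun_mult rat_fun_const rat_fun_prod rat_fun_power assms)

lemma poly_nonroot:
  fixes p :: "'a::field_char_0 poly"
  assumes "p \<noteq> 0"
  shows "\<exists>t. poly p t \<noteq> 0"
  using assms poly_roots_finite[OF assms] infinite_UNIV_char_0[where 'a = 'a]
  by (metis (mono_tags, lifting) UNIV_eq_I mem_Collect_eq)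

text \<open>Along a polynomial curve \<open>f\<close> becomes a polynomial in one parameter.
  Multiplied by the parameter it vanishes on the whole infinite field, hence it is zero. This
  replaces limits in closure arguments.\<close>

lemma peval_limit_zero:
  fixes \<gamma> :: "'a::field_char_0 \<Rightarrow> 'v \<Rightarrow> 'a"
  assumes "\<And>v. \<exists>F. \<forall>t. \<gamma> t v = poly F t" "\<And>t. t \<noteq> 0 \<Longrightarrow> peval (\<gamma> t) f = 0"
  shows "peval (\<gamma> 0) f = 0"
proof -
  have "rat_fun 1 (\<lambda>t. \<gamma> t v)" for v
    using assms(1)[of v] unfolding rat_fun_def by auto
  then have "rat_fun 1 (\<lambda>t. peval (\<gamma> t) f)" by (rule rat_fun_peval)
  then obtain F where F: "\<And>t. peval (\<gamma> t) f = poly F t" unfolding rat_fun_def by auto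
  have "[:0, 1:] * F = 0"
  proof (rule ccontr)
    assume "[:0, 1:] * F \<noteq> 0"
    then obtain t where "poly ([:0, 1:] * F) t \<noteq> 0" using poly_nonroot by blast
    then show False using assms(2)[of t] F[of t] by auto
  qed
  then have "F = 0" by simp
  then show ?thesis using F[of 0] by simp
qed

text \<open>Two polynomials nonvanishing at the two ends of a rational curve are simultaneously
  nonzero somewhere on it, because the field is infinite.\<close>

lemma prime_ideal_vanishing:
  fixes X :: "('v \<Rightarrow> 'a::field_char_0) set"
  assumes "X \<noteq> {}"
    and curve: "\<And>p q. p \<in> X \<Longrightarrow> q \<in> X \<Longrightarrow> \<exists>D \<gamma>. poly D 0 \<noteq> 0 \<and> poly D 1 \<noteq> 0 \<and> \<gamma> 0 = p \<and> \<gamma> 1 = q \<and>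
      (\<forall>v. rat_fun D (\<lambda>t. \<gamma> t v)) \<and> (\<forall>t. poly D t \<noteq> 0 \<longrightarrow> \<gamma> t \<in> X)"
  shows "prime_ideal (vanishing X)"
  unfolding prime_ideal_def
proof (intro conjI allI impI)
  show "is_ideal (vanishing X)" by (rule is_ideal_vanishing)
  show "1 \<notin> vanishing X" using assms(1) by (auto simp: vanishing_def peval_simps)
  fix f g :: "('v, 'a) mpoly"
  assume fg: "f * g \<in> vanishing X"
  show "f \<in> vanishing X \<or> g \<in> vanishing X"
  proof (rule ccontr)
    assume "\<not> ?thesis"
    then obtain p q where pq: "p \<in> X" "peval p f \<noteq> 0" "q \<in> X" "peval q g \<noteq> 0"
      by (auto simp: vanishing_def)
    obtain D \<gamma> where D: "poly D 0 \<noteq> 0" "poly D 1 \<noteq> 0" and \<gamma>: "\<gamma> 0 = p" "\<gamma> 1 = q"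
      and rf: "\<And>v. rat_fun D (\<lambda>t. \<gamma> t v)" and X: "\<And>t. poly D t \<noteq> 0 \<Longrightarrow> \<gamma> t \<in> X"
      using curve[OF pq(1,3)] by blast
    obtain F N where F: "\<And>t. poly D t \<noteq> 0 \<Longrightarrow> peval (\<gamma> t) f * poly D t ^ N = poly F t"
      using rat_fun_peval[of D \<gamma> f, OF rf] unfolding rat_fun_def by blast
    obtain G M where G: "\<And>t. poly D t \<noteq> 0 \<Longrightarrow> peval (\<gamma> t) g * poly D t ^ M = poly G t"
      using rat_fun_peval[of D \<gamma> g, OF rf] unfolding rat_fun_def by blast
    have "F \<noteq> 0" using F[OF D(1)] D(1) pq(2) \<gamma> by auto
    moreover have "G \<noteq> 0" using G[OF D(2)] D(2) pq(4) \<gamma> by auto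
    moreover have "D \<noteq> 0" using D(1) by auto
    ultimately have "D * F * G \<noteq> 0" by simp
    then obtain t where "poly (D * F * G) t \<noteq> 0" using poly_nonroot by blast
    then have t: "poly D t \<noteq> 0" "poly F t \<noteq> 0" "poly G t \<noteq> 0" by auto
    have "peval (\<gamma> t) (f * g) = 0" using fg X[OF t(1)] by (auto simp: vanishing_def)
    then have "peval (\<gamma> t) f = 0 \<or> peval (\<gamma> t) g = 0" by (simp add: peval_simps)
    then show False using F[OF t(1)] G[OF t(1)] t by auto
  qed
qed

section \<open>Charts in which the zero fibre is linear\<close>

text \<open>For \<open>i \<in> I\<close> the entry \<open>Inr i\<close> of the argument is read as
  the product of the two coordinates and divided by the first. In terms of these products the
  equations of the zero fibre are linear.\<close>

definition torus_chart :: "'n set \<Rightarrow> ('n + 'n \<Rightarrow> 'a::field) \<Rightarrow> 'n + 'n \<Rightarrow> 'a" where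
  "torus_chart I p = case_sum (\<lambda>i. p (Inl i)) (\<lambda>i. if i \<in> I then p (Inr i) / p (Inl i) else p (Inr i))"

lemma torus_chart_simps [simp]:
  "torus_chart I p (Inl i) = p (Inl i)"
  "torus_chart I p (Inr i) = (if i \<in> I then p (Inr i) / p (Inl i) else p (Inr i))"
  by (auto simp: torus_chart_def)

text \<open>Before the chart is applied, two points are joined by a line inside \<open>M\<close>.
  The only denominators are the coordinates \<open>Inl i\<close> with \<open>i \<in> I\<close>;
  their product along the line is nonzero at both ends.\<close>

lemma prime_ideal_vanishing_torus_chart:
  fixes M :: "('n::finite + 'n \<Rightarrow> 'a::field_char_0) set"
  assumes affine: "\<And>p q t. p \<in> M \<Longrightarrow> q \<in> M \<Longrightarrow> (\<lambda>v. (1 - t) * p v + t * q v) \<in> M"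
    and nonempty: "\<exists>p\<in>M. \<forall>i\<in>I. p (Inl i) \<noteq> 0"
  shows "prime_ideal (vanishing (torus_chart I ` {p\<in>M. \<forall>i\<in>I. p (Inl i) \<noteq> 0}))"
proof (rule prime_ideal_vanishing)
  let ?M = "{p\<in>M. \<forall>i\<in>I. p (Inl i) \<noteq> 0}"
  show "torus_chart I ` ?M \<noteq> {}" using nonempty by auto
  fix p' q' assume "p' \<in> torus_chart I ` ?M" "q' \<in> torus_chart I ` ?M"
  then obtain p q where p: "p \<in> M" "\<And>i. i \<in> I \<Longrightarrow> p (Inl i) \<noteq> 0" "p' = torus_chart I p"
    and q: "q \<in> M" "\<And>i. i \<in> I \<Longrightarrow> q (Inl i) \<noteq> 0" "q' = torus_chart I q" by auto
  define L where "L v = [:p v, q v - p v:]" for v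
  have L: "poly (L v) t = (1 - t) * p v + t * q v" for v t
    by (simp add: L_def algebra_simps)
  define D where "D = (\<Prod>i\<in>I. L (Inl i))"
  define \<gamma> where "\<gamma> t = torus_chart I (\<lambda>v. poly (L v) t)" for t
  have D: "poly D t = (\<Prod>i\<in>I. poly (L (Inl i)) t)" for t by (simp add: D_def poly_prod)
  have "poly D 0 \<noteq> 0" "poly D 1 \<noteq> 0" using p q by (auto simp: D L)
  moreover have "\<gamma> 0 = p'" "\<gamma> 1 = q'" using p q by (auto simp: \<gamma>_def L)
  moreover have "rat_fun D (\<lambda>t. \<gamma> t v)" for v
  proof (cases v)
    case (Inl i)
    then show ?thesis using rat_fun_poly[of D "L (Inl i)"] by (simp add: \<gamma>_def)
  next
    case (Inr i)
    show ?thesis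
    proof (cases "i \<in> I")
      case True
      have "\<gamma> t v * poly D t ^ 1 = poly (L (Inr i) * (\<Prod>k\<in>I - {i}. L (Inl k))) t" if "poly D t \<noteq> 0" for t
      proof -
        have "poly D t = poly (L (Inl i)) t * (\<Prod>k\<in>I - {i}. poly (L (Inl k)) t)"
          using True by (simp add: D prod.remove)
        then show ?thesis using that True Inr by (simp add: \<gamma>_def poly_prod)
      qed
      then show ?thesis by (rule rat_funI)
    next
      case False
      then show ?thesis using rat_fun_poly[of D "L (Inr i)"] Inr by (simp add: \<gamma>_def)
    qed
  qed
  moreover have "\<gamma> t \<in> torus_chart I ` ?M" if "poly D t \<noteq> 0" for t
  proof -
    have "(\<lambda>v. poly (L v) t) \<in> M" unfolding L by (rule affine[OF p(1) q(1)])
    moreover have "\<forall>i\<in>I. poly (L (Inl i)) t \<noteq> 0" using that by (auto simp: D)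
    ultimately show ?thesis unfolding \<gamma>_def by auto
  qed
  ultimately show "\<exists>D \<gamma>. poly D 0 \<noteq> 0 \<and> poly D 1 \<noteq> 0 \<and> \<gamma> 0 = p' \<and> \<gamma> 1 = q' \<and>
      (\<forall>v. rat_fun D (\<lambda>t. \<gamma> t v)) \<and> (\<forall>t. poly D t \<noteq> 0 \<longrightarrow> \<gamma> t \<in> torus_chart I ` ?M)"
    by blast
qed

section \<open>Row relations and generators indexed by a row basis\<close>

lemma (in coeff_hom) h_sum: "h (sum f A) = (\<Sum>x\<in>A. h (f x))"
  by (induction A rule: infinite_finite_induct) (auto simp: h_0 h_add)

lemma (in coeff_hom) h_uminus: "h (- x) = - h x"
  using h_add[of x "- x"] by (simp add: h_0 add_eq_0_iff)

lemma of_rat_const_coeff_hom: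
  "coeff_hom (\<lambda>q. Poly_Mapping.single 0 (of_rat q) :: 'k::comm_monoid_add \<Rightarrow>\<^sub>0 'a::field_char_0)"
  by unfold_locales (auto simp: of_rat_add of_rat_mult single_add mult_single)

lemma keys_const_mult: "Poly_Mapping.keys (Poly_Mapping.single 0 c * p) \<subseteq> Poly_Mapping.keys p"
  using keys_mult[of "Poly_Mapping.single 0 c" p] by (auto split: if_splits)

definition mdeg :: "('v::finite \<Rightarrow>\<^sub>0 nat) \<Rightarrow> nat" where
  "mdeg m = (\<Sum>v\<in>UNIV. Poly_Mapping.lookup m v)"

lemma mdeg_add: "mdeg (m + m') = mdeg m + mdeg m'"
  by (simp add: mdeg_def lookup_add sum.distrib)

lemma mdeg_single: "mdeg (Poly_Mapping.single v k) = k"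
  by (simp add: mdeg_def lookup_single when_def)

abbreviation xy_monomial :: "'n \<Rightarrow> 'n + 'n \<Rightarrow>\<^sub>0 nat" where
  "xy_monomial i \<equiv> Poly_Mapping.single (Inl i) 1 + Poly_Mapping.single (Inr i) 1"

lemma Var_mult_Var: "Var (Inl i) * Var (Inr i) = Poly_Mapping.single (xy_monomial i) 1"
  by (simp add: Var_def mult_single)

text \<open>On the zero fibre the products of dual coordinates satisfy exactly the linear relations between
  the rows of the weight matrix. Choosing a basis \<open>P\<close> of the row space, these read
  \<open>u i = (\<Sum>j\<in>- P. \<Lambda> i j * u j)\<close>; the vectors \<open>t\<close> are dual to the basis.\<close>

locale pivot_rows =
  fixes r :: nat and S :: "'n::finite \<Rightarrow> nat \<Rightarrow> int" and P :: "'n set"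
    and \<Lambda> :: "'n \<Rightarrow> 'n \<Rightarrow> rat" and t :: "'n \<Rightarrow> nat \<Rightarrow> rat"
  assumes coeff_free: "i \<notin> P \<Longrightarrow> \<Lambda> i j = (if i = j then 1 else 0)"
    and row_free: "j \<notin> P \<Longrightarrow> k < r \<Longrightarrow> of_int (S j k) = - (\<Sum>i\<in>P. \<Lambda> i j * of_int (S i k))"
    and dual: "i \<in> P \<Longrightarrow> a \<in> P \<Longrightarrow> (\<Sum>k<r. t i k * of_int (S a k)) = (if i = a then 1 else 0)"
    and card_P: "card P = rank_rows r S UNIV"
begin

text \<open>The coefficient homomorphism is arbitrary because the identity is applied to constant
  polynomials, for the ideal, and to rational vectors, for relations between rows.\<close>

lemma relation_via_pivots:
  assumes "coeff_hom c" "k < r"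
  shows "(\<Sum>i\<in>UNIV. c (of_int (S i k)) * u i) =
    (\<Sum>i\<in>P. c (of_int (S i k)) * (u i - (\<Sum>j\<in>- P. c (\<Lambda> i j) * u j)))"
proof -
  interpret coeff_hom c by fact
  have "(\<Sum>i\<in>UNIV. c (of_int (S i k)) * u i) =
      (\<Sum>i\<in>P. c (of_int (S i k)) * u i) + (\<Sum>j\<in>- P. c (of_int (S j k)) * u j)"
    by (subst sum.union_disjoint[symmetric]) simp_all
  also have "(\<Sum>j\<in>- P. c (of_int (S j k)) * u j) =
      - (\<Sum>j\<in>- P. \<Sum>i\<in>P. c (of_int (S i k)) * (c (\<Lambda> i j) * u j))"
    unfolding sum_negf[symmetric]
    by (intro sum.cong refl)
       (simp add: row_free[OF _ assms(2)] h_uminus h_sum h_mult sum_distrib_left sum_distrib_right sum_negf algebra_simps)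
  also have "(\<Sum>j\<in>- P. \<Sum>i\<in>P. c (of_int (S i k)) * (c (\<Lambda> i j) * u j)) =
      (\<Sum>i\<in>P. c (of_int (S i k)) * (\<Sum>j\<in>- P. c (\<Lambda> i j) * u j))"
    by (subst sum.swap) (simp add: sum_distrib_left)
  finally show ?thesis by (simp add: sum_subtractf right_diff_distrib)
qed

text \<open>The dual vectors invert \<open>relation_via_pivots\<close>, so the components of the
  moment map and the pivot relations generate the same ideal.\<close>

lemma pivot_via_relations:
  assumes "coeff_hom c" "i \<in> P"
  shows "u i - (\<Sum>j\<in>- P. c (\<Lambda> i j) * u j) = (\<Sum>k<r. c (t i k) * (\<Sum>i\<in>UNIV. c (of_int (S i k)) * u i))"
proof -
  interpret coeff_hom c by fact
  let ?g = "\<lambda>i. u i - (\<Sum>j\<in>- P. c (\<Lambda> i j) * u j)"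
  have "(\<Sum>k<r. c (t i k) * (\<Sum>i\<in>UNIV. c (of_int (S i k)) * u i)) =
      (\<Sum>k<r. \<Sum>a\<in>P. c (t i k * of_int (S a k)) * ?g a)"
    by (intro sum.cong refl) (simp add: relation_via_pivots[OF assms(1)] sum_distrib_left h_mult mult.assoc)
  also have "\<dots> = (\<Sum>a\<in>P. c (\<Sum>k<r. t i k * of_int (S a k)) * ?g a)"
    by (subst sum.swap) (simp add: h_sum sum_distrib_right)
  also have "\<dots> = (\<Sum>a\<in>P. if a = i then ?g a else 0)"
    using assms(2) by (intro sum.cong refl) (auto simp: dual h_0 h_1)
  finally show ?thesis using assms(2) by simp
qed

text \<open>By \<open>coeff_free\<close> this is zero at free indices, so only the pivots contribute
  generators.\<close>

definition gpol :: "'n \<Rightarrow> ('n + 'n, 'a::field_char_0) mpoly" where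
  "gpol i = Var (Inl i) * Var (Inr i) -
    (\<Sum>j\<in>- P. Poly_Mapping.single 0 (of_rat (\<Lambda> i j)) * (Var (Inl j) * Var (Inr j)))"

lemma mu_comp_alt:
  "(mu_comp r S k :: ('n + 'n, 'a::field_char_0) mpoly) =
    (\<Sum>i\<in>UNIV. Poly_Mapping.single 0 (of_rat (of_int (S i k))) * (Var (Inl i) * Var (Inr i)))"
  unfolding mu_comp_def by (simp add: mult.assoc)

lemma is_ideal_mu_ideal: "is_ideal (mu_ideal r S)"
  unfolding mu_ideal_def by (rule is_ideal_ideal_gen)

text \<open>Passing to these generators makes their number equal to the rank, as a complete
  intersection requires.\<close>

lemma mu_ideal_eq: "(mu_ideal r S :: ('n + 'n, 'a::field_char_0) mpoly set) = ideal_gen (gpol ` P)"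
proof -
  note hom = of_rat_const_coeff_hom[where 'k = "'n + 'n \<Rightarrow>\<^sub>0 nat" and 'a = 'a]
  have "(mu_comp r S k :: ('n + 'n, 'a) mpoly) \<in> ideal_gen (gpol ` P)" if "k < r" for k
    unfolding mu_comp_alt relation_via_pivots[OF hom that] gpol_def[symmetric]
    by (intro ideal_sum ideal_mult_left is_ideal_ideal_gen subsetD[OF ideal_gen_superset] imageI)
  then have "(mu_ideal r S :: ('n + 'n, 'a) mpoly set) \<subseteq> ideal_gen (gpol ` P)"
    unfolding mu_ideal_def by (intro ideal_gen_least is_ideal_ideal_gen) auto
  moreover have "(gpol i :: ('n + 'n, 'a) mpoly) \<in> mu_ideal r S" if "i \<in> P" for i
  proof -
    have "gpol i = (\<Sum>k<r. Poly_Mapping.single 0 (of_rat (t i k)) * (mu_comp r S k :: ('n + 'n, 'a) mpoly))"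
      unfolding gpol_def mu_comp_alt by (rule pivot_via_relations[OF hom that])
    moreover have "(mu_comp r S k :: ('n + 'n, 'a) mpoly) \<in> mu_ideal r S" if "k < r" for k
      unfolding mu_ideal_def using that by (intro subsetD[OF ideal_gen_superset]) auto
    ultimately show ?thesis
      using is_ideal_mu_ideal by (auto intro!: ideal_sum ideal_mult_left)
  qed
  then have "ideal_gen (gpol ` P) \<subseteq> (mu_ideal r S :: ('n + 'n, 'a) mpoly set)"
    by (intro ideal_gen_least) (auto simp: mu_ideal_def is_ideal_ideal_gen)
  ultimately show ?thesis by blast
qed

lemma gpol_mem: "(gpol i :: ('n + 'n, 'a::field_char_0) mpoly) \<in> mu_ideal r S"
proof (cases "i \<in> P")
  case True
  then show ?thesis unfolding mu_ideal_eq using ideal_gen_superset[of "gpol ` P"] by auto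
next
  case False
  have "(\<Sum>j\<in>- P. Poly_Mapping.single 0 (of_rat (\<Lambda> i j)) * (Var (Inl j) * Var (Inr j))) =
      (\<Sum>j\<in>- P. if j = i then Var (Inl i) * Var (Inr i) else (0 :: ('n + 'n, 'a) mpoly))"
    by (intro sum.cong refl) (auto simp: coeff_free[OF False])
  then have "(gpol i :: ('n + 'n, 'a) mpoly) = 0" using False by (simp add: gpol_def)
  then show ?thesis using ideal_zero[OF is_ideal_mu_ideal] by simp
qed

subsection \<open>Normal forms modulo the ideal\<close>

definition std :: "('n + 'n \<Rightarrow>\<^sub>0 nat) \<Rightarrow> bool" where
  "std m \<longleftrightarrow> (\<forall>i\<in>P. Poly_Mapping.lookup m (Inl i) = 0 \<or> Poly_Mapping.lookup m (Inr i) = 0)"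

text \<open>Replacing a pivot product by free products lowers the total exponent of the pivot
  variables \<open>Inl i\<close>, which gives termination. The rule is homogeneous and keeps the
  degree, on which the dimension count relies.\<close>

lemma normal_form_monomial:
  "\<exists>g :: ('n + 'n, 'a::field_char_0) mpoly. Poly_Mapping.single m 1 - g \<in> mu_ideal r S \<and>
    (\<forall>l\<in>Poly_Mapping.keys g. std l \<and> mdeg l = mdeg m)"
proof (induction "\<Sum>i\<in>P. Poly_Mapping.lookup m (Inl i)" arbitrary: m rule: less_induct)
  case less
  show ?case
  proof (cases "std m")
    case True
    then show ?thesis
      by (intro exI[of _ "Poly_Mapping.single m 1"]) (auto simp: ideal_zero[OF is_ideal_mu_ideal])
  next
    case False
    then obtain i where i: "i \<in> P" "Poly_Mapping.lookup m (Inl i) \<noteq> 0" "Poly_Mapping.lookup m (Inr i) \<noteq> 0"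
      unfolding std_def by auto
    define m' where "m' = m - xy_monomial i"
    have m: "m = m' + xy_monomial i"
      by (rule poly_mapping_eqI) (use i in \<open>auto simp: m'_def lookup_add lookup_minus lookup_single when_def\<close>)
    have less': "(\<Sum>a\<in>P. Poly_Mapping.lookup (m' + xy_monomial j) (Inl a)) < (\<Sum>a\<in>P. Poly_Mapping.lookup m (Inl a))"
      if "j \<in> - P" for j
    proof (rule sum_strict_mono_ex1)
      show "\<forall>a\<in>P. Poly_Mapping.lookup (m' + xy_monomial j) (Inl a) \<le> Poly_Mapping.lookup m (Inl a)"
        using that by (auto simp: m lookup_add lookup_single when_def)
      show "\<exists>a\<in>P. Poly_Mapping.lookup (m' + xy_monomial j) (Inl a) < Poly_Mapping.lookup m (Inl a)"
        using that i(1) by (intro bexI[of _ i]) (auto simp: m lookup_add lookup_single when_def)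
    qed simp
    have "\<forall>j\<in>- P. \<exists>g :: ('n + 'n, 'a) mpoly. Poly_Mapping.single (m' + xy_monomial j) 1 - g \<in> mu_ideal r S \<and>
        (\<forall>l\<in>Poly_Mapping.keys g. std l \<and> mdeg l = mdeg m)"
      using less[OF less'] by (auto simp: m mdeg_add mdeg_single)
    then obtain G :: "'n \<Rightarrow> ('n + 'n, 'a) mpoly" where
      G: "\<And>j. j \<in> - P \<Longrightarrow> Poly_Mapping.single (m' + xy_monomial j) 1 - G j \<in> mu_ideal r S"
         "\<And>j l. j \<in> - P \<Longrightarrow> l \<in> Poly_Mapping.keys (G j) \<Longrightarrow> std l \<and> mdeg l = mdeg m"
      by metis
    let ?C = "\<lambda>j. Poly_Mapping.single 0 (of_rat (\<Lambda> i j)) :: ('n + 'n, 'a) mpoly"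
    let ?g = "\<Sum>j\<in>- P. ?C j * G j"
    have "Poly_Mapping.single m 1 - (\<Sum>j\<in>- P. ?C j * Poly_Mapping.single (m' + xy_monomial j) 1) =
        Poly_Mapping.single m' 1 * gpol i"
      by (simp add: m gpol_def Var_mult_Var right_diff_distrib sum_distrib_left mult_single)
    then have 1: "Poly_Mapping.single m 1 - (\<Sum>j\<in>- P. ?C j * Poly_Mapping.single (m' + xy_monomial j) 1) \<in> mu_ideal r S"
      using ideal_mult_left[OF is_ideal_mu_ideal gpol_mem] by simp
    have "(\<Sum>j\<in>- P. ?C j * (Poly_Mapping.single (m' + xy_monomial j) 1 - G j)) \<in> mu_ideal r S"
      by (intro ideal_sum[OF is_ideal_mu_ideal] ideal_mult_left[OF is_ideal_mu_ideal] G(1))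
    then have 2: "(\<Sum>j\<in>- P. ?C j * Poly_Mapping.single (m' + xy_monomial j) 1) - ?g \<in> mu_ideal r S"
      by (simp add: right_diff_distrib sum_subtractf)
    have "std l \<and> mdeg l = mdeg m" if "l \<in> Poly_Mapping.keys ?g" for l
    proof -
      have "\<exists>j\<in>- P. l \<in> Poly_Mapping.keys (?C j * G j)"
      proof (rule ccontr)
        assume "\<not> ?thesis"
        then have "Poly_Mapping.lookup ?g l = 0" by (auto simp: lookup_sum in_keys_iff intro!: sum.neutral)
        then show False using that by (simp add: in_keys_iff)
      qed
      then show ?thesis using keys_const_mult G(2) by blast
    qed
    with ideal_diff_trans[OF is_ideal_mu_ideal 1 2] show ?thesis by blast
  qed
qed

lemma normal_form:
  fixes f :: "('n + 'n, 'a::field_char_0) mpoly"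
  assumes "\<And>m. m \<in> Poly_Mapping.keys f \<Longrightarrow> mdeg m \<le> N"
  shows "\<exists>g. f - g \<in> mu_ideal r S \<and> (\<forall>l\<in>Poly_Mapping.keys g. std l \<and> mdeg l \<le> N)"
proof -
  obtain G :: "_ \<Rightarrow> ('n + 'n, 'a) mpoly" where
    G: "\<And>m. Poly_Mapping.single m 1 - G m \<in> mu_ideal r S"
       "\<And>m l. l \<in> Poly_Mapping.keys (G m) \<Longrightarrow> std l \<and> mdeg l = mdeg m"
    using normal_form_monomial[where 'a = 'a] by metis
  let ?C = "\<lambda>m. Poly_Mapping.single 0 (Poly_Mapping.lookup f m) :: ('n + 'n, 'a) mpoly"
  let ?g = "\<Sum>m\<in>Poly_Mapping.keys f. ?C m * G m"
  have "(\<Sum>m\<in>Poly_Mapping.keys f. ?C m * (Poly_Mapping.single m 1 - G m)) \<in> mu_ideal r S"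
    by (intro ideal_sum[OF is_ideal_mu_ideal] ideal_mult_left[OF is_ideal_mu_ideal] G(1))
  also have "(\<Sum>m\<in>Poly_Mapping.keys f. ?C m * (Poly_Mapping.single m 1 - G m)) = f - ?g"
    by (simp add: right_diff_distrib sum_subtractf mult_single flip: poly_mapping_sum_single)
  finally have "f - ?g \<in> mu_ideal r S" .
  moreover have "std l \<and> mdeg l \<le> N" if "l \<in> Poly_Mapping.keys ?g" for l
  proof -
    have "\<exists>m\<in>Poly_Mapping.keys f. l \<in> Poly_Mapping.keys (?C m * G m)"
    proof (rule ccontr)
      assume "\<not> ?thesis"
      then have "Poly_Mapping.lookup ?g l = 0" by (auto simp: lookup_sum in_keys_iff intro!: sum.neutral)
      then show False using that by (simp add: in_keys_iff)
    qed
    then show ?thesis using keys_const_mult G(2) assms by fastforce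
  qed
  ultimately show ?thesis by blast
qed

end

subsection \<open>Embedding into Laurent polynomial rings\<close>

text \<open>Exponent vectors of Laurent monomials: index \<open>0\<close> carries the total degree, the odd indices the
  torus coordinates and the positive even indices the free products \<open>u j\<close>. The degree comes first in
  the lexicographic order, so that every leading exponent has only finitely many predecessors.\<close>

type_synonym expo = "nat \<Rightarrow>\<^sub>0 int"

definition xidx :: "'n::finite \<Rightarrow> nat" where "xidx i = 2 * to_nat i + 1"
definition widx :: "'n::finite \<Rightarrow> nat" where "widx i = 2 * to_nat i + 2"

lemma idx_simps [simp]:
  "xidx i \<noteq> 0" "0 \<noteq> xidx i" "widx i \<noteq> 0" "0 \<noteq> widx i"
  "xidx i = xidx j \<longleftrightarrow> i = j" "widx i = widx j \<longleftrightarrow> i = j" "xidx i \<noteq> widx j" "widx j \<noteq> xidx i"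
proof -
  have "2 * a + 1 \<noteq> 2 * b + (2::nat)" for a b by presburger
  then show "xidx i \<noteq> widx j" "widx j \<noteq> xidx i" by (metis xidx_def widx_def)+
qed (simp_all add: xidx_def widx_def)

definition hexp :: expo where "hexp = Poly_Mapping.single 0 1"
definition xexp :: "'n::finite \<Rightarrow> expo" where "xexp i = Poly_Mapping.single (xidx i) 1"
definition wexp :: "'n::finite \<Rightarrow> expo" where "wexp j = Poly_Mapping.single (widx j) 1"

lemma wexp_inject: "wexp i = wexp j \<longleftrightarrow> i = j"
proof
  assume "wexp i = wexp j"
  then have "Poly_Mapping.lookup (wexp i) (widx i) = Poly_Mapping.lookup (wexp j) (widx i)" by simp
  then show "i = j" by (simp add: wexp_def lookup_single when_def split: if_splits)
qed simp

lemma sum_UNIV_Plus: "(\<Sum>v\<in>UNIV. f v) = (\<Sum>i\<in>UNIV. f (Inl i)) + (\<Sum>i\<in>UNIV. f (Inr i))"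
  for f :: "'n::finite + 'n \<Rightarrow> 'b::comm_monoid_add"
proof -
  have "(\<Sum>v\<in>UNIV <+> UNIV. f v) = (\<Sum>i\<in>UNIV. f (Inl i)) + (\<Sum>i\<in>UNIV. f (Inr i))"
    by (subst sum.Plus) auto
  then show ?thesis by simp
qed

context pivot_rows
begin

definition Z :: "'n set" where
  "Z = {i. \<forall>j\<in>- P. \<Lambda> i j = 0}"

lemma Z_subset: "Z \<subseteq> P"
proof (rule subsetI, rule ccontr)
  fix i assume "i \<in> Z" "i \<notin> P"
  then show False using coeff_free[of i i] by (auto simp: Z_def)
qed

text \<open>The free index carrying the leading term of the linear form at \<open>i\<close>;
  meaningful only for \<open>i \<notin> Z\<close>.\<close>

definition jlead :: "'n \<Rightarrow> 'n" where
  "jlead i = (SOME j. j \<in> - P \<and> \<Lambda> i j \<noteq> 0 \<and> (\<forall>k\<in>- P. \<Lambda> i k \<noteq> 0 \<longrightarrow> wexp k \<le> wexp j))"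

lemma jlead:
  assumes "i \<notin> Z"
  shows "jlead i \<in> - P" "\<Lambda> i (jlead i) \<noteq> 0" "\<And>k. k \<in> - P \<Longrightarrow> \<Lambda> i k \<noteq> 0 \<Longrightarrow> wexp k \<le> wexp (jlead i)"
proof -
  let ?A = "{j \<in> - P. \<Lambda> i j \<noteq> 0}"
  have "Max (wexp ` ?A) \<in> wexp ` ?A" using assms by (intro Max_in) (auto simp: Z_def)
  then obtain j where j: "j \<in> ?A" "Max (wexp ` ?A) = wexp j" by auto
  then have "wexp k \<le> wexp j" if "k \<in> ?A" for k using that j(2)[symmetric] by simp
  with j have "\<exists>j. j \<in> - P \<and> \<Lambda> i j \<noteq> 0 \<and> (\<forall>k\<in>- P. \<Lambda> i k \<noteq> 0 \<longrightarrow> wexp k \<le> wexp j)" by auto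
  from someI_ex[OF this] show "jlead i \<in> - P" "\<Lambda> i (jlead i) \<noteq> 0"
    "\<And>k. k \<in> - P \<Longrightarrow> \<Lambda> i k \<noteq> 0 \<Longrightarrow> wexp k \<le> wexp (jlead i)"
    unfolding jlead_def by blast+
qed

lemma jlead_free:
  assumes "i \<notin> P"
  shows "jlead i = i"
proof -
  have "i \<notin> Z" using assms Z_subset by auto
  from jlead(2)[OF this] show ?thesis by (auto simp: coeff_free[OF assms] split: if_splits)
qed

text \<open>Over a component of the zero fibre labelled by \<open>E \<subseteq> Z\<close> the coordinates \<open>x i\<close>, \<open>i \<in> Z - E\<close>, and
  \<open>\<phi> i\<close>, \<open>i \<in> Z \<inter> E\<close>, vanish.\<close>

definition point :: "'n set \<Rightarrow> 'n + 'n \<Rightarrow> expo \<Rightarrow>\<^sub>0 'a::field_char_0" where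
  "point E = case_sum
     (\<lambda>i. if i \<in> Z - E then 0 else Poly_Mapping.single (hexp + xexp i) 1)
     (\<lambda>i. if i \<in> Z then if i \<in> E then 0 else Poly_Mapping.single (hexp - xexp i) 1
          else \<Sum>j\<in>- P. Poly_Mapping.single (hexp - xexp i + wexp j) (of_rat (\<Lambda> i j)))"

definition emb :: "'n set \<Rightarrow> ('n + 'n, 'a::field_char_0) mpoly \<Rightarrow> expo \<Rightarrow>\<^sub>0 'a" where
  "emb E = heval (Poly_Mapping.single 0) (point E)"

lemmas emb_simps = const_hom.heval_add[where a = "point E" for E, folded emb_def]
  const_hom.heval_mult[where a = "point E" for E, folded emb_def]
  const_hom.heval_diff[where a = "point E" for E, folded emb_def]
  const_hom.heval_power[where a = "point E" for E, folded emb_def]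
  const_hom.heval_sum[where a = "point E" for E, folded emb_def]
  const_hom.heval_Var[where a = "point E" for E, folded emb_def]
  const_hom.heval_0[where a = "point E" for E, folded emb_def]
  const_hom.heval_1[where a = "point E" for E, folded emb_def]
  const_hom.heval_single[where a = "point E" for E, folded emb_def]

text \<open>For \<open>i \<in> Z\<close> one factor is killed and the linear form is zero, so every
  choice of \<open>E\<close> respects the relations.\<close>

lemma point_product:
  "point E (Inl i) * point E (Inr i) =
    (\<Sum>j\<in>- P. Poly_Mapping.single (hexp + hexp + wexp j) (of_rat (\<Lambda> i j) :: 'a::field_char_0))"
proof (cases "i \<in> Z")
  case True
  then have "\<Lambda> i j = 0" if "j \<in> - P" for j using that by (auto simp: Z_def)
  then show ?thesis using True by (simp add: point_def)
next
  case False
  then show ?thesis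
    by (simp add: point_def sum_distrib_left mult_single algebra_simps)
qed

lemma emb_gpol: "emb E (gpol i :: ('n + 'n, 'a::field_char_0) mpoly) = 0"
proof -
  have free: "point E (Inl j) * point E (Inr j) = Poly_Mapping.single (hexp + hexp + wexp j) (1 :: 'a)" if "j \<in> - P" for j
  proof -
    have "(\<Sum>k\<in>- P. Poly_Mapping.single (hexp + hexp + wexp k) (of_rat (\<Lambda> j k) :: 'a)) =
        (\<Sum>k\<in>- P. if k = j then Poly_Mapping.single (hexp + hexp + wexp j) 1 else 0)"
      using that by (intro sum.cong refl) (auto simp: coeff_free)
    then show ?thesis using that by (simp add: point_product)
  qed
  have "emb E (gpol i :: ('n + 'n, 'a) mpoly) = point E (Inl i) * point E (Inr i) -
      (\<Sum>j\<in>- P. Poly_Mapping.single 0 (of_rat (\<Lambda> i j)) * (point E (Inl j) * point E (Inr j)))"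
    by (simp add: gpol_def emb_simps)
  also have "(\<Sum>j\<in>- P. Poly_Mapping.single 0 (of_rat (\<Lambda> i j)) * (point E (Inl j) * point E (Inr j))) =
      (\<Sum>j\<in>- P. Poly_Mapping.single (hexp + hexp + wexp j) (of_rat (\<Lambda> i j) :: 'a))"
    by (intro sum.cong refl) (simp add: free mult_single)
  finally show ?thesis by (simp add: point_product)
qed

lemma emb_mu_ideal:
  assumes "f \<in> mu_ideal r S"
  shows "emb E (f :: ('n + 'n, 'a::field_char_0) mpoly) = 0"
proof -
  have "is_ideal {f :: ('n + 'n, 'a) mpoly. emb E f = 0}"
    by (auto simp: is_ideal_def emb_simps)
  then have "ideal_gen (gpol ` P) \<subseteq> {f :: ('n + 'n, 'a) mpoly. emb E f = 0}"
    by (rule ideal_gen_least) (auto simp: emb_gpol)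
  then show ?thesis using assms by (auto simp: mu_ideal_eq)
qed

section \<open>Leading exponents of embedded monomials\<close>

definition killed :: "'n set \<Rightarrow> 'n + 'n \<Rightarrow> bool" where
  "killed E = case_sum (\<lambda>i. i \<in> Z - E) (\<lambda>i. i \<in> Z \<inter> E)"

text \<open>Leading exponents of the images of the variables. They do not depend on
  \<open>E\<close>: variables sent to zero are excluded through \<open>killed\<close>
  instead.\<close>

definition vexp :: "'n + 'n \<Rightarrow> expo" where
  "vexp = case_sum (\<lambda>i. hexp + xexp i) (\<lambda>i. hexp - xexp i + (if i \<in> Z then 0 else wexp (jlead i)))"

definition mexp :: "('n + 'n \<Rightarrow>\<^sub>0 nat) \<Rightarrow> expo" where
  "mexp m = (\<Sum>v\<in>UNIV. frag_cmul (int (Poly_Mapping.lookup m v)) (vexp v))"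

lemma point_killed: "killed E v \<Longrightarrow> point E v = 0"
  by (cases v) (auto simp: killed_def point_def)

lemma lead_point:
  assumes "\<not> killed E v"
  shows "lead (point E v :: expo \<Rightarrow>\<^sub>0 'a::field_char_0) (vexp v)"
proof (cases v)
  case (Inl i)
  then show ?thesis using assms by (auto simp: killed_def point_def vexp_def intro: lead_single)
next
  case (Inr i)
  show ?thesis
  proof (cases "i \<in> Z")
    case True
    then show ?thesis using Inr assms by (auto simp: killed_def point_def vexp_def intro: lead_single)
  next
    case False
    let ?s = "\<Sum>j\<in>- P. Poly_Mapping.single (hexp - xexp i + wexp j) (of_rat (\<Lambda> i j)) :: expo \<Rightarrow>\<^sub>0 'a"
    have look: "Poly_Mapping.lookup ?s (hexp - xexp i + wexp j) = of_rat (\<Lambda> i j)" if "j \<in> - P" for j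
    proof -
      have "Poly_Mapping.lookup ?s (hexp - xexp i + wexp j) = (\<Sum>k\<in>- P. if k = j then of_rat (\<Lambda> i j) else 0)"
        unfolding lookup_sum by (intro sum.cong refl) (auto simp: lookup_single when_def wexp_inject)
      then show ?thesis using that by simp
    qed
    have "lead ?s (hexp - xexp i + wexp (jlead i))"
      unfolding lead_def
    proof (intro conjI ballI)
      show "hexp - xexp i + wexp (jlead i) \<in> Poly_Mapping.keys ?s"
        using look[OF jlead(1)[OF False]] jlead(2)[OF False] by (simp add: in_keys_iff)
      fix l assume l: "l \<in> Poly_Mapping.keys ?s"
      have "\<exists>j\<in>- P. l = hexp - xexp i + wexp j \<and> \<Lambda> i j \<noteq> 0"
      proof (rule ccontr)
        assume "\<not> ?thesis"
        then have "Poly_Mapping.lookup ?s l = 0"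
          unfolding lookup_sum by (intro sum.neutral) (auto simp: lookup_single when_def)
        then show False using l by (simp add: in_keys_iff)
      qed
      then show "l \<le> hexp - xexp i + wexp (jlead i)" using jlead(3)[OF False] by auto
    qed
    then show ?thesis using Inr False by (simp add: point_def vexp_def)
  qed
qed

lemma lead_emb_monomial:
  assumes "c \<noteq> 0" "\<forall>v\<in>Poly_Mapping.keys m. \<not> killed E v"
  shows "lead (emb E (Poly_Mapping.single m (c :: 'a::field_char_0))) (mexp m)"
proof -
  have "lead (point E v ^ Poly_Mapping.lookup m v :: expo \<Rightarrow>\<^sub>0 'a) (frag_cmul (int (Poly_Mapping.lookup m v)) (vexp v))" for v
  proof (cases "Poly_Mapping.lookup m v = 0")
    case True
    then show ?thesis using lead_single[of "1::'a" "0::expo"] by simp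
  next
    case False
    then have "\<not> killed E v" using assms(2) by (simp add: in_keys_iff)
    then show ?thesis by (intro lead_power lead_point)
  qed
  then have "lead (\<Prod>v\<in>UNIV. point E v ^ Poly_Mapping.lookup m v :: expo \<Rightarrow>\<^sub>0 'a) (mexp m)"
    unfolding mexp_def by (intro lead_prod) auto
  from lead_mult[OF lead_single[OF assms(1)] this, of 0] show ?thesis
    by (simp add: emb_simps mon_eval_finite)
qed

lemma emb_monomial_killed:
  assumes "v \<in> Poly_Mapping.keys m" "killed E v"
  shows "emb E (Poly_Mapping.single m (c :: 'a::field_char_0)) = 0"
proof -
  have "(\<Prod>v\<in>UNIV. point E v ^ Poly_Mapping.lookup m v :: expo \<Rightarrow>\<^sub>0 'a) = 0"
    using assms by (intro prod_zero) (auto simp: point_killed in_keys_iff zero_power_eq intro!: exI[of _ v])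
  then show ?thesis by (simp add: emb_simps mon_eval_finite)
qed

lemma lookup_vexp:
  "Poly_Mapping.lookup (vexp v) 0 = 1"
  "Poly_Mapping.lookup (vexp (Inl i)) (xidx k) = (if i = k then 1 else 0)"
  "Poly_Mapping.lookup (vexp (Inr i)) (xidx k) = (if i = k then - 1 else 0)"
  "Poly_Mapping.lookup (vexp (Inl i)) (widx k) = 0"
  "Poly_Mapping.lookup (vexp (Inr i)) (widx k) = (if i \<notin> Z \<and> jlead i = k then 1 else 0)"
  by (cases v) (simp_all add: vexp_def hexp_def xexp_def wexp_def lookup_add lookup_minus lookup_single lookup_one when_def)

lemma lookup_mexp_degree: "Poly_Mapping.lookup (mexp m) 0 = int (mdeg m)"
  unfolding mexp_def mdeg_def by (simp add: lookup_sum lookup_vexp)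

lemma lookup_mexp_x:
  "Poly_Mapping.lookup (mexp m) (xidx i) =
    int (Poly_Mapping.lookup m (Inl i)) - int (Poly_Mapping.lookup m (Inr i))"
  unfolding mexp_def sum_UNIV_Plus lookup_add lookup_sum lookup_frag_cmul lookup_vexp
  by (simp add: if_distrib cong: if_cong)

lemma lookup_mexp_widx:
  "Poly_Mapping.lookup (mexp m) (widx j) = (\<Sum>k\<in>{k. k \<notin> Z \<and> jlead k = j}. int (Poly_Mapping.lookup m (Inr k)))"
proof -
  have "Poly_Mapping.lookup (mexp m) (widx j) =
    (\<Sum>k\<in>UNIV. if k \<in> {k. k \<notin> Z \<and> jlead k = j} then int (Poly_Mapping.lookup m (Inr k)) else 0)"
    unfolding mexp_def sum_UNIV_Plus lookup_add lookup_sum lookup_frag_cmul lookup_vexp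
    by (auto intro!: sum.cong)
  also have "\<dots> = (\<Sum>k\<in>{k. k \<notin> Z \<and> jlead k = j}. int (Poly_Mapping.lookup m (Inr k)))"
    by (subst sum.inter_restrict[symmetric]) simp_all
  finally show ?thesis .
qed

lemma lookup_mexp_w:
  assumes "j \<in> - P"
  shows "Poly_Mapping.lookup (mexp m) (widx j) =
    int (Poly_Mapping.lookup m (Inr j)) + (\<Sum>i\<in>{i\<in>P - Z. jlead i = j}. int (Poly_Mapping.lookup m (Inr i)))"
proof -
  have "k \<notin> Z \<and> jlead k = j \<longleftrightarrow> k = j \<or> k \<in> P - Z \<and> jlead k = j" for k
    using assms Z_subset jlead_free[of k] by (cases "k \<in> P") auto
  then have "{k. k \<notin> Z \<and> jlead k = j} = insert j {i\<in>P - Z. jlead i = j}" by blast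
  then show ?thesis using assms by (simp add: lookup_mexp_widx)
qed

text \<open>The torus coordinates give the difference of the two exponents at every index. At a
  pivot one of the two is zero, so both are known; the coordinates \<open>widx j\<close> then yield
  the exponents at free indices.\<close>

lemma mexp_inj_std:
  assumes "std m" "std m'" "mexp m = mexp m'"
  shows "m = m'"
proof -
  have d: "int (Poly_Mapping.lookup m (Inl i)) - int (Poly_Mapping.lookup m (Inr i)) =
      int (Poly_Mapping.lookup m' (Inl i)) - int (Poly_Mapping.lookup m' (Inr i))" for i
    using lookup_mexp_x[of m i] lookup_mexp_x[of m' i] assms(3) by simp
  have P: "Poly_Mapping.lookup m (Inl i) = Poly_Mapping.lookup m' (Inl i) \<and>
      Poly_Mapping.lookup m (Inr i) = Poly_Mapping.lookup m' (Inr i)" if "i \<in> P" for i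
    using d[of i] assms(1,2) that unfolding std_def by fastforce
  have F: "Poly_Mapping.lookup m (Inl i) = Poly_Mapping.lookup m' (Inl i) \<and>
      Poly_Mapping.lookup m (Inr i) = Poly_Mapping.lookup m' (Inr i)" if "i \<in> - P" for i
  proof -
    have "(\<Sum>k\<in>{k\<in>P - Z. jlead k = i}. int (Poly_Mapping.lookup m (Inr k))) =
        (\<Sum>k\<in>{k\<in>P - Z. jlead k = i}. int (Poly_Mapping.lookup m' (Inr k)))"
      by (intro sum.cong) (auto simp: P)
    then show ?thesis using lookup_mexp_w[OF that, of m] lookup_mexp_w[OF that, of m'] assms(3) d[of i] by simp
  qed
  show ?thesis
  proof (rule poly_mapping_eqI)
    fix v show "Poly_Mapping.lookup m v = Poly_Mapping.lookup m' v"
      using P F by (cases v) (metis ComplI)+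
  qed
qed

text \<open>Killed monomials drop out and the others have distinct leading exponents;
  \<open>m0\<close> guarantees that some monomial survives.\<close>

lemma lead_emb_std:
  fixes g :: "('n + 'n, 'a::field_char_0) mpoly"
  assumes "\<forall>m\<in>Poly_Mapping.keys g. std m" "m0 \<in> Poly_Mapping.keys g" "\<forall>v\<in>Poly_Mapping.keys m0. \<not> killed E v"
  shows "\<exists>m\<in>Poly_Mapping.keys g. lead (emb E g) (mexp m)"
proof -
  let ?A = "{m \<in> Poly_Mapping.keys g. \<forall>v\<in>Poly_Mapping.keys m. \<not> killed E v}"
  have "emb E g = (\<Sum>m\<in>Poly_Mapping.keys g. emb E (Poly_Mapping.single m (Poly_Mapping.lookup g m)))"
    by (subst poly_mapping_sum_single) (simp add: emb_simps)
  also have "\<dots> = (\<Sum>m\<in>?A. emb E (Poly_Mapping.single m (Poly_Mapping.lookup g m)))"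
    by (intro sum.mono_neutral_right) (auto simp: emb_monomial_killed)
  finally have eq: "emb E g = (\<Sum>m\<in>?A. emb E (Poly_Mapping.single m (Poly_Mapping.lookup g m)))" .
  have "\<exists>m\<in>?A. lead (\<Sum>m\<in>?A. emb E (Poly_Mapping.single m (Poly_Mapping.lookup g m))) (mexp m)"
  proof (rule lead_sum)
    show "inj_on mexp ?A" using assms(1) by (auto simp: inj_on_def intro: mexp_inj_std)
  qed (use assms in \<open>auto intro!: lead_emb_monomial simp: in_keys_iff\<close>)
  then show ?thesis unfolding eq by auto
qed

lemma normal_form':
  fixes f :: "('n + 'n, 'a::field_char_0) mpoly"
  obtains g where "f - g \<in> mu_ideal r S" "\<forall>l\<in>Poly_Mapping.keys g. std l"
proof -
  have "mdeg m \<le> Max (mdeg ` Poly_Mapping.keys f)" if "m \<in> Poly_Mapping.keys f" for m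
    using that by simp
  from normal_form[OF this] that show ?thesis by blast
qed

lemma emb_cong: "f - g \<in> mu_ideal r S \<Longrightarrow> emb E f = emb E (g :: ('n + 'n, 'a::field_char_0) mpoly)"
  using emb_mu_ideal[of "f - g" E] by (simp add: emb_simps)

text \<open>A normal form is nonzero under \<open>emb E\<close> as soon as \<open>E\<close> is the set of \<open>x\<close>-variables of one of its monomials.\<close>

lemma mu_ideal_iff_emb:
  "f \<in> mu_ideal r S \<longleftrightarrow> (\<forall>E. emb E (f :: ('n + 'n, 'a::field_char_0) mpoly) = 0)"
proof
  assume f: "\<forall>E. emb E f = 0"
  obtain g where g: "f - g \<in> mu_ideal r S" "\<forall>l\<in>Poly_Mapping.keys g. std l"
    by (rule normal_form'[of f])
  have "g = 0"
  proof (rule ccontr)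
    assume "g \<noteq> 0"
    then obtain m where m: "m \<in> Poly_Mapping.keys g" using keys_eq_empty by (metis all_not_in_conv in_keys_iff lookup_zero poly_mapping_eqI)
    define E where "E = {i. Poly_Mapping.lookup m (Inl i) \<noteq> 0}"
    have "\<not> killed E v" if "v \<in> Poly_Mapping.keys m" for v
    proof (cases v)
      case (Inl i)
      then show ?thesis using that by (simp add: killed_def E_def in_keys_iff)
    next
      case (Inr i)
      have "i \<notin> E" if "i \<in> Z"
      proof -
        have "i \<in> P" using that Z_subset by blast
        moreover have "std m" using g(2) m by blast
        moreover have "Poly_Mapping.lookup m (Inr i) \<noteq> 0"
          using \<open>v \<in> Poly_Mapping.keys m\<close> Inr by (simp add: in_keys_iff)
        ultimately show ?thesis unfolding E_def std_def by auto
      qed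
      then show ?thesis using Inr by (auto simp: killed_def)
    qed
    with lead_emb_std[OF g(2) m] obtain l where "lead (emb E g) l" by blast
    then have "emb E g \<noteq> 0" by (rule lead_nonzero)
    then show False using f emb_cong[OF g(1)] by simp
  qed
  with g show "f \<in> mu_ideal r S" by simp
qed (auto intro: emb_mu_ideal)

section \<open>Reducedness and primality\<close>

text \<open>The ideal is an intersection of kernels of homomorphisms into a domain.\<close>

lemma reduced_mu_ideal: "reduced_quot (mu_ideal r S :: ('n + 'n, 'a::field_char_0) mpoly set)"
  unfolding reduced_quot_def
proof (intro equalityI subsetI)
  fix f :: "('n + 'n, 'a) mpoly"
  assume "f \<in> radical (mu_ideal r S)"
  then obtain k where k: "f ^ k \<in> mu_ideal r S" by (auto simp: radical_def)
  have "emb E f = 0" for E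
    using emb_mu_ideal[OF k, of E] by (simp add: emb_simps)
  then show "f \<in> mu_ideal r S" by (simp add: mu_ideal_iff_emb)
next
  fix f :: "('n + 'n, 'a) mpoly"
  assume "f \<in> mu_ideal r S"
  then have "f ^ 1 \<in> mu_ideal r S" by simp
  then show "f \<in> radical (mu_ideal r S)" unfolding radical_def by blast
qed

lemma mu_ideal_iff_emb_empty:
  assumes "Z = {}"
  shows "f \<in> mu_ideal r S \<longleftrightarrow> emb {} (f :: ('n + 'n, 'a::field_char_0) mpoly) = 0"
proof -
  have "point E = (point {} :: _ \<Rightarrow> expo \<Rightarrow>\<^sub>0 'a)" for E by (simp add: point_def assms)
  then have "emb E f = emb {} f" for E unfolding emb_def by (rule arg_cong)
  then show ?thesis unfolding mu_ideal_iff_emb by metis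
qed

lemma prime_mu_ideal:
  assumes "Z = {}"
  shows "prime_ideal (mu_ideal r S :: ('n + 'n, 'a::field_char_0) mpoly set)"
  using is_ideal_mu_ideal by (simp add: prime_ideal_def mu_ideal_iff_emb_empty[OF assms] emb_simps)

end

subsection \<open>Normality\<close>

lemma finite_mdeg_le: "finite {m :: 'v::finite \<Rightarrow>\<^sub>0 nat. mdeg m \<le> N}"
proof (rule finite_imageD[of Poly_Mapping.lookup])
  have "Poly_Mapping.lookup m v \<le> mdeg m" for m :: "'v \<Rightarrow>\<^sub>0 nat" and v
    unfolding mdeg_def by (rule member_le_sum) auto
  then have "Poly_Mapping.lookup ` {m :: 'v \<Rightarrow>\<^sub>0 nat. mdeg m \<le> N} \<subseteq> UNIV \<rightarrow>\<^sub>E {..N}"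
    by (auto simp: PiE_def Pi_def intro: le_trans)
  then show "finite (Poly_Mapping.lookup ` {m :: 'v \<Rightarrow>\<^sub>0 nat. mdeg m \<le> N})"
    by (rule finite_subset) (auto intro: finite_PiE)
  show "inj_on Poly_Mapping.lookup {m :: 'v \<Rightarrow>\<^sub>0 nat. mdeg m \<le> N}"
    by (auto simp: inj_on_def intro: poly_mapping_eqI)
qed

text \<open>In the lexicographic order the smallest index is the most significant, so the degree
  decides first.\<close>

lemma expo_less_lookup_0: "(e :: expo) < e' \<Longrightarrow> Poly_Mapping.lookup e 0 \<le> Poly_Mapping.lookup e' 0"
  by (auto simp: less_poly_mapping.rep_eq less_fun_def) (metis le_less neq0_conv order_refl)

lemma frag_cmul_diff: "frag_cmul k (a - b) = frag_cmul k a - frag_cmul k b"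
  by (rule poly_mapping_eqI) (simp add: lookup_minus algebra_simps)

section \<open>Integral and almost integral fractions\<close>

text \<open>If the fraction \<open>a / b\<close> is integral of degree \<open>m\<close>, then
  \<open>b ^ m\<close> is a common denominator of all its powers, because powers from the
  \<open>m\<close>-th on reduce to lower ones.\<close>

lemma integral_almost_integral:
  assumes J: "is_ideal J" and int: "a ^ m + (\<Sum>k<m. c k * a ^ k * b ^ (m - k)) \<in> J"
  shows "\<exists>h. b ^ m * a ^ k - b ^ k * h \<in> J"
proof (induction k rule: less_induct)
  case (less k)
  show ?case
  proof (cases "k < m")
    case True
    then have "b ^ m * a ^ k - b ^ k * (b ^ (m - k) * a ^ k) = 0"
      by (simp add: mult.assoc[symmetric] flip: power_add)
    then show ?thesis using ideal_zero[OF J] by metis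
  next
    case False
    have "\<forall>l<m. \<exists>h. b ^ m * a ^ (k - m + l) - b ^ (k - m + l) * h \<in> J"
      using False by (auto intro!: less)
    then obtain H where H: "\<And>l. l < m \<Longrightarrow> b ^ m * a ^ (k - m + l) - b ^ (k - m + l) * H l \<in> J" by metis
    \<comment> \<open>The equation is multiplied by \<open>b ^ m * a ^ (k - m)\<close>, and its
      lower terms are replaced by means of the induction hypothesis.\<close>
    have "b ^ m * a ^ (k - m) * (a ^ m + (\<Sum>l<m. c l * a ^ l * b ^ (m - l))) -
        (\<Sum>l<m. c l * b ^ (m - l) * (b ^ m * a ^ (k - m + l) - b ^ (k - m + l) * H l)) \<in> J"
      by (intro ideal_diff[OF J] ideal_sum[OF J] ideal_mult_left[OF J] int H) auto
    also have "b ^ m * a ^ (k - m) * (a ^ m + (\<Sum>l<m. c l * a ^ l * b ^ (m - l))) -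
        (\<Sum>l<m. c l * b ^ (m - l) * (b ^ m * a ^ (k - m + l) - b ^ (k - m + l) * H l)) =
        b ^ m * (a ^ (k - m) * a ^ m) + (\<Sum>l<m. c l * H l * (b ^ (m - l) * b ^ (k - m + l)))"
      by (simp add: algebra_simps sum_subtractf sum_distrib_left power_add)
    also have "(\<Sum>l<m. c l * H l * (b ^ (m - l) * b ^ (k - m + l))) = (\<Sum>l<m. c l * H l * b ^ k)"
      using False by (intro sum.cong refl) (simp flip: power_add)
    also have "b ^ m * (a ^ (k - m) * a ^ m) + (\<Sum>l<m. c l * H l * b ^ k) = b ^ m * a ^ k - b ^ k * - (\<Sum>l<m. c l * H l)"
      using False by (simp add: sum_distrib_left sum_distrib_right algebra_simps flip: power_add)
    finally show ?thesis by blast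
  qed
qed

text \<open>By the binomial theorem, subtracting a ring element from the fraction preserves the
  common denominator \<open>c\<close>. This lets subduction be repeated.\<close>

lemma almost_integral_shift:
  assumes J: "is_ideal J" and ai: "\<And>k. \<exists>h. c * a ^ k - b ^ k * h \<in> J"
  shows "\<exists>h. c * (a - b * s) ^ k - b ^ k * h \<in> J"
proof -
  obtain H where H: "\<And>k. c * a ^ k - b ^ k * H k \<in> J" using ai by metis
  let ?B = "\<lambda>l. of_nat (k choose l)"
  have "(\<Sum>l\<le>k. (c * a ^ l - b ^ l * H l) * (?B l * (- (b * s)) ^ (k - l))) \<in> J"
    by (intro ideal_sum[OF J] ideal_mult_right[OF J] H)
  moreover have "(\<Sum>l\<le>k. (c * a ^ l - b ^ l * H l) * (?B l * (- (b * s)) ^ (k - l))) =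
      c * (\<Sum>l\<le>k. ?B l * a ^ l * (- (b * s)) ^ (k - l)) - (\<Sum>l\<le>k. b ^ l * H l * (?B l * (- (b * s)) ^ (k - l)))"
    by (simp add: left_diff_distrib sum_subtractf sum_distrib_left algebra_simps)
  moreover have "(\<Sum>l\<le>k. ?B l * a ^ l * (- (b * s)) ^ (k - l)) = (a - b * s) ^ k"
    using binomial_ring[of a "- (b * s)" k] by simp
  moreover have "(\<Sum>l\<le>k. b ^ l * H l * (?B l * (- (b * s)) ^ (k - l))) = b ^ k * (\<Sum>l\<le>k. H l * ?B l * (- s) ^ (k - l))"
    unfolding sum_distrib_left
  proof (intro sum.cong refl)
    fix l assume "l \<in> {..k}"
    then have "b ^ k = b ^ l * b ^ (k - l)" by (simp flip: power_add)
    moreover have "(- (b * s)) ^ (k - l) = b ^ (k - l) * (- s) ^ (k - l)"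
      by (simp flip: power_mult_distrib)
    ultimately show "b ^ l * H l * (?B l * (- (b * s)) ^ (k - l)) = b ^ k * (H l * ?B l * (- s) ^ (k - l))"
      by (simp add: algebra_simps)
  qed
  ultimately show ?thesis by auto
qed

context pivot_rows
begin

lemma mexp_add: "mexp (m + m') = mexp m + mexp m'"
  by (rule poly_mapping_eqI)
     (simp add: mexp_def lookup_sum lookup_add sum.distrib algebra_simps)

lemma vexp_pair:
  assumes "i \<notin> Z"
  shows "vexp (Inl i) + vexp (Inr i) = hexp + hexp + wexp (jlead i)"
  using assms by (simp add: vexp_def)

text \<open>The degree follows from the other coordinates: with equal torus coordinates the
  exponents differ by a combination of the sums \<open>vexp (Inl i) + vexp (Inr i)\<close>, each of
  which contributes degree two and one free product.\<close>

lemma mexp_eqI: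
  assumes "Z = {}" and x: "\<And>i::'n. Poly_Mapping.lookup (mexp m) (xidx i) = Poly_Mapping.lookup (mexp m') (xidx i)"
    and w: "\<And>j. j \<in> - P \<Longrightarrow> Poly_Mapping.lookup (mexp m) (widx j) = Poly_Mapping.lookup (mexp m') (widx j)"
  shows "mexp m = mexp m'"
proof (rule poly_mapping_eqI)
  fix k
  let ?\<delta> = "\<lambda>i::'n. int (Poly_Mapping.lookup m (Inr i)) - int (Poly_Mapping.lookup m' (Inr i))"
  let ?L = "\<lambda>j. Poly_Mapping.lookup (hexp + hexp + wexp j) k"
  have \<delta>: "int (Poly_Mapping.lookup m (Inl i)) - int (Poly_Mapping.lookup m' (Inl i)) = ?\<delta> i" for i
    using x[of i] by (simp add: lookup_mexp_x)
  have "Poly_Mapping.lookup (mexp m) k - Poly_Mapping.lookup (mexp m') k =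
      (\<Sum>i\<in>UNIV. (int (Poly_Mapping.lookup m (Inl i)) - int (Poly_Mapping.lookup m' (Inl i))) * Poly_Mapping.lookup (vexp (Inl i)) k
        + ?\<delta> i * Poly_Mapping.lookup (vexp (Inr i)) k)"
    unfolding mexp_def sum_UNIV_Plus lookup_add lookup_sum lookup_frag_cmul
    by (simp add: sum.distrib sum_subtractf algebra_simps)
  also have "\<dots> = (\<Sum>i\<in>UNIV. ?\<delta> i * ?L (jlead i))"
  proof (intro sum.cong refl)
    fix i
    have "?L (jlead i) = Poly_Mapping.lookup (vexp (Inl i)) k + Poly_Mapping.lookup (vexp (Inr i)) k"
      using vexp_pair[of i] assms(1) by (simp flip: lookup_add)
    then show "(int (Poly_Mapping.lookup m (Inl i)) - int (Poly_Mapping.lookup m' (Inl i))) * Poly_Mapping.lookup (vexp (Inl i)) k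
        + ?\<delta> i * Poly_Mapping.lookup (vexp (Inr i)) k = ?\<delta> i * ?L (jlead i)"
      unfolding \<delta> by (simp add: algebra_simps)
  qed
  also have "\<dots> = (\<Sum>j\<in>- P. \<Sum>i\<in>{i \<in> UNIV. jlead i = j}. ?\<delta> i * ?L (jlead i))"
    by (rule sum.group[symmetric]) (use jlead(1) assms(1) in auto)
  also have "\<dots> = (\<Sum>j\<in>- P. (\<Sum>i\<in>{i. jlead i = j}. ?\<delta> i) * ?L j)"
    by (simp add: sum_distrib_right)
  also have "\<dots> = 0"
  proof (rule sum.neutral, rule ballI)
    fix j assume "j \<in> - P"
    then have "(\<Sum>i\<in>{i. jlead i = j}. ?\<delta> i) = 0"
      using w[of j] assms(1) by (simp add: lookup_mexp_widx sum_subtractf)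
    then show "(\<Sum>i\<in>{i. jlead i = j}. ?\<delta> i) * ?L j = 0" by simp
  qed
  finally show "Poly_Mapping.lookup (mexp m) k = Poly_Mapping.lookup (mexp m') k" by simp
qed

text \<open>The leading exponents form a saturated semigroup: it is cut out by the inequalities
  \<open>w j \<ge> (\<Sum>i | jlead i = j. max 0 (- x i))\<close>, whose right-hand sides are convex and homogeneous.\<close>

lemma mexp_saturated:
  assumes "Z = {}" and sat: "\<And>k::nat. \<exists>m. mexp m = c + frag_cmul (int k) (mexp a - mexp b)"
  shows "\<exists>m. std m \<and> mexp m = mexp a - mexp b"
proof -
  let ?e = "mexp a - mexp b"
  define d where "d i = Poly_Mapping.lookup ?e (xidx i)" for i :: 'n
  define neg where "neg i = (if d i < 0 then - d i else 0)" for i :: 'n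
  have ineq: "(\<Sum>i\<in>{i. jlead i = j}. neg i) \<le> Poly_Mapping.lookup ?e (widx j)" for j
  proof (rule ccontr)
    assume less: "\<not> ?thesis"
    \<comment> \<open>A violated inequality fails by at least one, so at the \<open>k\<close>-th
      multiple the defect is at least \<open>k\<close>, whereas \<open>c\<close> compensates only a
      fixed amount.\<close>
    define B where "B = (\<Sum>i\<in>{i. jlead i = j}. \<bar>Poly_Mapping.lookup c (xidx i)\<bar>)"
    have bound: "int k \<le> Poly_Mapping.lookup c (widx j) + B" for k
    proof -
      obtain m where m: "mexp m = c + frag_cmul (int k) ?e" using sat by blast
      have "int k * neg i - \<bar>Poly_Mapping.lookup c (xidx i)\<bar> \<le> int (Poly_Mapping.lookup m (Inr i))" for i
      proof -
        have "int (Poly_Mapping.lookup m (Inl i)) - int (Poly_Mapping.lookup m (Inr i)) = Poly_Mapping.lookup c (xidx i) + int k * d i"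
          using lookup_mexp_x[of m i] by (simp add: m lookup_add d_def)
        then show ?thesis by (auto simp: neg_def)
      qed
      then have "(\<Sum>i\<in>{i. jlead i = j}. int k * neg i - \<bar>Poly_Mapping.lookup c (xidx i)\<bar>) \<le>
          (\<Sum>i\<in>{i. jlead i = j}. int (Poly_Mapping.lookup m (Inr i)))"
        by (intro sum_mono)
      also have "\<dots> = Poly_Mapping.lookup c (widx j) + int k * Poly_Mapping.lookup ?e (widx j)"
        using lookup_mexp_widx[of m j] assms(1) by (simp add: m lookup_add)
      finally have "int k * (\<Sum>i\<in>{i. jlead i = j}. neg i) - B \<le> Poly_Mapping.lookup c (widx j) + int k * Poly_Mapping.lookup ?e (widx j)"
        by (simp add: sum_subtractf sum_distrib_left B_def)
      moreover have "int k * (Poly_Mapping.lookup ?e (widx j) + 1) \<le> int k * (\<Sum>i\<in>{i. jlead i = j}. neg i)"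
        using less by (intro mult_left_mono) auto
      ultimately show ?thesis by (simp add: algebra_simps)
    qed
    from bound[of 0] bound[of "nat (Poly_Mapping.lookup c (widx j) + B + 1)"] show False by (simp split: if_splits)
  qed
  \<comment> \<open>Pivots get the smallest admissible exponent, which makes the monomial standard;
    a free index takes what the pivots assigned to it leave over.\<close>
  define \<beta> where "\<beta> i = (if i \<in> P then nat (neg i)
    else nat (Poly_Mapping.lookup ?e (widx i) - (\<Sum>k\<in>{k\<in>P - Z. jlead k = i}. neg k)))" for i
  define m where "m = Abs_poly_mapping (case_sum (\<lambda>i. nat (d i + int (\<beta> i))) \<beta>)"
  have m: "Poly_Mapping.lookup m (Inl i) = nat (d i + int (\<beta> i))" "Poly_Mapping.lookup m (Inr i) = \<beta> i" for i
    by (simp_all add: m_def)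
  have group: "{k. jlead k = j} = insert j {k\<in>P - Z. jlead k = j}" if "j \<in> - P" for j
  proof -
    have "jlead k = j \<longleftrightarrow> k = j \<or> k \<in> P - Z \<and> jlead k = j" for k
      using that assms(1) jlead_free[of k] by (cases "k \<in> P") auto
    then show ?thesis by blast
  qed
  have \<beta>_free: "int (\<beta> j) = Poly_Mapping.lookup ?e (widx j) - (\<Sum>k\<in>{k\<in>P - Z. jlead k = j}. neg k)"
    "neg j \<le> int (\<beta> j)" if "j \<in> - P" for j
  proof -
    have "neg j + (\<Sum>k\<in>{k\<in>P - Z. jlead k = j}. neg k) \<le> Poly_Mapping.lookup ?e (widx j)"
      using ineq[of j] that by (simp add: group)
    moreover have "0 \<le> neg j" by (simp add: neg_def)
    ultimately show "int (\<beta> j) = Poly_Mapping.lookup ?e (widx j) - (\<Sum>k\<in>{k\<in>P - Z. jlead k = j}. neg k)" "neg j \<le> int (\<beta> j)"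
      using that by (auto simp: \<beta>_def)
  qed
  have "neg i \<le> int (\<beta> i)" for i
    using \<beta>_free(2)[of i] by (cases "i \<in> P") (auto simp: \<beta>_def)
  moreover have "0 \<le> d i + neg i" for i by (simp add: neg_def)
  ultimately have pos: "0 \<le> d i + int (\<beta> i)" for i by (metis add_left_mono order_trans)
  have "std m"
    by (auto simp: std_def m \<beta>_def neg_def)
  moreover have "mexp (m + b) = mexp a"
  proof (rule mexp_eqI[OF assms(1)])
    show "Poly_Mapping.lookup (mexp (m + b)) (xidx i) = Poly_Mapping.lookup (mexp a) (xidx i)" for i :: 'n
      using pos[of i] by (simp add: mexp_add lookup_add lookup_mexp_x[of m] m d_def lookup_minus)
    fix j assume j: "j \<in> - P"
    have "Poly_Mapping.lookup (mexp m) (widx j) = int (\<beta> j) + (\<Sum>k\<in>{k\<in>P - Z. jlead k = j}. int (\<beta> k))"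
      using j by (simp add: lookup_mexp_w m)
    also have "(\<Sum>k\<in>{k\<in>P - Z. jlead k = j}. int (\<beta> k)) = (\<Sum>k\<in>{k\<in>P - Z. jlead k = j}. neg k)"
      by (intro sum.cong) (auto simp: \<beta>_def neg_def)
    finally show "Poly_Mapping.lookup (mexp (m + b)) (widx j) = Poly_Mapping.lookup (mexp a) (widx j)"
      using \<beta>_free(1)[OF j] by (simp add: mexp_add lookup_add lookup_minus)
  qed
  then have "mexp m = mexp a - mexp b" by (simp add: mexp_add algebra_simps)
  ultimately show ?thesis by blast
qed

lemma lead_emb:
  fixes f :: "('n + 'n, 'a::field_char_0) mpoly"
  assumes "Z = {}" "f \<notin> mu_ideal r S"
  shows "\<exists>m. std m \<and> lead (emb {} f) (mexp m)"
proof -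
  obtain g where g: "f - g \<in> mu_ideal r S" "\<forall>l\<in>Poly_Mapping.keys g. std l"
    by (rule normal_form'[of f])
  have "emb {} g \<noteq> 0" using assms mu_ideal_iff_emb_empty[OF assms(1), of f] emb_cong[OF g(1)] by metis
  then have "g \<noteq> 0" by (auto simp: emb_simps)
  then obtain m where "m \<in> Poly_Mapping.keys g" by (metis all_not_in_conv in_keys_iff lookup_zero poly_mapping_eqI)
  moreover have "\<not> killed {} v" for v using assms(1) by (cases v) (auto simp: killed_def)
  ultimately have "\<exists>m\<in>Poly_Mapping.keys g. lead (emb {} g) (mexp m)" using g(2) by (intro lead_emb_std) auto
  then show ?thesis using emb_cong[OF g(1)] g(2) by metis
qed

lemma emb_single_scale:
  "emb E (Poly_Mapping.single m (\<gamma> :: 'a::field_char_0)) = Poly_Mapping.single 0 \<gamma> * emb E (Poly_Mapping.single m 1)"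
  by (simp add: emb_simps)

text \<open>Subduction: saturation supplies a monomial whose exponent is the difference of those of
  \<open>a\<close> and \<open>b\<close>, and subtracting a multiple of \<open>b\<close> by it lowers
  the leading exponent of \<open>a\<close>. Only finitely many standard monomials lie below, so the
  process stops.\<close>

lemma almost_integral_mem:
  fixes a b c :: "('n + 'n, 'a::field_char_0) mpoly"
  assumes Z: "Z = {}" and b: "b \<notin> mu_ideal r S" and c: "c \<notin> mu_ideal r S"
    and ai: "\<And>k. \<exists>h. c * a ^ k - b ^ k * h \<in> mu_ideal r S"
  shows "\<exists>h. a - b * h \<in> mu_ideal r S"
proof (cases "a \<in> mu_ideal r S")
  case True
  then have "a - b * 0 \<in> mu_ideal r S" by simp
  then show ?thesis ..
next
  case False
  then obtain ma where ma: "lead (emb {} a) (mexp ma)" using lead_emb[OF Z] by blast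
  from ai ma show ?thesis
  proof (induction "card {m. std m \<and> mexp m < mexp ma}" arbitrary: a ma rule: less_induct)
    case less
    note ai = less.prems(1) and ma = less.prems(2)
    obtain mb where mb: "lead (emb {} b) (mexp mb)" using lead_emb[OF Z b] by blast
    obtain mc where mc: "lead (emb {} c) (mexp mc)" using lead_emb[OF Z c] by blast
    \<comment> \<open>Comparing leading exponents in \<open>c * a ^ k = b ^ k * h\<close> shows that
      every multiple of the difference, shifted by \<open>mexp mc\<close>, lies in the
      semigroup.\<close>
    have "\<exists>m. mexp m = mexp mc + frag_cmul (int k) (mexp ma - mexp mb)" for k
    proof -
      obtain h where h: "c * a ^ k - b ^ k * h \<in> mu_ideal r S" using ai by blast
      have eq: "emb {} c * emb {} a ^ k = emb {} b ^ k * emb {} h"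
        using emb_cong[OF h, of "{}"] by (simp add: emb_simps)
      have l: "lead (emb {} c * emb {} a ^ k) (mexp mc + frag_cmul (int k) (mexp ma))"
        by (intro lead_mult lead_power ma mc)
      then have "emb {} h \<noteq> 0" using eq lead_nonzero by fastforce
      then have "h \<notin> mu_ideal r S" using mu_ideal_iff_emb_empty[OF Z] by blast
      then obtain m where m: "lead (emb {} h) (mexp m)" using lead_emb[OF Z] by blast
      have "lead (emb {} b ^ k * emb {} h) (frag_cmul (int k) (mexp mb) + mexp m)"
        by (intro lead_mult lead_power mb m)
      with l eq have "mexp mc + frag_cmul (int k) (mexp ma) = frag_cmul (int k) (mexp mb) + mexp m"
        by (metis lead_unique)
      then have "mexp m = mexp mc + frag_cmul (int k) (mexp ma - mexp mb)"
        by (simp add: frag_cmul_diff algebra_simps)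
      then show ?thesis by blast
    qed
    from mexp_saturated[OF Z this] obtain m where m: "std m" "mexp m = mexp ma - mexp mb" by blast
    have lm: "lead (emb {} (Poly_Mapping.single m (1::'a))) (mexp m)"
      by (rule lead_emb_monomial) (auto simp: killed_def Z split: sum.splits)
    \<comment> \<open>Chosen so that \<open>b * s\<close> and \<open>a\<close> have the same leading
      coefficient after embedding.\<close>
    define \<gamma> where "\<gamma> = Poly_Mapping.lookup (emb {} a) (mexp ma) /
      (Poly_Mapping.lookup (emb {} b) (mexp mb) * Poly_Mapping.lookup (emb {} (Poly_Mapping.single m (1::'a))) (mexp m))"
    have nz: "Poly_Mapping.lookup (emb {} a) (mexp ma) \<noteq> 0" "Poly_Mapping.lookup (emb {} b) (mexp mb) \<noteq> 0"
      "Poly_Mapping.lookup (emb {} (Poly_Mapping.single m (1::'a))) (mexp m) \<noteq> 0"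
      using ma mb lm by (auto simp: lead_def in_keys_iff)
    then have "\<gamma> \<noteq> 0" by (simp add: \<gamma>_def)
    then have l\<gamma>: "lead (Poly_Mapping.single 0 \<gamma>) (0 :: expo)" by (rule lead_single)
    define s where "s = (Poly_Mapping.single m \<gamma> :: ('n + 'n, 'a) mpoly)"
    have s: "lead (emb {} s) (mexp m)"
      "Poly_Mapping.lookup (emb {} s) (mexp m) = \<gamma> * Poly_Mapping.lookup (emb {} (Poly_Mapping.single m (1::'a))) (mexp m)"
      unfolding s_def emb_single_scale[of _ _ \<gamma>]
      using lead_mult[OF l\<gamma> lm] lookup_lead_mult[OF l\<gamma> lm] by auto
    have mbm: "mexp mb + mexp m = mexp ma" by (simp add: m)
    have bs: "lead (emb {} (b * s)) (mexp ma)"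
      "Poly_Mapping.lookup (emb {} (b * s)) (mexp ma) = Poly_Mapping.lookup (emb {} a) (mexp ma)"
      using lead_mult[OF mb s(1)] lookup_lead_mult[OF mb s(1)] nz
      by (auto simp: mbm emb_simps s(2) \<gamma>_def)
    let ?a = "a - b * s"
    have ai': "\<exists>h. c * ?a ^ k - b ^ k * h \<in> mu_ideal r S" for k
      by (rule almost_integral_shift[OF is_ideal_mu_ideal ai])
    have "\<exists>h. ?a - b * h \<in> mu_ideal r S"
    proof (cases "?a \<in> mu_ideal r S")
      case True
      then have "?a - b * 0 \<in> mu_ideal r S" by simp
      then show ?thesis ..
    next
      case False
      then obtain ma' where ma': "std ma'" "lead (emb {} ?a) (mexp ma')" using lead_emb[OF Z] by blast
      have k: "mexp ma' \<in> Poly_Mapping.keys (emb {} a - emb {} (b * s))"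
        using ma'(2) by (simp add: lead_def emb_simps)
      then have "mexp ma' \<in> Poly_Mapping.keys (emb {} a) \<union> Poly_Mapping.keys (emb {} (b * s))"
        by (auto simp: in_keys_iff lookup_minus)
      then have "mexp ma' \<le> mexp ma" using ma bs(1) by (auto simp: lead_def)
      moreover have "mexp ma' \<noteq> mexp ma" using k bs(2) by (auto simp: in_keys_iff lookup_minus)
      ultimately have less_ma: "mexp ma' < mexp ma" by simp
      have "{m. std m \<and> mexp m < mexp ma'} \<subset> {m. std m \<and> mexp m < mexp ma}"
        using less_ma ma'(1) by auto
      moreover have "{m. std m \<and> mexp m < mexp ma} \<subseteq> {m. mdeg m \<le> mdeg ma}"
        using expo_less_lookup_0 by (force simp: lookup_mexp_degree)
      then have "finite {m. std m \<and> mexp m < mexp ma}" using finite_mdeg_le by (rule finite_subset)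
      ultimately have "card {m. std m \<and> mexp m < mexp ma'} < card {m. std m \<and> mexp m < mexp ma}"
        by (intro psubset_card_mono)
      from less.hyps[OF this ai' ma'(2)] show ?thesis .
    qed
    then obtain h where "a - b * s - b * h \<in> mu_ideal r S" by blast
    then have "a - b * (s + h) \<in> mu_ideal r S" by (simp add: algebra_simps)
    then show ?case ..
  qed
qed

lemma normal_mu_ideal:
  assumes Z: "Z = {}"
  shows "normal_quot (mu_ideal r S :: ('n + 'n, 'a::field_char_0) mpoly set)"
  unfolding normal_quot_def
proof (intro allI impI, elim conjE)
  let ?J = "mu_ideal r S :: ('n + 'n, 'a) mpoly set"
  fix Q :: "('n + 'n, 'a) mpoly set"
  assume Q: "prime_ideal Q" "?J \<subseteq> Q"
  have J: "prime_ideal ?J" by (rule prime_mu_ideal[OF Z])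
  have "1 \<notin> Q" using Q by (simp add: prime_ideal_def)
  \<comment> \<open>The ideal is prime and contained in \<open>Q\<close>, so localising kills no
    further elements.\<close>
  have lz: "loc_zero ?J Q a \<longleftrightarrow> a \<in> ?J" for a
  proof
    assume "loc_zero ?J Q a"
    then obtain t where "t \<notin> Q" "t * a \<in> ?J" by (auto simp: loc_zero_def)
    then show "a \<in> ?J" using prime_ideal_mult[OF J] Q(2) by blast
  next
    assume "a \<in> ?J"
    then have "1 \<notin> Q \<and> 1 * a \<in> ?J" using \<open>1 \<notin> Q\<close> by simp
    then show "loc_zero ?J Q a" unfolding loc_zero_def by blast
  qed
  show "normal_local ?J Q"
    unfolding normal_local_def lz
  proof (intro conjI allI impI)
    show "1 \<notin> ?J" using J by (simp add: prime_ideal_def)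
    show "a \<in> ?J \<or> b \<in> ?J" if "a * b \<in> ?J" for a b using prime_ideal_mult[OF J that] .
    fix a b
    assume b: "b \<notin> ?J" and "\<exists>m>0. \<exists>c u. u \<notin> Q \<and> u * a ^ m + (\<Sum>k<m. c k * a ^ k * b ^ (m - k)) \<in> ?J"
    then obtain m c u where m: "m > 0" and u: "u \<notin> Q" and int: "u * a ^ m + (\<Sum>k<m. c k * a ^ k * b ^ (m - k)) \<in> ?J"
      by blast
    \<comment> \<open>Multiplication by \<open>u ^ (m - 1)\<close> turns the equation with leading
      coefficient \<open>u\<close> into a monic one for \<open>u * a\<close>. Since \<open>u\<close>
      is a unit in the local ring, it can serve as the denominator \<open>v\<close> at the
      end.\<close>
    have "(u * a) ^ m + (\<Sum>k<m. (c k * u ^ (m - 1 - k)) * (u * a) ^ k * b ^ (m - k)) =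
        u ^ (m - 1) * (u * a ^ m + (\<Sum>k<m. c k * a ^ k * b ^ (m - k)))"
    proof -
      have "(u * a) ^ m = u ^ (m - 1) * (u * a ^ m)"
        using m by (simp add: power_mult_distrib mult.assoc[symmetric] flip: power_Suc2)
      moreover have "(\<Sum>k<m. (c k * u ^ (m - 1 - k)) * (u * a) ^ k * b ^ (m - k)) = u ^ (m - 1) * (\<Sum>k<m. c k * a ^ k * b ^ (m - k))"
        unfolding sum_distrib_left
      proof (intro sum.cong refl)
        fix k assume "k \<in> {..<m}"
        then have "u ^ (m - 1) = u ^ (m - 1 - k) * u ^ k" by (simp flip: power_add)
        then show "(c k * u ^ (m - 1 - k)) * (u * a) ^ k * b ^ (m - k) = u ^ (m - 1) * (c k * a ^ k * b ^ (m - k))"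
          by (simp add: power_mult_distrib algebra_simps)
      qed
      ultimately show ?thesis by (simp add: distrib_left)
    qed
    then have "(u * a) ^ m + (\<Sum>k<m. (c k * u ^ (m - 1 - k)) * (u * a) ^ k * b ^ (m - k)) \<in> ?J"
      using ideal_mult_left[OF is_ideal_mu_ideal int] by simp
    from integral_almost_integral[OF is_ideal_mu_ideal this]
    have "\<exists>h. b ^ m * (u * a) ^ k - b ^ k * h \<in> ?J" for k .
    moreover have "b ^ m \<notin> ?J"
      using prime_ideal_power[OF J, of b m 1] b J by (auto simp: prime_ideal_def)
    ultimately obtain h where "u * a - b * h \<in> ?J" using almost_integral_mem[OF Z b] by blast
    with u have "u \<notin> Q \<and> a * u - b * h \<in> ?J" by (simp add: mult.commute)
    then show "\<exists>c v. v \<notin> Q \<and> a * v - b * c \<in> ?J" by blast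
  qed
qed

end

subsection \<open>Dimension\<close>

definition mprod :: "'a::comm_ring_1 list \<Rightarrow> nat list \<Rightarrow> 'a" where
  "mprod ys bs = prod_list (map2 (^) ys bs)"

lemma mprod_simps: "mprod [] [] = 1" "mprod (y # ys) (b # bs) = y ^ b * mprod ys bs"
  by (simp_all add: mprod_def)

text \<open>Comparing the lexicographically smallest monomials shows that elements witnessing the strict
  inclusions of a chain of primes are algebraically independent modulo its first member.\<close>

lemma prime_chain_independent:
  fixes Q :: "nat \<Rightarrow> 'r::comm_ring_1 set"
  assumes "\<And>k. k \<le> length ys \<Longrightarrow> prime_ideal (Q k)"
    and "\<And>k. k < length ys \<Longrightarrow> Q k \<subseteq> Q (Suc k) \<and> ys ! k \<in> Q (Suc k) \<and> ys ! k \<notin> Q k"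
    and "finite B" "\<And>b. b \<in> B \<Longrightarrow> length b = length ys" "\<And>b. b \<in> B \<Longrightarrow> c b \<notin> Q (length ys)"
    and "(\<Sum>b\<in>B. c b * mprod ys b) \<in> Q 0"
  shows "B = {}"
  using assms
proof (induction ys arbitrary: Q B c)
  case Nil
  show ?case
  proof (rule ccontr)
    assume "B \<noteq> {}"
    with Nil.prems(4) have "B = {[]}" by auto
    with Nil.prems(5,6) show False by (simp add: mprod_simps)
  qed
next
  case (Cons y ys)
  show ?case
  proof (rule ccontr)
    assume "B \<noteq> {}"
    \<comment> \<open>The factor \<open>y ^ m0\<close> can be cancelled modulo \<open>Q 0\<close>,
      which does not contain \<open>y\<close>; as \<open>y\<close> lies in \<open>Q 1\<close>, only
      terms with first exponent exactly \<open>m0\<close> then survive modulo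
      \<open>Q 1\<close>.\<close>
    define m0 where "m0 = Min (hd ` B)"
    have m0: "m0 \<le> hd b" if "b \<in> B" for b using that Cons.prems(3) by (simp add: m0_def)
    have "m0 \<in> hd ` B" unfolding m0_def using \<open>B \<noteq> {}\<close> Cons.prems(3) by (intro Min_in) auto
    then obtain b0 where b0: "b0 \<in> B" "hd b0 = m0" by auto
    have Q: "prime_ideal (Q 0)" "prime_ideal (Q 1)" "Q 0 \<subseteq> Q 1" "y \<in> Q 1" "y \<notin> Q 0"
      using Cons.prems(1)[of 0] Cons.prems(1)[of 1] Cons.prems(2)[of 0] by auto
    note Q1 = prime_ideal_D[OF Q(2)]
    let ?f = "\<lambda>b. c b * y ^ (hd b - m0) * mprod ys (tl b)"
    have Bcons: "mprod (y # ys) b = y ^ hd b * mprod ys (tl b)" if "b \<in> B" for b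
      using Cons.prems(4)[OF that] by (cases b) (auto simp: mprod_simps)
    have eq: "(\<Sum>b\<in>B. c b * mprod (y # ys) b) = y ^ m0 * (\<Sum>b\<in>B. ?f b)"
      unfolding sum_distrib_left
    proof (intro sum.cong refl)
      fix b assume b: "b \<in> B"
      have "y ^ hd b = y ^ m0 * y ^ (hd b - m0)" using m0[OF b] by (simp flip: power_add)
      then show "c b * mprod (y # ys) b = y ^ m0 * ?f b" by (simp add: Bcons[OF b] mult.assoc mult.left_commute)
    qed
    have "y ^ m0 * (\<Sum>b\<in>B. ?f b) \<in> Q 0" using Cons.prems(6) unfolding eq .
    from prime_ideal_power[OF Q(1) this Q(5)] Q(3) have "(\<Sum>b\<in>B. ?f b) \<in> Q 1" by (rule rev_subsetD)
    moreover have "(\<Sum>b\<in>B - {b \<in> B. hd b = m0}. ?f b) \<in> Q 1"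
    proof (rule ideal_sum[OF Q1])
      fix b assume "b \<in> B - {b \<in> B. hd b = m0}"
      then have "hd b - m0 \<noteq> 0" using m0[of b] by auto
      then obtain n where "hd b - m0 = Suc n" by (cases "hd b - m0") auto
      then have "?f b = (c b * y ^ n * mprod ys (tl b)) * y" by (simp add: algebra_simps)
      then show "?f b \<in> Q 1" using ideal_mult_left[OF Q1 Q(4)] by simp
    qed
    moreover have "(\<Sum>b\<in>B. ?f b) = (\<Sum>b\<in>B - {b \<in> B. hd b = m0}. ?f b) + (\<Sum>b\<in>{b \<in> B. hd b = m0}. ?f b)"
      by (rule sum.subset_diff) (use Cons.prems(3) in auto)
    ultimately have "(\<Sum>b\<in>{b \<in> B. hd b = m0}. ?f b) \<in> Q 1"
      using ideal_diff[OF Q1, of "\<Sum>b\<in>B. ?f b" "\<Sum>b\<in>B - {b \<in> B. hd b = m0}. ?f b"] by simp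
    moreover have ne: "b \<noteq> []" if "b \<in> B" for b using Cons.prems(4)[OF that] by auto
    moreover have "(\<Sum>b\<in>tl ` {b \<in> B. hd b = m0}. c (m0 # b) * mprod ys b) = (\<Sum>b\<in>{b \<in> B. hd b = m0}. ?f b)"
    proof (subst sum.reindex)
      show "inj_on tl {b \<in> B. hd b = m0}"
        using ne by (auto simp: inj_on_def) (metis list.collapse)
      show "sum ((\<lambda>b. c (m0 # b) * mprod ys b) \<circ> tl) {b \<in> B. hd b = m0} = (\<Sum>b\<in>{b \<in> B. hd b = m0}. ?f b)"
        by (intro sum.cong) (use ne in auto)
    qed
    ultimately have sum: "(\<Sum>b\<in>tl ` {b \<in> B. hd b = m0}. c (m0 # b) * mprod ys b) \<in> Q (Suc 0)" by simp
    have "tl ` {b \<in> B. hd b = m0} = {}"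
    proof (rule Cons.IH[of "\<lambda>k. Q (Suc k)" _ "\<lambda>b. c (m0 # b)"])
      show "\<And>k. k \<le> length ys \<Longrightarrow> prime_ideal (Q (Suc k))" using Cons.prems(1) by simp
      show "\<And>k. k < length ys \<Longrightarrow> Q (Suc k) \<subseteq> Q (Suc (Suc k)) \<and> ys ! k \<in> Q (Suc (Suc k)) \<and> ys ! k \<notin> Q (Suc k)"
        using Cons.prems(2)[of "Suc k" for k] by simp
      show "finite (tl ` {b \<in> B. hd b = m0})" using Cons.prems(3) by simp
      show "\<And>b. b \<in> tl ` {b \<in> B. hd b = m0} \<Longrightarrow> length b = length ys" using Cons.prems(4) by auto
      show "c (m0 # b) \<notin> Q (Suc (length ys))" if "b \<in> tl ` {b \<in> B. hd b = m0}" for b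
      proof -
        from that obtain a where a: "a \<in> B" "hd a = m0" "b = tl a" by auto
        then have "m0 # b = a" using ne[OF a(1)] by (cases a) auto
        with Cons.prems(5)[OF a(1)] show ?thesis by simp
      qed
    qed (rule sum)
    with b0 show False by auto
  qed
qed

section \<open>Upper bound for the dimension\<close>

lemma lookup_const_mult: "Poly_Mapping.lookup (Poly_Mapping.single 0 c * p) k = c * Poly_Mapping.lookup p k"
  by (simp add: map.rep_eq when_def flip: mult_map_scale_conv_mult)

definition deg_le :: "('v::finite, 'a::zero) mpoly \<Rightarrow> nat \<Rightarrow> bool" where
  "deg_le p N \<longleftrightarrow> (\<forall>m\<in>Poly_Mapping.keys p. mdeg m \<le> N)"

lemma deg_le_mult: "deg_le p M \<Longrightarrow> deg_le q N \<Longrightarrow> deg_le (p * q :: ('v::finite, 'a::comm_ring_1) mpoly) (M + N)"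
  unfolding deg_le_def
proof
  fix m assume pq: "\<forall>m\<in>Poly_Mapping.keys p. mdeg m \<le> M" "\<forall>m\<in>Poly_Mapping.keys q. mdeg m \<le> N"
    and "m \<in> Poly_Mapping.keys (p * q)"
  then obtain a b where "a \<in> Poly_Mapping.keys p" "b \<in> Poly_Mapping.keys q" "m = a + b"
    using keys_mult[of p q] by blast
  with pq show "mdeg m \<le> M + N" by (simp add: mdeg_add add_mono)
qed

lemma deg_le_1: "deg_le (1 :: ('v::finite, 'a::comm_ring_1) mpoly) N"
  by (simp add: deg_le_def mdeg_def)

lemma deg_le_power: "deg_le p e \<Longrightarrow> deg_le (p ^ k :: ('v::finite, 'a::comm_ring_1) mpoly) (k * e)"
  by (induction k) (auto simp: deg_le_1 deg_le_mult)

lemma deg_le_mono: "deg_le p M \<Longrightarrow> M \<le> N \<Longrightarrow> deg_le p N"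
  unfolding deg_le_def by force

lemma deg_le_mprod:
  fixes ys :: "('v::finite, 'a::comm_ring_1) mpoly list"
  assumes "length b = length ys" "\<forall>y\<in>set ys. deg_le y e" "set b \<subseteq> {..N}"
  shows "deg_le (mprod ys b) (length ys * (N * e))"
  using assms
proof (induction b ys rule: list_induct2)
  case Nil
  then show ?case by (simp add: mprod_simps deg_le_1)
next
  case (Cons k b y ys)
  have "deg_le (y ^ k) (N * e)"
    by (rule deg_le_mono[OF deg_le_power[of y e]]) (use Cons.prems in auto)
  with Cons show ?case by (simp add: mprod_simps deg_le_mult)
qed

context pivot_rows
begin

text \<open>An index set with \<open>2 * n - rank\<close> elements, where \<open>n\<close> is the
  number of weights. It serves both to code standard monomials and to index a flag of
  slices.\<close>

definition coords :: "('n + 'n) set" where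
  "coords = Inl ` UNIV \<union> Inr ` (- P)"

lemma card_coords: "card coords = 2 * card (UNIV :: 'n set) - rank_rows r S UNIV"
proof -
  have "card coords = card (UNIV :: 'n set) + card (- P)"
    unfolding coords_def by (subst card_Un_disjoint) (auto simp: card_image)
  moreover have "card (- P) = card (UNIV :: 'n set) - card P" by (simp add: Compl_eq_Diff_UNIV card_Diff_subset)
  moreover have "card P \<le> card (UNIV :: 'n set)" by (rule card_mono) auto
  ultimately show ?thesis using card_P by linarith
qed

text \<open>For a pivot \<open>i\<close> at most one of the two exponents is nonzero, so both fit into one number.\<close>

lemma card_std: "card {m. std m \<and> mdeg m \<le> M} \<le> (2 * M + 2) ^ card coords"
proof -
  \<comment> \<open>The value \<open>undefined\<close> off \<open>coords\<close> puts the code into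
    the extensional function space. The shift by \<open>M\<close> separates a nonzero exponent of
    \<open>Inr i\<close> from all exponents of \<open>Inl i\<close>.\<close>
  define code where "code m v = (if v \<notin> coords then undefined else case v of
      Inl i \<Rightarrow> if i \<in> P \<and> Poly_Mapping.lookup m (Inr i) \<noteq> 0 then M + Poly_Mapping.lookup m (Inr i) else Poly_Mapping.lookup m (Inl i)
    | Inr i \<Rightarrow> Poly_Mapping.lookup m (Inr i))" for m :: "'n + 'n \<Rightarrow>\<^sub>0 nat" and v
  have le: "Poly_Mapping.lookup m v \<le> M" if "mdeg m \<le> M" for m :: "'n + 'n \<Rightarrow>\<^sub>0 nat" and v
    using that member_le_sum[of v UNIV "Poly_Mapping.lookup m"] by (simp add: mdeg_def)
  have "inj_on code {m. std m \<and> mdeg m \<le> M}"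
  proof (rule inj_onI)
    fix m m' assume m: "m \<in> {m. std m \<and> mdeg m \<le> M}" "m' \<in> {m. std m \<and> mdeg m \<le> M}" and eq: "code m = code m'"
    have free: "Poly_Mapping.lookup m (Inl i) = Poly_Mapping.lookup m' (Inl i) \<and> Poly_Mapping.lookup m (Inr i) = Poly_Mapping.lookup m' (Inr i)"
      if "i \<notin> P" for i
      using that fun_cong[OF eq, of "Inl i"] fun_cong[OF eq, of "Inr i"] by (auto simp: code_def coords_def)
    have pivot: "Poly_Mapping.lookup m (Inl i) = Poly_Mapping.lookup m' (Inl i) \<and> Poly_Mapping.lookup m (Inr i) = Poly_Mapping.lookup m' (Inr i)"
      if "i \<in> P" for i
    proof -
      have "Poly_Mapping.lookup m (Inl i) = 0 \<or> Poly_Mapping.lookup m (Inr i) = 0"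
        "Poly_Mapping.lookup m' (Inl i) = 0 \<or> Poly_Mapping.lookup m' (Inr i) = 0"
        using m that by (auto simp: std_def)
      moreover have "Poly_Mapping.lookup m (Inl i) \<le> M" "Poly_Mapping.lookup m' (Inl i) \<le> M" using m le by auto
      moreover have "code m (Inl i) = code m' (Inl i)" using eq by simp
      ultimately show ?thesis using that by (auto simp: code_def coords_def split: if_splits)
    qed
    show "m = m'"
    proof (rule poly_mapping_eqI)
      fix v show "Poly_Mapping.lookup m v = Poly_Mapping.lookup m' v"
        using free pivot by (cases v) blast+
    qed
  qed
  then have "card {m. std m \<and> mdeg m \<le> M} = card (code ` {m. std m \<and> mdeg m \<le> M})" by (simp add: card_image)
  also have "\<dots> \<le> card (coords \<rightarrow>\<^sub>E {..<2 * M + 2})"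
  proof (rule card_mono)
    show "finite (coords \<rightarrow>\<^sub>E {..<2 * M + 2})" by (intro finite_PiE) auto
    have "code m v < 2 * M + 2" if "mdeg m \<le> M" "v \<in> coords" for m v
      using that le[OF that(1), of "Inl (projl v)"] le[OF that(1), of "Inr (projl v)"] le[OF that(1), of "Inr (projr v)"]
      by (cases v) (auto simp: code_def)
    then show "code ` {m. std m \<and> mdeg m \<le> M} \<subseteq> coords \<rightarrow>\<^sub>E {..<2 * M + 2}"
      by (auto simp: PiE_def Pi_def extensional_def code_def)
  qed
  also have "\<dots> = (2 * M + 2) ^ card coords" by (subst card_PiE) auto
  finally show ?thesis .
qed

text \<open>With exponents up to \<open>N\<close> there are \<open>(N + 1) ^ (D + 1)\<close>
  products of the given elements, while their normal forms lie in a space whose dimension grows only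
  like \<open>N ^ D\<close>.\<close>

lemma algebraic_dependence:
  fixes ys :: "('n + 'n, 'a::field_char_0) mpoly list"
  assumes "length ys = Suc (card coords)"
  shows "\<exists>B c. finite B \<and> B \<noteq> {} \<and> (\<forall>b\<in>B. length b = length ys \<and> c b \<noteq> 0) \<and>
    (\<Sum>b\<in>B. Poly_Mapping.single 0 (c b) * mprod ys b) \<in> mu_ideal r S"
proof -
  define D where "D = card coords"
  define e where "e = Max (insert 0 (mdeg ` (\<Union>y\<in>set ys. Poly_Mapping.keys y)))"
  have e: "deg_le y e" if "y \<in> set ys" for y
    unfolding deg_le_def e_def using that by (intro ballI Max_ge) auto
  \<comment> \<open>The choice of \<open>K\<close> gives \<open>2 * M + 2 \<le> K * (N + 1)\<close>.
    With \<open>N = K ^ D\<close> the bound \<open>(K * (N + 1)) ^ D\<close> equals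
    \<open>N * (N + 1) ^ D\<close>, just below the number of products.\<close>
  define K where "K = 2 * Suc D * e + 2"
  define N where "N = K ^ D"
  define M where "M = Suc D * (N * e)"
  define Bs where "Bs = {b. set b \<subseteq> {..N} \<and> length b = length ys}"
  have Bs: "finite Bs" "card Bs = (N + 1) ^ Suc D"
    unfolding Bs_def using card_lists_length_eq[of "{..N}" "length ys"] finite_lists_length_eq[of "{..N}" "length ys"]
    by (auto simp: assms D_def)
  have "\<exists>g. mprod ys b - g \<in> mu_ideal r S \<and> (\<forall>l\<in>Poly_Mapping.keys g. std l \<and> mdeg l \<le> M)" if "b \<in> Bs" for b
  proof (rule normal_form)
    have "deg_le (mprod ys b) M"
      using deg_le_mprod[of b ys e N] that e by (auto simp: Bs_def M_def assms D_def)
    then show "mdeg m \<le> M" if "m \<in> Poly_Mapping.keys (mprod ys b)" for m using that by (simp add: deg_le_def)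
  qed
  then obtain G where G: "\<And>b. b \<in> Bs \<Longrightarrow> mprod ys b - G b \<in> mu_ideal r S"
    "\<And>b l. b \<in> Bs \<Longrightarrow> l \<in> Poly_Mapping.keys (G b) \<Longrightarrow> std l \<and> mdeg l \<le> M"
    by metis
  let ?A = "{m. std m \<and> mdeg m \<le> M}"
  have finA: "finite ?A" by (rule finite_subset[OF _ finite_mdeg_le[of M]]) auto
  have "card ?A \<le> (2 * M + 2) ^ D" unfolding D_def by (rule card_std)
  also have "\<dots> \<le> (K * (N + 1)) ^ D"
    by (rule power_mono) (auto simp: M_def K_def algebra_simps)
  also have "\<dots> = N * (N + 1) ^ D" by (simp only: power_mult_distrib N_def)
  also have "\<dots> < (N + 1) * (N + 1) ^ D" by simp
  finally have "card ?A < card Bs" by (simp add: Bs)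
  from homogeneous_system_nontrivial[OF finA Bs(1) this, of "\<lambda>b. Poly_Mapping.lookup (G b)"]
  obtain c :: "nat list \<Rightarrow> 'a" where c: "\<exists>b\<in>Bs. c b \<noteq> 0" "\<forall>m\<in>?A. (\<Sum>b\<in>Bs. c b * Poly_Mapping.lookup (G b) m) = 0" by blast
  let ?C = "\<lambda>b. Poly_Mapping.single 0 (c b) :: ('n + 'n, 'a) mpoly"
  have "(\<Sum>b\<in>Bs. ?C b * G b) = 0"
  proof (rule poly_mapping_eqI)
    fix m
    have "Poly_Mapping.lookup (\<Sum>b\<in>Bs. ?C b * G b) m = (\<Sum>b\<in>Bs. c b * Poly_Mapping.lookup (G b) m)"
      by (simp add: lookup_sum lookup_const_mult)
    also have "\<dots> = 0"
    proof (cases "m \<in> ?A")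
      case False
      then have "Poly_Mapping.lookup (G b) m = 0" if "b \<in> Bs" for b using G(2)[OF that] by (auto simp: in_keys_iff)
      then show ?thesis by simp
    qed (use c in auto)
    finally show "Poly_Mapping.lookup (\<Sum>b\<in>Bs. ?C b * G b) m = Poly_Mapping.lookup 0 m" by simp
  qed
  moreover have "(\<Sum>b\<in>Bs. ?C b * (mprod ys b - G b)) \<in> mu_ideal r S"
    by (intro ideal_sum[OF is_ideal_mu_ideal] ideal_mult_left[OF is_ideal_mu_ideal] G(1))
  ultimately have "(\<Sum>b\<in>Bs. ?C b * mprod ys b) \<in> mu_ideal r S"
    by (simp add: right_diff_distrib sum_subtractf)
  also have "(\<Sum>b\<in>Bs. ?C b * mprod ys b) = (\<Sum>b\<in>{b\<in>Bs. c b \<noteq> 0}. ?C b * mprod ys b)"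
    using Bs(1) by (intro sum.mono_neutral_right) auto
  finally have "(\<Sum>b\<in>{b\<in>Bs. c b \<noteq> 0}. ?C b * mprod ys b) \<in> mu_ideal r S" .
  then show ?thesis
  proof (intro exI[of _ "{b\<in>Bs. c b \<noteq> 0}"] exI[of _ c] conjI)
    show "finite {b\<in>Bs. c b \<noteq> 0}" using Bs(1) by simp
    show "{b\<in>Bs. c b \<noteq> 0} \<noteq> {}" using c(1) by blast
  qed (auto simp: Bs_def)
qed

lemma no_long_chain:
  "\<not> has_prime_chain (mu_ideal r S :: ('n + 'n, 'a::field_char_0) mpoly set) (Suc (card coords))"
proof
  let ?d = "Suc (card coords)"
  assume "has_prime_chain (mu_ideal r S :: ('n + 'n, 'a) mpoly set) ?d"
  then obtain Q :: "nat \<Rightarrow> ('n + 'n, 'a) mpoly set" where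
    Q: "\<And>k. k \<le> ?d \<Longrightarrow> prime_ideal (Q k)" "\<And>k. k \<le> ?d \<Longrightarrow> mu_ideal r S \<subseteq> Q k" "\<And>k. k < ?d \<Longrightarrow> Q k \<subset> Q (Suc k)"
    unfolding has_prime_chain_def by blast
  have "\<forall>k. \<exists>y. k < ?d \<longrightarrow> y \<in> Q (Suc k) \<and> y \<notin> Q k" using Q(3) by blast
  then obtain y where y: "\<And>k. k < ?d \<Longrightarrow> y k \<in> Q (Suc k) \<and> y k \<notin> Q k" by metis
  define ys where "ys = map y [0..<?d]"
  have len: "length ys = ?d" by (simp add: ys_def)
  have nth: "ys ! k = y k" if "k < ?d" for k using that by (simp add: ys_def del: upt_Suc)
  from algebraic_dependence[OF len] obtain B and c :: "nat list \<Rightarrow> 'a" where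
    B: "finite B" "B \<noteq> {}" "\<And>b. b \<in> B \<Longrightarrow> length b = length ys" "\<And>b. b \<in> B \<Longrightarrow> c b \<noteq> 0"
    "(\<Sum>b\<in>B. Poly_Mapping.single 0 (c b) * mprod ys b) \<in> mu_ideal r S" by blast
  have "B = {}"
  proof (rule prime_chain_independent[of ys Q B "\<lambda>b. Poly_Mapping.single 0 (c b)"])
    show "prime_ideal (Q k)" if "k \<le> length ys" for k using Q(1) that len by simp
    show "Q k \<subseteq> Q (Suc k) \<and> ys ! k \<in> Q (Suc k) \<and> ys ! k \<notin> Q k" if "k < length ys" for k
      using Q(3)[of k] y[of k] nth[of k] that len by auto
    show "Poly_Mapping.single 0 (c b) \<notin> Q (length ys)" if "b \<in> B" for b
    proof
      assume "Poly_Mapping.single 0 (c b) \<in> Q (length ys)"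
      then have "Poly_Mapping.single 0 (inverse (c b)) * Poly_Mapping.single 0 (c b) \<in> Q (length ys)"
        using Q(1)[of ?d] len by (intro ideal_mult_left prime_ideal_D) auto
      then have "1 \<in> Q (length ys)" using B(4)[OF that] by (simp add: mult_single)
      then show False using Q(1)[of ?d] len by (auto simp: prime_ideal_def)
    qed
    show "(\<Sum>b\<in>B. Poly_Mapping.single 0 (c b) * mprod ys b) \<in> Q 0" using B(5) Q(2)[of 0] by auto
  qed (use B in auto)
  with B(2) show False by simp
qed

section \<open>Lower bound for the dimension: a flag of slices\<close>

definition linear_rel :: "('n \<Rightarrow> 'a::field_char_0) \<Rightarrow> bool" where
  "linear_rel u \<longleftrightarrow> (\<forall>i. u i = (\<Sum>j\<in>- P. of_rat (\<Lambda> i j) * u j))"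

lemma linear_rel_line:
  assumes "linear_rel u" "linear_rel v"
  shows "linear_rel (\<lambda>i. s * u i + s' * v i)"
  unfolding linear_rel_def
proof
  fix i
  have "u i = (\<Sum>j\<in>- P. of_rat (\<Lambda> i j) * u j)" using assms(1) unfolding linear_rel_def by (rule spec)
  moreover have "v i = (\<Sum>j\<in>- P. of_rat (\<Lambda> i j) * v j)" using assms(2) unfolding linear_rel_def by (rule spec)
  ultimately have "s * u i + s' * v i = s * (\<Sum>j\<in>- P. of_rat (\<Lambda> i j) * u j) + s' * (\<Sum>j\<in>- P. of_rat (\<Lambda> i j) * v j)"
    by (rule arg_cong2[where f = "\<lambda>x y. s * x + s' * y"])
  also have "\<dots> = (\<Sum>j\<in>- P. of_rat (\<Lambda> i j) * (s * u j + s' * v j))"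
    by (simp add: sum.distrib sum_distrib_left algebra_simps)
  finally show "s * u i + s' * v i = (\<Sum>j\<in>- P. of_rat (\<Lambda> i j) * (s * u j + s' * v j))" .
qed

lemma linear_rel_0: "linear_rel (\<lambda>_. 0)"
  by (simp add: linear_rel_def)

lemma linear_rel_combination: "linear_rel (\<lambda>i. \<Sum>j\<in>- P. of_rat (\<Lambda> i j) * w j)"
  unfolding linear_rel_def
proof
  fix i
  have "(\<Sum>k\<in>- P. of_rat (\<Lambda> j k) * w k) = w j" if "j \<in> - P" for j
  proof -
    have "(\<Sum>k\<in>- P. of_rat (\<Lambda> j k) * w k) = (\<Sum>k\<in>- P. if k = j then w j else 0)"
      using that by (intro sum.cong refl) (auto simp: coeff_free)
    then show ?thesis using that by simp
  qed
  then show "(\<Sum>j\<in>- P. of_rat (\<Lambda> i j) * w j) = (\<Sum>j\<in>- P. of_rat (\<Lambda> i j) * (\<Sum>k\<in>- P. of_rat (\<Lambda> j k) * w k))"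
    by (intro sum.cong refl) auto
qed

lemma linear_rel_column:
  assumes "j \<in> - P"
  shows "linear_rel (\<lambda>i. of_rat (\<Lambda> i j) :: 'a::field_char_0)"
proof -
  have "(\<Sum>k\<in>- P. of_rat (\<Lambda> i k) * (if k = j then 1 else 0)) = (of_rat (\<Lambda> i j) :: 'a)" for i
    using assms by (simp add: if_distrib cong: if_cong)
  then show ?thesis using linear_rel_combination[of "\<lambda>k. if k = j then 1 else (0::'a)"] by (simp only:)
qed

text \<open>Written before the chart is applied, so \<open>p (Inr i)\<close> is a product of dual
  coordinates. The entries \<open>Inl i\<close> are fixed to \<open>1\<close> and not to
  \<open>0\<close> because the chart divides by them.\<close>

definition slice :: "('n + 'n) set \<Rightarrow> ('n + 'n \<Rightarrow> 'a::field_char_0) set" where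
  "slice T = {p. linear_rel (\<lambda>i. p (Inr i)) \<and>
    (\<forall>i. Inl i \<in> T \<longrightarrow> p (Inl i) = 1) \<and> (\<forall>j. Inr j \<in> T \<longrightarrow> p (Inr j) = 0)}"

definition slice_chart :: "('n + 'n) set \<Rightarrow> ('n + 'n \<Rightarrow> 'a::field_char_0) set" where
  "slice_chart T = torus_chart UNIV ` {p \<in> slice T. \<forall>i\<in>UNIV. p (Inl i) \<noteq> 0}"

lemma prime_ideal_slice: "prime_ideal (vanishing (slice_chart T :: ('n + 'n \<Rightarrow> 'a::field_char_0) set))"
  unfolding slice_chart_def
proof (rule prime_ideal_vanishing_torus_chart)
  show "(\<lambda>v. (1 - t) * p v + t * q v) \<in> slice T" if "p \<in> slice T" "q \<in> slice T" for p q and t :: 'a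
    using that by (auto simp: slice_def linear_rel_line)
  show "\<exists>p\<in>slice T. \<forall>i\<in>UNIV. p (Inl i) \<noteq> (0 :: 'a)"
    by (rule bexI[of _ "case_sum (\<lambda>_. 1) (\<lambda>_. 0)"]) (auto simp: slice_def linear_rel_0)
qed

lemma peval_gpol:
  "peval p (gpol i) = p (Inl i) * p (Inr i) - (\<Sum>j\<in>- P. of_rat (\<Lambda> i j) * (p (Inl j) * p (Inr j)))"
  by (simp add: gpol_def peval_simps)

lemma mu_ideal_subset_vanishing_iff:
  "(mu_ideal r S :: ('n + 'n, 'a::field_char_0) mpoly set) \<subseteq> vanishing X \<longleftrightarrow>
    (\<forall>p\<in>X. linear_rel (\<lambda>i. p (Inl i) * p (Inr i)))"
proof
  assume "(mu_ideal r S :: ('n + 'n, 'a) mpoly set) \<subseteq> vanishing X"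
  then have "peval p (gpol i) = 0" if "p \<in> X" for p i using gpol_mem[of i] that by (auto simp: vanishing_def)
  then show "\<forall>p\<in>X. linear_rel (\<lambda>i. p (Inl i) * p (Inr i))"
    unfolding linear_rel_def peval_gpol by simp
next
  assume "\<forall>p\<in>X. linear_rel (\<lambda>i. p (Inl i) * p (Inr i))"
  then have "peval p (gpol i) = 0" if "p \<in> X" for p i
    using that unfolding linear_rel_def peval_gpol right_minus_eq by blast
  then show "(mu_ideal r S :: ('n + 'n, 'a) mpoly set) \<subseteq> vanishing X"
    unfolding mu_ideal_eq by (intro ideal_gen_least is_ideal_vanishing) (auto simp: vanishing_def)
qed

lemma mu_ideal_slice: "mu_ideal r S \<subseteq> vanishing (slice_chart T :: ('n + 'n \<Rightarrow> 'a::field_char_0) set)"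
  unfolding mu_ideal_subset_vanishing_iff by (auto simp: slice_chart_def slice_def)

lemma slice_vanishing_mono:
  "T \<subseteq> T' \<Longrightarrow> vanishing (slice_chart T :: ('n + 'n \<Rightarrow> 'a::field_char_0) set) \<subseteq> vanishing (slice_chart T')"
  unfolding vanishing_def slice_chart_def slice_def by blast

text \<open>The function that fixes the new coordinate separates the slices. The witness has
  \<open>2\<close> at \<open>Inl i\<close> in the first case; in the second its products form column
  \<open>j\<close> of \<open>\<Lambda>\<close>, which vanishes at all other free indices.\<close>

lemma slice_vanishing_strict:
  assumes "T \<subseteq> coords" "v \<in> coords - T"
  shows "vanishing (slice_chart T :: ('n + 'n \<Rightarrow> 'a::field_char_0) set) \<subset> vanishing (slice_chart (insert v T))"
proof (cases v)
  case (Inl i)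
  let ?f = "Var (Inl i) - 1 :: ('n + 'n, 'a) mpoly"
  let ?p = "case_sum (\<lambda>k. if k = i then 2 else 1) (\<lambda>_. 0) :: 'n + 'n \<Rightarrow> 'a"
  have "?f \<in> vanishing (slice_chart (insert v T))"
    by (auto simp: vanishing_def slice_chart_def slice_def peval_simps Inl)
  moreover have "torus_chart UNIV ?p \<in> slice_chart T"
    unfolding slice_chart_def using assms(2) Inl by (intro imageI) (auto simp: slice_def linear_rel_0)
  then have "?f \<notin> vanishing (slice_chart T)"
    by (auto simp: vanishing_def peval_simps intro!: bexI[of _ "torus_chart UNIV ?p"])
  ultimately show ?thesis using slice_vanishing_mono[of T "insert v T"] by blast
next
  case (Inr j)
  then have j: "j \<in> - P" using assms(2) by (auto simp: coords_def)
  let ?f = "Var (Inl j) * Var (Inr j) :: ('n + 'n, 'a) mpoly"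
  let ?p = "case_sum (\<lambda>_. 1) (\<lambda>i. of_rat (\<Lambda> i j)) :: 'n + 'n \<Rightarrow> 'a"
  have "?f \<in> vanishing (slice_chart (insert v T))"
    by (auto simp: vanishing_def slice_chart_def slice_def peval_simps Inr)
  moreover have "torus_chart UNIV ?p \<in> slice_chart T"
    unfolding slice_chart_def
  proof (intro imageI CollectI conjI)
    have "\<Lambda> k j = 0" if "Inr k \<in> T" for k
      using that assms Inr coeff_free[of k j] by (auto simp: coords_def)
    then show "?p \<in> slice T" using linear_rel_column[OF j] by (auto simp: slice_def)
  qed simp
  then have "?f \<notin> vanishing (slice_chart T)"
    using j by (auto simp: vanishing_def peval_simps coeff_free intro!: bexI[of _ "torus_chart UNIV ?p"])
  ultimately show ?thesis using slice_vanishing_mono[of T "insert v T"] by blast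
qed

lemma long_chain: "has_prime_chain (mu_ideal r S :: ('n + 'n, 'a::field_char_0) mpoly set) (card coords)"
proof -
  obtain h where h: "bij_betw h {0..<card coords} coords"
    using ex_bij_betw_nat_finite[of coords] by auto
  let ?Q = "\<lambda>k. vanishing (slice_chart (h ` {0..<k})) :: ('n + 'n, 'a) mpoly set"
  have "?Q k \<subset> ?Q (Suc k)" if k: "k < card coords" for k
  proof -
    have "h ` {0..<k} \<subseteq> coords" using h k by (auto simp: bij_betw_def)
    moreover have "h k \<noteq> h x" if "x < k" for x
      using h k that by (auto simp: bij_betw_def dest: inj_onD[of h _ k x])
    then have "h k \<notin> h ` {0..<k}" by (metis atLeastLessThan_iff imageE)
    then have "h k \<in> coords - h ` {0..<k}" using h k by (auto simp: bij_betw_def)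
    moreover have "h ` {0..<Suc k} = insert (h k) (h ` {0..<k})" by (simp add: atLeast0_lessThan_Suc)
    ultimately show ?thesis by (simp add: slice_vanishing_strict)
  qed
  then show ?thesis unfolding has_prime_chain_def
    by (intro exI[of _ ?Q]) (auto simp: prime_ideal_slice mu_ideal_slice)
qed

lemma krull_dim_mu_ideal:
  "krull_dim_quot (mu_ideal r S :: ('n + 'n, 'a::field_char_0) mpoly set) (2 * card (UNIV :: 'n set) - rank_rows r S UNIV)"
  unfolding krull_dim_quot_def card_coords[symmetric] using long_chain no_long_chain by blast

lemma complete_intersection_mu_ideal:
  "complete_intersection (2 * card (UNIV :: 'n set)) (mu_ideal r S :: ('n + 'n, 'a::field_char_0) mpoly set)"
proof -
  obtain ps where ps: "set ps = P" "distinct ps" using finite_distinct_list[of P] by auto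
  then have "length ps = card P" using distinct_card by metis
  moreover have "card P \<le> card (UNIV :: 'n set)" by (rule card_mono) auto
  ultimately have "length (map gpol ps) = 2 * card (UNIV :: 'n set) - (2 * card (UNIV :: 'n set) - rank_rows r S UNIV)"
    using card_P by simp
  moreover have "ideal_gen (set (map gpol ps)) = (mu_ideal r S :: ('n + 'n, 'a) mpoly set)"
    using ps by (simp add: mu_ideal_eq)
  ultimately show ?thesis
    unfolding complete_intersection_def using krull_dim_mu_ideal by (metis diff_le_self)
qed

end

subsection \<open>Components of the zero fibre\<close>

context pivot_rows
begin

lemma mu_zero_iff: "p \<in> mu_zero r S \<longleftrightarrow> linear_rel (\<lambda>i. p (Inl i) * p (Inr i) :: 'a::field_char_0)"
proof -
  have "p \<in> mu_zero r S \<longleftrightarrow> mu_ideal r S \<subseteq> vanishing {p}"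
    by (auto simp: mu_zero_def zero_set_def vanishing_def)
  then show ?thesis by (simp add: mu_ideal_subset_vanishing_iff)
qed

lemma mu_zero_J_iff:
  "p \<in> mu_zero_J r S I \<longleftrightarrow> linear_rel (\<lambda>i. p (Inl i) * p (Inr i) :: 'a::field_char_0) \<and> (\<forall>i. p (Inl i) \<noteq> 0 \<longleftrightarrow> i \<in> I)"
  by (simp add: mu_zero_J_def mu_zero_iff)

lemma zclosed_mu_zero: "zclosed (mu_zero r S :: ('n + 'n \<Rightarrow> 'a::field_char_0) set)"
  by (auto simp: mu_zero_def zclosed_def)

lemma linear_rel_Z:
  assumes "linear_rel u" "i \<in> Z"
  shows "u i = 0"
proof -
  have "u i = (\<Sum>j\<in>- P. of_rat (\<Lambda> i j) * u j)" using assms(1) unfolding linear_rel_def by (rule spec)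
  also have "\<dots> = 0" using assms(2) by (intro sum.neutral) (auto simp: Z_def)
  finally show ?thesis .
qed

text \<open>Shows the stratum to be the open part of a linear space: outside \<open>I\<close> the
  products are zero and the dual coordinates are unconstrained.\<close>

lemma mu_zero_J_chart:
  "(mu_zero_J r S I :: ('n + 'n \<Rightarrow> 'a::field_char_0) set) =
    torus_chart I ` {p \<in> {p. linear_rel (\<lambda>i. if i \<in> I then p (Inr i) else 0) \<and> (\<forall>i. i \<notin> I \<longrightarrow> p (Inl i) = 0)}. \<forall>i\<in>I. p (Inl i) \<noteq> 0}"
  (is "_ = torus_chart I ` ?M")
proof (intro equalityI subsetI)
  fix q :: "'n + 'n \<Rightarrow> 'a"
  assume q: "q \<in> mu_zero_J r S I"
  define p where "p = case_sum (\<lambda>i. q (Inl i)) (\<lambda>i. if i \<in> I then q (Inl i) * q (Inr i) else q (Inr i))"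
  have eq: "(\<lambda>i. if i \<in> I then p (Inr i) else 0) = (\<lambda>i. q (Inl i) * q (Inr i))"
  proof
    fix i show "(if i \<in> I then p (Inr i) else 0) = q (Inl i) * q (Inr i)"
      using q by (cases "i \<in> I") (auto simp: p_def mu_zero_J_iff)
  qed
  have "linear_rel (\<lambda>i. if i \<in> I then p (Inr i) else 0)" using q unfolding eq mu_zero_J_iff by blast
  moreover have "p (Inl i) \<noteq> 0 \<longleftrightarrow> i \<in> I" for i using q by (simp add: p_def mu_zero_J_iff)
  ultimately have "p \<in> ?M" by auto
  moreover have "q = torus_chart I p"
  proof
    fix v show "q v = torus_chart I p v" using q by (cases v) (auto simp: p_def mu_zero_J_iff)
  qed
  ultimately show "q \<in> torus_chart I ` ?M" by blast
next
  fix q assume "q \<in> torus_chart I ` ?M"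
  then obtain p where p: "linear_rel (\<lambda>i. if i \<in> I then p (Inr i) else 0)" "\<And>i. p (Inl i) \<noteq> 0 \<longleftrightarrow> i \<in> I" "q = torus_chart I p"
    by auto
  have "(\<lambda>i. q (Inl i) * q (Inr i)) = (\<lambda>i. if i \<in> I then p (Inr i) else 0)"
  proof
    fix i show "q (Inl i) * q (Inr i) = (if i \<in> I then p (Inr i) else 0)"
      using p(2)[of i] by (cases "i \<in> I") (auto simp: p(3))
  qed
  then show "q \<in> mu_zero_J r S I" using p by (simp add: mu_zero_J_iff)
qed

lemma prime_ideal_mu_zero_J: "prime_ideal (vanishing (mu_zero_J r S I :: ('n + 'n \<Rightarrow> 'a::field_char_0) set))"
  unfolding mu_zero_J_chart
proof (rule prime_ideal_vanishing_torus_chart)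
  let ?M = "{p. linear_rel (\<lambda>i. if i \<in> I then p (Inr i) else (0 :: 'a)) \<and> (\<forall>i. i \<notin> I \<longrightarrow> p (Inl i) = 0)}"
  fix p q and s :: 'a assume pq: "p \<in> ?M" "q \<in> ?M"
  have "(\<lambda>i. if i \<in> I then (1 - s) * p (Inr i) + s * q (Inr i) else 0) =
      (\<lambda>i. (1 - s) * (if i \<in> I then p (Inr i) else 0) + s * (if i \<in> I then q (Inr i) else 0))" by auto
  then have "linear_rel (\<lambda>i. if i \<in> I then (1 - s) * p (Inr i) + s * q (Inr i) else 0)"
    using pq linear_rel_line[of "\<lambda>i. if i \<in> I then p (Inr i) else 0" "\<lambda>i. if i \<in> I then q (Inr i) else 0" "1 - s" s] by simp
  then show "(\<lambda>v. (1 - s) * p v + s * q v) \<in> ?M" using pq by simp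
next
  show "\<exists>p\<in>{p. linear_rel (\<lambda>i. if i \<in> I then p (Inr i) else (0 :: 'a)) \<and> (\<forall>i. i \<notin> I \<longrightarrow> p (Inl i) = 0)}. \<forall>i\<in>I. p (Inl i) \<noteq> 0"
    by (rule bexI[of _ "case_sum (\<lambda>i. if i \<in> I then 1 else 0) (\<lambda>_. 0)"]) (auto simp: linear_rel_0 cong: if_cong)
qed

lemma zirreducible_closure_J: "zirreducible (zclosure (mu_zero_J r S I :: ('n + 'n \<Rightarrow> 'a::field_char_0) set))"
  by (rule zirreducible_zclosure[OF prime_ideal_mu_zero_J])

text \<open>The free entries are put on the moment curve \<open>s ^ to_nat j\<close>. Each linear
  form outside \<open>Z\<close> becomes a nonzero polynomial in \<open>s\<close>, and finitely many
  of these have a common nonroot.\<close>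

lemma generic_relation: "\<exists>c :: 'n \<Rightarrow> 'a::field_char_0. linear_rel c \<and> (\<forall>i. c i = 0 \<longleftrightarrow> i \<in> Z)"
proof -
  define F where "F i = (\<Sum>j\<in>- P. monom (of_rat (\<Lambda> i j) :: 'a) (to_nat j))" for i
  have coeff: "coeff (F i) (to_nat j) = of_rat (\<Lambda> i j)" if "j \<in> - P" for i j
  proof -
    have "coeff (F i) (to_nat j) = (\<Sum>k\<in>- P. if k = j then of_rat (\<Lambda> i j) else 0)"
      unfolding F_def coeff_sum by (intro sum.cong refl) auto
    then show ?thesis using that by simp
  qed
  have "F i \<noteq> 0" if "i \<in> - Z" for i
  proof -
    have "\<not> (\<forall>j\<in>- P. \<Lambda> i j = 0)" using that by (simp add: Z_def)
    then obtain j where "j \<in> - P" "\<Lambda> i j \<noteq> 0" by blast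
    then show ?thesis using coeff[of j i] by auto
  qed
  then have "(\<Prod>i\<in>- Z. F i) \<noteq> 0" by simp
  then obtain s where s: "poly (\<Prod>i\<in>- Z. F i) s \<noteq> 0" using poly_nonroot by blast
  have ev: "poly (F i) s = (\<Sum>j\<in>- P. of_rat (\<Lambda> i j) * s ^ to_nat j)" for i
    by (simp add: F_def poly_sum poly_monom)
  have lin: "linear_rel (\<lambda>i. poly (F i) s)"
    unfolding ev by (rule linear_rel_combination)
  moreover have "poly (F i) s = 0 \<longleftrightarrow> i \<in> Z" for i
  proof
    assume "poly (F i) s = 0"
    then show "i \<in> Z" using s by (auto simp: poly_prod)
  qed (rule linear_rel_Z[OF lin])
  ultimately show ?thesis by blast
qed

text \<open>Moving a point along a generic relation \<open>c\<close>, with products \<open>x i * \<phi> i + s\<^sup>2 * c i\<close> at time \<open>s\<close>,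
  makes all the coordinates \<open>x i\<close>, \<open>i \<notin> Z\<close>, nonzero.\<close>

lemma mu_zero_J_subset_closure:
  "(mu_zero_J r S I :: ('n + 'n \<Rightarrow> 'a::field_char_0) set) \<subseteq> zclosure (mu_zero_J r S (I \<union> - Z))"
proof
  fix p :: "'n + 'n \<Rightarrow> 'a"
  assume p: "p \<in> mu_zero_J r S I"
  then have pI: "p (Inl i) \<noteq> 0 \<longleftrightarrow> i \<in> I" for i by (simp add: mu_zero_J_iff)
  have rel: "linear_rel (\<lambda>i. p (Inl i) * p (Inr i))" using p by (simp add: mu_zero_J_iff)
  obtain c :: "'n \<Rightarrow> 'a" where c: "linear_rel c" "\<And>i. c i = 0 \<longleftrightarrow> i \<in> Z" using generic_relation by blast
  \<comment> \<open>The order \<open>s ^ 2\<close> lets a pair of zero coordinates move to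
    \<open>s\<close> and \<open>s * c i\<close>, both polynomial and zero at \<open>s = 0\<close>.
    If one coordinate of the pair is nonzero, it stays fixed and the other absorbs the
    change.\<close>
  define \<gamma> where "\<gamma> s = case_sum
    (\<lambda>i. if i \<in> I \<union> Z then p (Inl i) else if p (Inr i) = 0 then s else s ^ 2 * (c i / p (Inr i)))
    (\<lambda>i. if i \<in> I then p (Inr i) + s ^ 2 * (c i / p (Inl i)) else if i \<in> Z then p (Inr i)
       else if p (Inr i) = 0 then s * c i else p (Inr i))" for s
  have "\<gamma> 0 v = p v" for v using pI by (cases v) (auto simp: \<gamma>_def)
  then have \<gamma>0: "\<gamma> 0 = p" by auto
  have prod: "\<gamma> s (Inl i) * \<gamma> s (Inr i) = 1 * (p (Inl i) * p (Inr i)) + s ^ 2 * c i" for s i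
    using pI[of i] c(2)[of i] by (auto simp: \<gamma>_def field_simps power2_eq_square)
  have mem: "\<gamma> s \<in> mu_zero_J r S (I \<union> - Z)" if "s \<noteq> 0" for s
    unfolding mu_zero_J_iff prod
  proof (intro conjI allI)
    show "linear_rel (\<lambda>i. 1 * (p (Inl i) * p (Inr i)) + s ^ 2 * c i)" by (rule linear_rel_line[OF rel c(1)])
    show "\<gamma> s (Inl i) \<noteq> 0 \<longleftrightarrow> i \<in> I \<union> - Z" for i
      using pI[of i] c(2)[of i] that by (auto simp: \<gamma>_def)
  qed
  have poly: "\<exists>F. \<forall>s. \<gamma> s v = poly F s" for v
  proof -
    have const: "\<exists>F. \<forall>s. a = poly F s" for a :: 'a by (rule exI[of _ "[:a:]"]) simp
    have id: "\<exists>F. \<forall>s :: 'a. s = poly F s" by (rule exI[of _ "[:0, 1:]"]) simp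
    have lin: "\<exists>F. \<forall>s. s * b = poly F s" for b :: 'a by (rule exI[of _ "[:0, b:]"]) simp
    have sq: "\<exists>F. \<forall>s. a + s ^ 2 * b = poly F s" "\<exists>F. \<forall>s. s ^ 2 * b = poly F s" for a b :: 'a
      by (rule exI[of _ "[:a, 0, b:]"], simp add: power2_eq_square, rule exI[of _ "[:0, 0, b:]"], simp add: power2_eq_square)
    show ?thesis
    proof (cases v)
      case (Inl i)
      consider "i \<in> I \<union> Z" | "i \<notin> I \<union> Z" "p (Inr i) = 0" | "i \<notin> I \<union> Z" "p (Inr i) \<noteq> 0" by blast
      then show ?thesis
      proof cases
        case 1
        then show ?thesis using const by (simp only: \<gamma>_def Inl sum.case if_True)
      next
        case 2
        then show ?thesis using id by (simp only: \<gamma>_def Inl sum.case if_True if_False simp_thms)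
      next
        case 3
        then show ?thesis using sq(2) by (simp only: \<gamma>_def Inl sum.case if_False)
      qed
    next
      case (Inr i)
      consider "i \<in> I" | "i \<notin> I" "i \<in> Z" | "i \<notin> I" "i \<notin> Z" "p (Inr i) = 0" | "i \<notin> I" "i \<notin> Z" "p (Inr i) \<noteq> 0"
        by blast
      then show ?thesis
      proof cases
        case 1
        then show ?thesis using sq(1) by (simp only: \<gamma>_def Inr sum.case if_True)
      next
        case 2
        then show ?thesis using const by (simp only: \<gamma>_def Inr sum.case if_True if_False simp_thms)
      next
        case 3
        then show ?thesis using lin by (simp only: \<gamma>_def Inr sum.case if_True if_False simp_thms)
      next
        case 4
        then show ?thesis using const by (simp only: \<gamma>_def Inr sum.case if_False)
      qed
    qed
  qed
  have "peval p f = 0" if "f \<in> vanishing (mu_zero_J r S (I \<union> - Z))" for f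
    using peval_limit_zero[of \<gamma> f, OF poly] mem that by (auto simp: vanishing_def \<gamma>0)
  then show "p \<in> zclosure (mu_zero_J r S (I \<union> - Z))" by (auto simp: zclosure_eq zero_set_def)
qed

lemma mu_zero_Union:
  "(mu_zero r S :: ('n + 'n \<Rightarrow> 'a::field_char_0) set) = \<Union>{zclosure (mu_zero_J r S I) | I. - I \<subseteq> Z}"
proof
  show "mu_zero r S \<subseteq> \<Union>{zclosure (mu_zero_J r S I :: ('n + 'n \<Rightarrow> 'a) set) | I. - I \<subseteq> Z}"
  proof
    fix p :: "'n + 'n \<Rightarrow> 'a"
    assume "p \<in> mu_zero r S"
    then have "p \<in> mu_zero_J r S {i. p (Inl i) \<noteq> 0}" by (simp add: mu_zero_J_def)
    then have "p \<in> zclosure (mu_zero_J r S ({i. p (Inl i) \<noteq> 0} \<union> - Z))" using mu_zero_J_subset_closure by blast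
    moreover have "- ({i. p (Inl i) \<noteq> 0} \<union> - Z) \<subseteq> Z" by auto
    ultimately show "p \<in> \<Union>{zclosure (mu_zero_J r S I) | I. - I \<subseteq> Z}" by blast
  qed
  have "zclosure (mu_zero_J r S I) \<subseteq> (mu_zero r S :: ('n + 'n \<Rightarrow> 'a) set)" for I
    by (rule zclosure_minimal[OF _ zclosed_mu_zero]) (auto simp: mu_zero_J_def)
  then show "\<Union>{zclosure (mu_zero_J r S I :: ('n + 'n \<Rightarrow> 'a) set) | I. - I \<subseteq> Z} \<subseteq> mu_zero r S" by blast
qed

text \<open>For \<open>i \<notin> I'\<close> the coordinate \<open>Inl i\<close> vanishes on the
  second stratum. For \<open>i \<in> I' - I\<close> the index lies in \<open>Z\<close>, so
  \<open>Inr i\<close> vanishes there, yet it takes the value \<open>1\<close> on the first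
  stratum.\<close>

lemma closure_J_subsetD:
  assumes I: "- I \<subseteq> Z" "- I' \<subseteq> Z"
    and sub: "zclosure (mu_zero_J r S I :: ('n + 'n \<Rightarrow> 'a::field_char_0) set) \<subseteq> zclosure (mu_zero_J r S I')"
  shows "I = I'"
proof -
  have vanish: "peval p f = 0" if "f \<in> vanishing (mu_zero_J r S I')" "p \<in> mu_zero_J r S I" for f and p :: "'n + 'n \<Rightarrow> 'a"
  proof -
    have "p \<in> zclosure (mu_zero_J r S I')" using that(2) sub zclosure_superset by blast
    then show ?thesis using that(1) by (auto simp: zclosure_eq zero_set_def)
  qed
  have "i \<in> I'" if "i \<in> I" for i
  proof (rule ccontr)
    assume "i \<notin> I'"
    then have "(Var (Inl i) :: ('n + 'n, 'a) mpoly) \<in> vanishing (mu_zero_J r S I')"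
      by (auto simp: vanishing_def mu_zero_J_iff peval_simps)
    moreover have "case_sum (\<lambda>i. if i \<in> I then 1 else 0) (\<lambda>_. 0) \<in> (mu_zero_J r S I :: ('n + 'n \<Rightarrow> 'a) set)"
      by (simp add: mu_zero_J_iff linear_rel_0)
    ultimately show False using vanish that by (fastforce simp: peval_simps)
  qed
  moreover have "i \<notin> I'" if "i \<notin> I" for i
  proof
    assume i: "i \<in> I'"
    have "i \<in> Z" using that I(1) by auto
    then have "p (Inr i) = 0" if "p \<in> mu_zero_J r S I'" for p :: "'n + 'n \<Rightarrow> 'a"
      using that i linear_rel_Z[of "\<lambda>i. p (Inl i) * p (Inr i)" i] by (auto simp: mu_zero_J_iff)
    then have "(Var (Inr i) :: ('n + 'n, 'a) mpoly) \<in> vanishing (mu_zero_J r S I')"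
      by (auto simp: vanishing_def peval_simps)
    moreover have "case_sum (\<lambda>i. if i \<in> I then 1 else 0) (\<lambda>k. if k = i then 1 else 0) \<in> (mu_zero_J r S I :: ('n + 'n \<Rightarrow> 'a) set)"
    proof -
      have "(\<lambda>k. (if k \<in> I then 1 else 0) * (if k = i then 1 else 0)) = (\<lambda>_. 0 :: 'a)" using that by auto
      then show ?thesis by (simp add: mu_zero_J_iff linear_rel_0)
    qed
    ultimately show False using vanish by (fastforce simp: peval_simps)
  qed
  ultimately show ?thesis by blast
qed

lemma components_mu_zero:
  "{C. irreducible_component C (mu_zero r S :: ('n + 'n \<Rightarrow> 'a::field_char_0) set)} = {zclosure (mu_zero_J r S I) | I. - I \<subseteq> Z}"
  unfolding mu_zero_Union
proof (rule irreducible_components_Union)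
  show "finite {zclosure (mu_zero_J r S I :: ('n + 'n \<Rightarrow> 'a) set) | I. - I \<subseteq> Z}" by simp
  show "zirreducible X" if "X \<in> {zclosure (mu_zero_J r S I) | I. - I \<subseteq> Z}" for X :: "('n + 'n \<Rightarrow> 'a) set"
    using that zirreducible_closure_J by auto
  show "X = Y" if "X \<in> {zclosure (mu_zero_J r S I) | I. - I \<subseteq> Z}" "Y \<in> {zclosure (mu_zero_J r S I) | I. - I \<subseteq> Z}" "X \<subseteq> Y"
    for X Y :: "('n + 'n \<Rightarrow> 'a) set"
    using that closure_J_subsetD by blast
qed

section \<open>Irreducibility, normality and rank conditions through \<open>Z\<close>\<close>

lemma zirreducible_mu_zero_iff: "zirreducible (mu_zero r S :: ('n + 'n \<Rightarrow> 'a::field_char_0) set) \<longleftrightarrow> Z = {}"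
proof
  assume irr: "zirreducible (mu_zero r S :: ('n + 'n \<Rightarrow> 'a) set)"
  have whole: "zclosure (mu_zero_J r S I) = (mu_zero r S :: ('n + 'n \<Rightarrow> 'a) set)" if "- I \<subseteq> Z" for I
  proof -
    have "irreducible_component (zclosure (mu_zero_J r S I)) (mu_zero r S :: ('n + 'n \<Rightarrow> 'a) set)"
      using components_mu_zero that by blast
    with irr show ?thesis unfolding irreducible_component_def by auto
  qed
  \<comment> \<open>The labels \<open>UNIV\<close> and \<open>- Z\<close> are the two extremes; if
    both closures are the whole fibre, the labels agree.\<close>
  show "Z = {}"
    using closure_J_subsetD[of UNIV "- Z", where 'a = 'a] whole[of UNIV] whole[of "- Z"] by auto
next
  assume "Z = {}"
  then have "- I \<subseteq> Z \<longleftrightarrow> I = UNIV" for I by auto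
  then have "mu_zero r S = zclosure (mu_zero_J r S UNIV :: ('n + 'n \<Rightarrow> 'a) set)"
    unfolding mu_zero_Union by simp
  then show "zirreducible (mu_zero r S :: ('n + 'n \<Rightarrow> 'a) set)" using zirreducible_closure_J by metis
qed

text \<open>The coordinate axes lie in the zero fibre; hence for \<open>i \<in> Z\<close> neither factor of \<open>x i * \<phi> i = 0\<close>
  vanishes in the local ring at the origin.\<close>

lemma normal_imp_Z_empty:
  assumes "normal_quot (mu_ideal r S :: ('n + 'n, 'a::field_char_0) mpoly set)"
  shows "Z = {}"
proof (rule ccontr)
  let ?J = "mu_ideal r S :: ('n + 'n, 'a) mpoly set"
  assume "Z \<noteq> {}"
  then obtain i where i: "i \<in> Z" by auto
  let ?Q = "vanishing {\<lambda>_. 0} :: ('n + 'n, 'a) mpoly set"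
  have "prime_ideal ?Q"
    unfolding prime_ideal_def
    by (intro conjI is_ideal_vanishing) (auto simp: vanishing_def peval_simps)
  moreover have "?J \<subseteq> ?Q" by (simp add: mu_ideal_subset_vanishing_iff linear_rel_0)
  ultimately have "normal_local ?J ?Q" using assms by (simp add: normal_quot_def)
  then have dom: "loc_zero ?J ?Q (a * b) \<Longrightarrow> loc_zero ?J ?Q a \<or> loc_zero ?J ?Q b" for a b
    unfolding normal_local_def by blast
  have "(gpol i :: ('n + 'n, 'a) mpoly) = Var (Inl i) * Var (Inr i)"
    using i by (simp add: gpol_def Z_def)
  then have "1 \<notin> ?Q \<and> 1 * (Var (Inl i) * Var (Inr i)) \<in> ?J"
    using gpol_mem[of i, where 'a = 'a] by (auto simp: vanishing_def peval_simps)
  then have "loc_zero ?J ?Q (Var (Inl i) * Var (Inr i))" unfolding loc_zero_def by blast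
  then obtain v where "loc_zero ?J ?Q (Var v)" using dom by blast
  then obtain f where f: "f \<notin> ?Q" "f * Var v \<in> ?J" by (auto simp: loc_zero_def)
  \<comment> \<open>On this axis away from the origin the factor \<open>Var v\<close> cancels, so
    \<open>f\<close> vanishes there and hence at the origin, against
    \<open>f \<notin> ?Q\<close>.\<close>
  define \<gamma> where "\<gamma> s = (\<lambda>w. if w = v then s else 0)" for s :: 'a
  have away: "peval (\<gamma> s) f = 0" if "s \<noteq> 0" for s
  proof -
    have "(\<lambda>i. \<gamma> s (Inl i) * \<gamma> s (Inr i)) = (\<lambda>_. 0)" by (auto simp: \<gamma>_def)
    then have "?J \<subseteq> vanishing {\<gamma> s}" by (simp add: mu_ideal_subset_vanishing_iff linear_rel_0)
    then have "peval (\<gamma> s) (f * Var v) = 0" using f(2) by (auto simp: vanishing_def)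
    then show ?thesis using that by (simp add: peval_simps \<gamma>_def)
  qed
  have "\<gamma> s w = poly (if w = v then [:0, 1:] else 0) s" for s w by (simp add: \<gamma>_def)
  then have "\<exists>F. \<forall>s. \<gamma> s w = poly F s" for w by blast
  from peval_limit_zero[of \<gamma> f, OF this away] have "peval (\<gamma> 0) f = 0" by blast
  moreover have "\<gamma> 0 = (\<lambda>_. 0)" by (auto simp: \<gamma>_def)
  ultimately show False using f(1) by (simp add: vanishing_def)
qed

lemma normal_mu_ideal_iff:
  "normal_quot (mu_ideal r S :: ('n + 'n, 'a::field_char_0) mpoly set) \<longleftrightarrow> Z = {}"
  using normal_mu_ideal normal_imp_Z_empty by blast

text \<open>Frees \<open>Z\<close> from the choice of basis: columns of \<open>\<Lambda>\<close> at
  free indices are row relations, and every relation is determined by its free entries through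
  \<open>\<Lambda>\<close>.\<close>

lemma Z_eq: "Z = {i. \<forall>c::'n \<Rightarrow> rat. (\<forall>k<r. (\<Sum>i\<in>UNIV. c i * of_int (S i k)) = 0) \<longrightarrow> c i = 0}"
proof (intro equalityI subsetI)
  have hom: "coeff_hom (\<lambda>x::rat. x)" by unfold_locales auto
  fix i
  {
    assume i: "i \<in> Z"
    have "c i = 0" if c: "\<forall>k<r. (\<Sum>i\<in>UNIV. c i * of_int (S i k)) = 0" for c :: "'n \<Rightarrow> rat"
    proof -
      have "i \<in> P" using i Z_subset by auto
      from pivot_via_relations[OF hom this, of c] c
      have "c i = (\<Sum>j\<in>- P. \<Lambda> i j * c j)" by (simp add: mult.commute)
      also have "\<dots> = 0" using i by (intro sum.neutral) (auto simp: Z_def)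
      finally show ?thesis .
    qed
    then show "i \<in> {i. \<forall>c::'n \<Rightarrow> rat. (\<forall>k<r. (\<Sum>i\<in>UNIV. c i * of_int (S i k)) = 0) \<longrightarrow> c i = 0}" by blast
  next
    assume i: "i \<in> {i. \<forall>c::'n \<Rightarrow> rat. (\<forall>k<r. (\<Sum>i\<in>UNIV. c i * of_int (S i k)) = 0) \<longrightarrow> c i = 0}"
    have "\<Lambda> i j = 0" if j: "j \<in> - P" for j
    proof -
      have "(\<Sum>l\<in>- P. \<Lambda> a l * \<Lambda> l j) = \<Lambda> a j" for a
      proof -
        have "(\<Sum>l\<in>- P. \<Lambda> a l * \<Lambda> l j) = (\<Sum>l\<in>- P. if l = j then \<Lambda> a j else 0)"
          by (intro sum.cong refl) (auto simp: coeff_free)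
        then show ?thesis using j by simp
      qed
      then have "(\<Sum>a\<in>UNIV. of_int (S a k) * \<Lambda> a j) = 0" if "k < r" for k
        using relation_via_pivots[OF hom that, of "\<lambda>a. \<Lambda> a j"] by simp
      then have "\<forall>k<r. (\<Sum>a\<in>UNIV. \<Lambda> a j * of_int (S a k)) = 0" by (simp add: mult.commute)
      then show ?thesis using i by (auto dest: spec[of _ "\<lambda>a. \<Lambda> a j"])
    qed
    then show "i \<in> Z" by (simp add: Z_def)
  }
qed

lemma rank_condition_iff: "rank_rows r S UNIV = rank_rows r S I + card (- I) \<longleftrightarrow> - I \<subseteq> Z"
  unfolding Z_eq by (rule rank_rows_diff_eq_iff)

end

section \<open>Choice of a row basis and conclusion\<close>

lemma pivot_rows_exist:
  fixes S :: "'n::finite \<Rightarrow> nat \<Rightarrow> int"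
  obtains P \<Lambda> t where "pivot_rows r S P \<Lambda> t"
proof -
  obtain P where P: "rows_indep r S P" "card P = rank_rows r S UNIV"
    using rank_rows_attained[of UNIV r S] by auto
  obtain t where t: "\<forall>i\<in>P. \<forall>k\<in>P. (\<Sum>j<r. t i j * of_int (S k j)) = (if i = k then 1 else (0::rat))"
    using rows_indep_dual[OF _ P(1)] by auto
  have "\<forall>j. \<exists>\<alpha>::'n \<Rightarrow> rat. \<forall>k<r. of_int (S j k) = (\<Sum>a\<in>P. \<alpha> a * of_int (S a k))"
    using rank_rows_spanning[OF _ P] by auto
  then obtain \<alpha> :: "'n \<Rightarrow> 'n \<Rightarrow> rat" where
    \<alpha>: "\<And>j k. k < r \<Longrightarrow> of_int (S j k) = (\<Sum>a\<in>P. \<alpha> j a * of_int (S a k))" by metis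
  \<comment> \<open>For free \<open>j\<close>, column \<open>j\<close> is the relation between row
    \<open>j\<close>, with coefficient \<open>1\<close>, and the basis rows; bringing these to the
    same side causes the minus sign.\<close>
  define \<Lambda> where "\<Lambda> i j = (if i \<in> P then - \<alpha> j i else if i = j then 1 else 0)" for i j
  have "pivot_rows r S P \<Lambda> t"
  proof
    show "of_int (S j k) = - (\<Sum>i\<in>P. \<Lambda> i j * of_int (S i k))" if "j \<notin> P" "k < r" for j k
      using \<alpha>[OF that(2), of j] by (simp add: \<Lambda>_def sum_negf)
  qed (use t P in \<open>auto simp: \<Lambda>_def\<close>)
  then show ?thesis by (rule that)
qed

theorem theorem2p2:
  fixes r :: nat and S :: "'n::finite \<Rightarrow> nat \<Rightarrow> int"
  assumes "alg_closed TYPE('a::field_char_0)"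
  shows "(reduced_quot (mu_ideal r S :: ('n + 'n, 'a) mpoly set)
          \<and> complete_intersection (2 * card (UNIV :: 'n set)) (mu_ideal r S :: ('n + 'n, 'a) mpoly set)
          \<and> krull_dim_quot (mu_ideal r S :: ('n + 'n, 'a) mpoly set)
              (2 * card (UNIV :: 'n set) - rank_rows r S UNIV))
       \<and> ({C. irreducible_component C (mu_zero r S :: ('n + 'n \<Rightarrow> 'a) set)} =
          {zclosure (mu_zero_J r S I :: ('n + 'n \<Rightarrow> 'a) set) | I.
             int (rank_rows r S UNIV) - int (rank_rows r S I) = int (card (UNIV :: 'n set)) - int (card I)})
       \<and> (zirreducible (mu_zero r S :: ('n + 'n \<Rightarrow> 'a) set) \<longleftrightarrow>
          (\<forall>i. rank_rows r S (UNIV - {i}) = rank_rows r S UNIV))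
       \<and> (normal_quot (mu_ideal r S :: ('n + 'n, 'a) mpoly set) \<longleftrightarrow>
          zirreducible (mu_zero r S :: ('n + 'n \<Rightarrow> 'a) set))"
proof -
  obtain P \<Lambda> t where "pivot_rows r S P \<Lambda> t" by (rule pivot_rows_exist)
  then interpret pivot_rows r S P \<Lambda> t .
  have rank: "int (rank_rows r S UNIV) - int (rank_rows r S I) = int (card (UNIV :: 'n set)) - int (card I) \<longleftrightarrow> - I \<subseteq> Z" for I
  proof -
    have "card (- I) + card I = card (UNIV :: 'n set)"
      by (subst card_Un_disjoint[symmetric]) auto
    then show ?thesis unfolding rank_condition_iff[symmetric] by linarith
  qed
  have Z_empty: "Z = {} \<longleftrightarrow> (\<forall>i. rank_rows r S (UNIV - {i}) = rank_rows r S UNIV)"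
  proof -
    \<comment> \<open>Deleting one row lowers the rank by at most one, and by exactly one precisely
      when \<open>i \<in> Z\<close>.\<close>
    have "i \<notin> Z \<longleftrightarrow> rank_rows r S (UNIV - {i}) = rank_rows r S UNIV" for i
    proof -
      have compl: "- (UNIV - {i}) = {i}" by auto
      obtain J where "rows_indep r S J" "card J = rank_rows r S (UNIV - {i})"
        using rank_rows_attained[of "UNIV - {i}" r S] by auto
      then have "rank_rows r S (UNIV - {i}) \<le> rank_rows r S UNIV" by (metis rank_rows_ge subset_UNIV)
      moreover have "rank_rows r S UNIV \<le> rank_rows r S (UNIV - {i}) + 1"
        using rank_rows_diff_le[of r S "UNIV - {i}"] by (simp add: compl)
      moreover have "rank_rows r S UNIV = rank_rows r S (UNIV - {i}) + 1 \<longleftrightarrow> i \<in> Z"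
        using rank_condition_iff[of "UNIV - {i}"] by (simp add: compl)
      ultimately show ?thesis by linarith
    qed
    then show ?thesis by blast
  qed
  show ?thesis
    unfolding rank zirreducible_mu_zero_iff normal_mu_ideal_iff components_mu_zero
    using reduced_mu_ideal complete_intersection_mu_ideal krull_dim_mu_ideal Z_empty by blast
qed

end
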